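(* Let $B$ be a catacondensed benzenoid graph with $n$ hexagons. Then $$\mathrm{Cl}(B) \leq \left\lfloor \frac{2n+1}{3} \right\rfloor,$$ and equality holds if and only if $B$ belongs to the family $\mathcal{B}$ (defined inductively in the context).
   Context: A benzenoid graph is a 2-connected (plane) graph in which all inner faces are hexagons (and all hexagons are faces), such that two hexagons are either disjoint or have exactly one common edge, and no three hexagons share a common edge. (It is not required to be embeddable in the regular hexagonal lattice.) Two hexagons are adjacent if they have a common edge. A vertex shared by three hexagons is called internal; a benzenoid graph is catacondensed if it has no internal vertices. For a matching $M$ of a benzenoid graph $B$, a hexagon $h$ of $B$ is $M$-alternating if $M$ contains exactly 3 edges of $h$. A set of hexagons is independent if its hexagons are pairwise disjoint. The Clar number $\mathrm{Cl}(B)$ is the maximum, over all perfect matchings $M$ of $B$, of the cardinality of an independent set of $M$-alternating hexagons of $B$. The dualist graph $T(B)$ of $B$ has the hexagons of $B$ as vertices, two being adjacent if and only if the corresponding hexagons have a common edge; for $B$ catacondensed, $T(B)$ is a tree with all degrees at most 3. A hexagon adjacent to exactly two other hexagons, in a catacondensed benzenoid graph, has exactly two vertices of degree 2; it is called angular if these two vertices are adjacent, and linear otherwise. For an integer $k\ge 2$, the tree $T_k$ is composed of the path on vertices $v_1,\ldots,v_{2k+1}$ (in this order) with $k-2$ additional leaves, one attached to each of the vertices $v_4,v_6,\ldots,v_{2k-2}$ (so $T_2$ is the path on 5 vertices). Let $B_1$ denote the catacondensed benzenoid graph with three hexagons in which the hexagon adjacent to the two other hexagons is angular, and let $e_1$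 be the edge of this angular hexagon with both end-vertices of degree 2. The family $\mathcal{B}$ of catacondensed benzenoid graphs is defined inductively (graphs being considered up to isomorphism) as the smallest family such that: (i) the benzenoid graph with one hexagon, the benzenoid graph with two hexagons, and $B_1$ belong to $\mathcal{B}$; (ii) every catacondensed benzenoid graph $B$ such that $T(B)\simeq T_k$ for some $k\ge 2$ and such that the two hexagons corresponding to the vertices $v_2$ and $v_{2k}$ are both angular belongs to $\mathcal{B}$; (iii) if $B'\in\mathcal{B}$ and $e'$ is any edge of $B'$ with both end-vertices of degree 2, then the benzenoid graph obtained from (disjoint copies of) $B'$ and $B_1$ by identifying the edges $e'$ and $e_1$ belongs to $\mathcal{B}$. *)

theory Defs
  imports "HOL-Analysis.Analysis"
begin

section \<open>Finite simple graphs\<close>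

text \<open>A graph is a pair of a vertex set and a set of edges, an edge being a two-element set.\<close>

type_synonym 'a graph = "'a set \<times> 'a set set"

abbreviation verts :: "'a graph \<Rightarrow> 'a set" where
  "verts G \<equiv> fst G"

abbreviation edges :: "'a graph \<Rightarrow> 'a set set" where
  "edges G \<equiv> snd G"

definition simple_graph :: "'a graph \<Rightarrow> bool" where
  "simple_graph G \<longleftrightarrow> finite (verts G) \<and> (\<forall>e\<in>edges G. e \<subseteq> verts G \<and> card e = 2)"

definition degree :: "'a graph \<Rightarrow> 'a \<Rightarrow> nat" where
  "degree G v = card {e \<in> edges G. v \<in> e}"

definition graph_connected :: "'a graph \<Rightarrow> bool" where
  "graph_connected G \<longleftrightarrow> verts G \<noteq> {} \<and>
     (\<forall>u\<in>verts G. \<forall>v\<in>verts G. (u, v) \<in> {(x, y). {x, y} \<in> edges G}\<^sup>*)"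

definition delete_vertex :: "'a graph \<Rightarrow> 'a \<Rightarrow> 'a graph" where
  "delete_vertex G w = (verts G - {w}, {e \<in> edges G. w \<notin> e})"

definition two_connected :: "'a graph \<Rightarrow> bool" where
  "two_connected G \<longleftrightarrow> card (verts G) \<ge> 3 \<and> graph_connected G \<and>
     (\<forall>w\<in>verts G. graph_connected (delete_vertex G w))"

definition graph_iso :: "('a \<Rightarrow> 'b) \<Rightarrow> 'a graph \<Rightarrow> 'b graph \<Rightarrow> bool" where
  "graph_iso f G H \<longleftrightarrow> bij_betw f (verts G) (verts H) \<and> (\<lambda>e. f ` e) ` edges G = edges H"

definition perfect_matching :: "'a graph \<Rightarrow> 'a set set \<Rightarrow> bool" where
  "perfect_matching G M \<longleftrightarrow> M \<subseteq> edges G \<and> (\<forall>v\<in>verts G. \<exists>!e. e \<in> M \<and> v \<in> e)"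


section \<open>Drawings in the plane\<close>

text \<open>Vertices are drawn as distinct points and edges as arcs joining their end-vertices; arcs
  meet the vertex points and each other only in common end-vertices.\<close>

definition plane_drawing :: "'a graph \<Rightarrow> ('a \<Rightarrow> complex) \<Rightarrow> ('a set \<Rightarrow> real \<Rightarrow> complex) \<Rightarrow> bool" where
  "plane_drawing G p \<gamma> \<longleftrightarrow> inj_on p (verts G) \<and>
     (\<forall>e\<in>edges G. arc (\<gamma> e) \<and> {pathstart (\<gamma> e), pathfinish (\<gamma> e)} = p ` e \<and>
        path_image (\<gamma> e) \<inter> p ` verts G = p ` e) \<and>
     (\<forall>e\<in>edges G. \<forall>e'\<in>edges G. e \<noteq> e' \<longrightarrow>
        path_image (\<gamma> e) \<inter> path_image (\<gamma> e') \<subseteq> p ` (e \<inter> e'))"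

definition drawn_edges :: "('a set \<Rightarrow> real \<Rightarrow> complex) \<Rightarrow> 'a set set \<Rightarrow> complex set" where
  "drawn_edges \<gamma> F = (\<Union>e\<in>F. path_image (\<gamma> e))"

definition faces :: "'a graph \<Rightarrow> ('a \<Rightarrow> complex) \<Rightarrow> ('a set \<Rightarrow> real \<Rightarrow> complex) \<Rightarrow> complex set set" where
  "faces G p \<gamma> = components (- (p ` verts G \<union> drawn_edges \<gamma> (edges G)))"

definition inner_faces :: "'a graph \<Rightarrow> ('a \<Rightarrow> complex) \<Rightarrow> ('a set \<Rightarrow> real \<Rightarrow> complex) \<Rightarrow> complex set set" where
  "inner_faces G p \<gamma> = {\<phi> \<in> faces G p \<gamma>. bounded \<phi>}"


section \<open>Benzenoid graphs\<close>

definition cycle_edges :: "'a list \<Rightarrow> 'a set set" where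
  "cycle_edges xs = {{xs ! i, xs ! (Suc i mod length xs)} | i. i < length xs}"

text \<open>A hexagon is a cycle of length 6, represented by its set of edges; its set of vertices is
  the union of that set. Since in a benzenoid graph the 6-cycles are precisely the boundaries of
  the inner faces, the hexagons depend on the graph only and not on the drawing.\<close>

definition hexagons :: "'a graph \<Rightarrow> 'a set set set" where
  "hexagons G = {cycle_edges xs | xs. length xs = 6 \<and> distinct xs \<and> cycle_edges xs \<subseteq> edges G}"

definition benzenoid :: "'a graph \<Rightarrow> bool" where
  "benzenoid G \<longleftrightarrow> simple_graph G \<and> two_connected G \<and>
     (\<exists>p \<gamma>. plane_drawing G p \<gamma> \<and>
        (\<forall>\<phi>\<in>inner_faces G p \<gamma>. \<exists>h\<in>hexagons G. frontier \<phi> = drawn_edges \<gamma> h) \<and>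
        (\<forall>h\<in>hexagons G. \<exists>\<phi>\<in>inner_faces G p \<gamma>. frontier \<phi> = drawn_edges \<gamma> h)) \<and>
     (\<forall>h\<in>hexagons G. \<forall>h'\<in>hexagons G. h \<noteq> h' \<longrightarrow> \<Union>h \<inter> \<Union>h' = {} \<or> card (h \<inter> h') = 1) \<and>
     (\<forall>e\<in>edges G. card {h \<in> hexagons G. e \<in> h} \<le> 2)"

definition internal_vertex :: "'a graph \<Rightarrow> 'a \<Rightarrow> bool" where
  "internal_vertex G v \<longleftrightarrow> v \<in> verts G \<and> card {h \<in> hexagons G. v \<in> \<Union>h} \<ge> 3"

definition catacondensed :: "'a graph \<Rightarrow> bool" where
  "catacondensed G \<longleftrightarrow> benzenoid G \<and> (\<forall>v. \<not> internal_vertex G v)"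

definition adjacent_hexagons :: "'a set set \<Rightarrow> 'a set set \<Rightarrow> bool" where
  "adjacent_hexagons h h' \<longleftrightarrow> h \<noteq> h' \<and> h \<inter> h' \<noteq> {}"

definition dualist :: "'a graph \<Rightarrow> 'a set set graph" where
  "dualist G = (hexagons G,
     {{h, h'} | h h'. h \<in> hexagons G \<and> h' \<in> hexagons G \<and> adjacent_hexagons h h'})"

definition angular :: "'a graph \<Rightarrow> 'a set set \<Rightarrow> bool" where
  "angular G h \<longleftrightarrow> h \<in> hexagons G \<and> card {h' \<in> hexagons G. adjacent_hexagons h h'} = 2 \<and>
     (\<exists>u v. {w \<in> \<Union>h. degree G w = 2} = {u, v} \<and> u \<noteq> v \<and> {u, v} \<in> edges G)"


section \<open>The Clar number\<close>

definition alternating :: "'a set set \<Rightarrow> 'a set set \<Rightarrow> bool" where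
  "alternating M h \<longleftrightarrow> card (M \<inter> h) = 3"

definition independent_hexagons :: "'a set set set \<Rightarrow> bool" where
  "independent_hexagons S \<longleftrightarrow> pairwise (\<lambda>h h'. \<Union>h \<inter> \<Union>h' = {}) S"

definition clar_number :: "'a graph \<Rightarrow> nat" where
  "clar_number G = Max {card S | M S. perfect_matching G M \<and>
     S \<subseteq> {h \<in> hexagons G. alternating M h} \<and> independent_hexagons S}"


section \<open>The extremal family\<close>

text \<open>The tree \<open>T\<^sub>k\<close>: \<open>Inl i\<close> is the path vertex \<open>v\<^sub>i\<close>, and \<open>Inr i\<close> is the additional leaf
  attached to \<open>v\<^sub>i\<close>, for \<open>i = 4, 6, \<dots>, 2k - 2\<close>.\<close>

definition tree_T :: "nat \<Rightarrow> (nat + nat) graph" where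
  "tree_T k =
     (Inl ` {1..2 * k + 1} \<union> {Inr (2 * j) | j. 2 \<le> j \<and> j + 1 \<le> k},
      {{Inl i, Inl (i + 1)} | i. 1 \<le> i \<and> i \<le> 2 * k} \<union>
      {{Inl (2 * j), Inr (2 * j)} | j. 2 \<le> j \<and> j + 1 \<le> k})"

text \<open>\<open>is_B1 C e\<close>: \<open>C\<close> is a copy of \<open>B\<^sub>1\<close>, and \<open>e\<close> is its edge \<open>e\<^sub>1\<close>.\<close>

definition is_B1 :: "'a graph \<Rightarrow> 'a set \<Rightarrow> bool" where
  "is_B1 C e \<longleftrightarrow> catacondensed C \<and> card (hexagons C) = 3 \<and>
     (\<exists>h. angular C h \<and> e \<in> h \<and> (\<forall>v\<in>e. degree C v = 2))"

text \<open>The family is closed under isomorphism: \<open>one\<close>, \<open>two\<close>, \<open>B1\<close> and \<open>Tk\<close> admit all graphs with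
  the stated property. In \<open>glue\<close>, identifying \<open>e'\<close> with \<open>e\<^sub>1\<close> in disjoint copies of \<open>B'\<close> and \<open>B\<^sub>1\<close>
  is expressed as the union of a copy of \<open>B'\<close> and a copy of \<open>B\<^sub>1\<close> that intersect precisely in the
  edge \<open>e = e' = e\<^sub>1\<close> and its end-vertices.\<close>

inductive in_family :: "'a graph \<Rightarrow> bool" where
  one: "catacondensed B \<Longrightarrow> card (hexagons B) = 1 \<Longrightarrow> in_family B"
| two: "catacondensed B \<Longrightarrow> card (hexagons B) = 2 \<Longrightarrow> in_family B"
| B1: "is_B1 B e \<Longrightarrow> in_family B"
| Tk: "catacondensed B \<Longrightarrow> k \<ge> 2 \<Longrightarrow> graph_iso f (tree_T k) (dualist B) \<Longrightarrow>
       angular B (f (Inl 2)) \<Longrightarrow> angular B (f (Inl (2 * k))) \<Longrightarrow> in_family B"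
| glue: "in_family B' \<Longrightarrow> e \<in> edges B' \<Longrightarrow> (\<forall>v\<in>e. degree B' v = 2) \<Longrightarrow>
         is_B1 C e \<Longrightarrow> verts B' \<inter> verts C = e \<Longrightarrow>
         in_family (verts B' \<union> verts C, edges B' \<union> edges C)"

end

theory Submission
  imports Defs
begin

text \<open>By the Jordan curve theorem, every edge of a cycle lies in a hexagon inside the cycle, and an edge
  off the cycle with a hexagon inside lies in two such hexagons. Applied to cycles through one
  end of a common edge \<open>uv\<close> of two hexagons, this shows that deleting \<open>u\<close> and \<open>v\<close> separates the two
  hexagons. So the graph is glued along \<open>uv\<close> from two smaller graphs, which are again catacondensed because
  erasing one side does not create bounded faces; hence the dualist graph is a tree of maximum
  degree at most 3.

  The hexagons of a Clar set \<open>S\<close> form an independent set of this tree. Each of its \<open>n - 1\<close> edges has an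
  end among the \<open>n - |S|\<close> other hexagons, whence \<open>n - 1 \<le> 3 (n - |S|)\<close>. If the floor is attained, the
  defect in this inequality is at most 2: either some hexagon outside \<open>S\<close> has two
  leaves of \<open>S\<close> among its three neighbours, and they are removed as a copy of \<open>B\<^sub>1\<close>, or a count of the leaves
  shows that at most two hexagons remain or that the tree is the path on three vertices or \<open>T\<^sub>k\<close>.\<close>

section \<open>Cycles and plane drawings\<close>

text \<open>Plane topology enters the graph theory through two facts only: the hexagons inside a
  cycle (\<open>hexagons_inside_cycle\<close>) and the passage to a subdrawing
  (\<open>restrict_drawing\<close>).

  The tree is not built as an object. It is encoded by neighbourhoods that admit no proper nonempty
  closed set and whose sizes sum to \<open>2 * n - 2\<close>, a sum computed by induction over cuts.

  The bound rests on the independence of \<open>S\<close>; the perfect matching matters for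
  equality. It forces a hexagon outside \<open>S\<close> with exactly two neighbours, both in
  \<open>S\<close>, to be angular, and it must survive cutting and gluing; hence the care about the
  edge \<open>{u, v}\<close> at a cut.

  The floor is attained exactly when \<open>2 * n + 1 - 3 * |S|\<close> is at most 2, so equality is
  carried along as \<open>2 * n \<le> 3 * |S| + 1\<close>. Attaching \<open>B1\<close> adds three
  hexagons and two members of \<open>S\<close>, which changes both sides by 6.

  Rule \<open>glue\<close> does not demand that the union be catacondensed. For the direction from
  the family to equality, only the final graph is known to be so, and the property has to be pulled
  back to \<open>B'\<close> along the cut.\<close>

fun path_edges :: "'a list \<Rightarrow> 'a set set" where
  "path_edges (a # b # xs) = insert {a, b} (path_edges (b # xs))"
| "path_edges _ = {}"

lemma path_edge_subset: "e \<in> path_edges xs \<Longrightarrow> e \<subseteq> set xs"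
  by (induction xs rule: path_edges.induct) auto

lemma path_edges_nth: "path_edges xs = {{xs ! i, xs ! Suc i} | i. Suc i < length xs}"
proof (induction xs rule: path_edges.induct)
  case (1 a b xs)
  have "{{(a # b # xs) ! i, (a # b # xs) ! Suc i} | i. Suc i < length (a # b # xs)} =
      insert {a, b} {{(b # xs) ! i, (b # xs) ! Suc i} | i. Suc i < length (b # xs)}" (is "?L = ?R")
  proof
    show "?L \<subseteq> ?R"
    proof
      fix e assume "e \<in> ?L"
      then obtain i where i: "e = {(a # b # xs) ! i, (a # b # xs) ! Suc i}" "Suc i < length (a # b # xs)"
        by blast
      show "e \<in> ?R" using i by (cases i) auto
    qed
    show "?R \<subseteq> ?L"
    proof
      fix e assume "e \<in> ?R"
      then consider "e = {a, b}"
        | i where "e = {(b # xs) ! i, (b # xs) ! Suc i}" "Suc i < length (b # xs)" by blast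
      then show "e \<in> ?L"
      proof cases
        case 1
        then have "e = {(a # b # xs) ! 0, (a # b # xs) ! Suc 0} \<and> Suc 0 < length (a # b # xs)" by simp
        then show ?thesis by blast
      next
        case (2 i)
        then have "e = {(a # b # xs) ! Suc i, (a # b # xs) ! Suc (Suc i)} \<and>
            Suc (Suc i) < length (a # b # xs)" by simp
        then show ?thesis by blast
      qed
    qed
  qed
  then show ?case using 1 by simp
qed auto

text \<open>Isolates the closing edge, so that a drawn cycle becomes an arc followed by one more
  arc.\<close>

lemma cycle_edges_path_edges:
  assumes "xs \<noteq> []"
  shows "cycle_edges xs = insert {last xs, hd xs} (path_edges xs)"
proof
  have m: "Suc (length xs - 1) = length xs" using assms by simp
  show "cycle_edges xs \<subseteq> insert {last xs, hd xs} (path_edges xs)"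
  proof
    fix e assume "e \<in> cycle_edges xs"
    then obtain i where i: "e = {xs ! i, xs ! (Suc i mod length xs)}" "i < length xs"
      unfolding cycle_edges_def by blast
    show "e \<in> insert {last xs, hd xs} (path_edges xs)"
    proof (cases "Suc i < length xs")
      case True
      then show ?thesis using i unfolding path_edges_nth by auto
    next
      case False
      then have "i = length xs - 1" "Suc i = length xs" using i by auto
      then show ?thesis using i assms by (simp add: last_conv_nth hd_conv_nth)
    qed
  qed
  have "{last xs, hd xs} = {xs ! (length xs - 1), xs ! (Suc (length xs - 1) mod length xs)}"
    using assms m by (simp add: last_conv_nth hd_conv_nth)
  moreover have "length xs - 1 < length xs" using assms by simp
  ultimately have "{last xs, hd xs} \<in> cycle_edges xs" unfolding cycle_edges_def by blast
  moreover have "path_edges xs \<subseteq> cycle_edges xs"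
  proof
    fix e assume "e \<in> path_edges xs"
    then obtain i where i: "e = {xs ! i, xs ! Suc i}" "Suc i < length xs"
      unfolding path_edges_nth by blast
    then have "e = {xs ! i, xs ! (Suc i mod length xs)}" "i < length xs" by auto
    then show "e \<in> cycle_edges xs" unfolding cycle_edges_def by blast
  qed
  ultimately show "insert {last xs, hd xs} (path_edges xs) \<subseteq> cycle_edges xs" by blast
qed

definition is_cycle :: "'a graph \<Rightarrow> 'a list \<Rightarrow> bool" where
  "is_cycle G xs \<longleftrightarrow> 3 \<le> length xs \<and> distinct xs \<and> cycle_edges xs \<subseteq> edges G"

lemma hexagon_is_cycle:
  assumes "h \<in> hexagons G" obtains xs where "is_cycle G xs" "h = cycle_edges xs" "length xs = 6"
  using assms unfolding hexagons_def is_cycle_def by auto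

lemma finite_edges: "simple_graph G \<Longrightarrow> finite (edges G)"
  unfolding simple_graph_def by (meson Pow_iff finite_Pow_iff finite_subset subsetI)

lemma hexagon_subset_edges: "h \<in> hexagons G \<Longrightarrow> h \<subseteq> edges G"
  unfolding hexagons_def by auto

lemma finite_hexagons: "simple_graph G \<Longrightarrow> finite (hexagons G)"
  by (rule finite_subset[of _ "Pow (edges G)"]) (auto dest: hexagon_subset_edges simp: finite_edges)

lemma edge_distinct:
  assumes "simple_graph G" "{a, b} \<in> edges G" shows "a \<noteq> b" "a \<in> verts G" "b \<in> verts G"
proof -
  have "card {a, b} = 2" "{a, b} \<subseteq> verts G" using assms unfolding simple_graph_def by auto
  then show "a \<noteq> b" "a \<in> verts G" "b \<in> verts G" by (auto simp: card_insert_if split: if_splits)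
qed

text \<open>A connected set strictly larger than \<open>S\<close> meets \<open>frontier S\<close>,
  and so cannot stay inside \<open>U\<close>.\<close>

lemma component_if_frontier_disjoint:
  assumes "connected S" "S \<noteq> {}" "S \<subseteq> U" "frontier S \<inter> U = {}"
  shows "S \<in> components U"
  unfolding in_components_maximal
proof (intro conjI allI impI)
  fix D assume D: "D \<noteq> {} \<and> S \<subseteq> D \<and> D \<subseteq> U \<and> connected D"
  show "D = S"
  proof (rule ccontr)
    assume "D \<noteq> S"
    then have "D \<inter> S \<noteq> {}" "D - S \<noteq> {}" using D assms(2) by auto
    then have "D \<inter> frontier S \<noteq> {}" using D connected_Int_frontier by blast
    then show False using D assms(4) by blast
  qed
qed (use assms in auto)

section \<open>Drawn cycles as Jordan curves\<close>

locale plane_graph =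
  fixes G :: "'a graph" and p :: "'a \<Rightarrow> complex" and \<gamma> :: "'a set \<Rightarrow> real \<Rightarrow> complex"
  assumes simple: "simple_graph G" and drawing: "plane_drawing G p \<gamma>"
begin

abbreviation "drawn \<equiv> p ` verts G \<union> drawn_edges \<gamma> (edges G)"

lemma arc_edge: "e \<in> edges G \<Longrightarrow> arc (\<gamma> e)"
  and ends_edge: "e \<in> edges G \<Longrightarrow> {pathstart (\<gamma> e), pathfinish (\<gamma> e)} = p ` e"
  and edge_verts: "e \<in> edges G \<Longrightarrow> path_image (\<gamma> e) \<inter> p ` verts G = p ` e"
  and edges_meet: "e \<in> edges G \<Longrightarrow> e' \<in> edges G \<Longrightarrow> e \<noteq> e' \<Longrightarrow>
        path_image (\<gamma> e) \<inter> path_image (\<gamma> e') \<subseteq> p ` (e \<inter> e')"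
  using drawing unfolding plane_drawing_def by auto

lemma drawn_edges_mono: "F \<subseteq> F' \<Longrightarrow> drawn_edges \<gamma> F \<subseteq> drawn_edges \<gamma> F'"
  unfolding drawn_edges_def by blast

text \<open>\<open>plane_drawing\<close> fixes the end points of \<open>\<gamma> e\<close> only as
  an unordered pair, so the arc may have to be reversed before concatenation.\<close>

lemma oriented_arc:
  assumes "{a, b} \<in> edges G"
  obtains g where "arc g" "path_image g = path_image (\<gamma> {a, b})" "pathstart g = p a" "pathfinish g = p b"
proof -
  have "{pathstart (\<gamma> {a, b}), pathfinish (\<gamma> {a, b})} = {p a, p b}"
    using ends_edge[OF assms] by simp
  then consider "pathstart (\<gamma> {a, b}) = p a" "pathfinish (\<gamma> {a, b}) = p b"
    | "pathstart (\<gamma> {a, b}) = p b" "pathfinish (\<gamma> {a, b}) = p a"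
    by (metis doubleton_eq_iff)
  then show thesis
  proof cases
    case 1 then show ?thesis using that arc_edge[OF assms] by blast
  next
    case 2
    show ?thesis
      by (rule that[of "reversepath (\<gamma> {a, b})"])
        (use 2 arc_edge[OF assms] in \<open>auto simp: arc_reversepath\<close>)
  qed
qed

text \<open>Arcs are prepended one at a time. As \<open>a\<close> occurs nowhere later in the list,
  \<open>{a, b}\<close> differs from every later edge, and \<open>edges_meet\<close> leaves only the
  point of \<open>b\<close> in common.\<close>

lemma drawn_path_arc:
  assumes "distinct xs" "2 \<le> length xs" "path_edges xs \<subseteq> edges G"
  shows "\<exists>g. arc g \<and> path_image g = drawn_edges \<gamma> (path_edges xs) \<and>
           pathstart g = p (hd xs) \<and> pathfinish g = p (last xs)"
  using assms
proof (induction xs rule: path_edges.induct)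
  case (1 a b xs)
  have ab: "{a, b} \<in> edges G" using 1 by simp
  obtain g where g: "arc g" "path_image g = path_image (\<gamma> {a, b})" "pathstart g = p a"
    "pathfinish g = p b" using oriented_arc[OF ab] .
  show ?case
  proof (cases xs)
    case Nil
    then show ?thesis using g by (auto simp: drawn_edges_def intro!: exI[of _ g])
  next
    case (Cons c ys)
    then obtain g' where g': "arc g'" "path_image g' = drawn_edges \<gamma> (path_edges (b # xs))"
      "pathstart g' = p b" "pathfinish g' = p (last (b # xs))"
      using 1 by auto
    have meet: "path_image g \<inter> path_image g' \<subseteq> {pathstart g'}"
    proof
      fix z assume z: "z \<in> path_image g \<inter> path_image g'"
      then obtain e where e: "e \<in> path_edges (b # xs)" "z \<in> path_image (\<gamma> e)"
        using g' unfolding drawn_edges_def by blast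
      have sub: "e \<subseteq> set (b # xs)" using path_edge_subset[OF e(1)] .
      have "{a, b} \<noteq> e" using sub 1(2) by auto
      moreover have "e \<in> edges G" using e 1(4) by auto
      ultimately have "z \<in> p ` ({a, b} \<inter> e)" using edges_meet[OF ab] e(2) z g(2) by blast
      then show "z \<in> {pathstart g'}" using sub 1(2) g'(3) by auto
    qed
    have "arc (g +++ g')" using arc_join[OF g(1) g'(1)] g(4) g'(3) meet by simp
    moreover have "path_image (g +++ g') = drawn_edges \<gamma> (path_edges (a # b # xs))"
      using g g' by (simp add: path_image_join drawn_edges_def)
    ultimately show ?thesis using g g' by (intro exI[of _ "g +++ g'"]) auto
  qed
qed auto

lemma drawn_cycle_simple_path:
  assumes "is_cycle G xs"
  obtains g where "simple_path g" "pathfinish g = pathstart g"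
    "path_image g = drawn_edges \<gamma> (cycle_edges xs)"
proof -
  have ne: "xs \<noteq> []" and len: "3 \<le> length xs" and dist: "distinct xs"
    using assms unfolding is_cycle_def by auto
  have sub: "insert {last xs, hd xs} (path_edges xs) \<subseteq> edges G"
    using assms cycle_edges_path_edges[OF ne] unfolding is_cycle_def by simp
  obtain g where g: "arc g" "path_image g = drawn_edges \<gamma> (path_edges xs)"
      "pathstart g = p (hd xs)" "pathfinish g = p (last xs)"
    using drawn_path_arc[of xs] dist len sub by auto
  have lh: "{last xs, hd xs} \<in> edges G" using sub by simp
  obtain g' where g': "arc g'" "path_image g' = path_image (\<gamma> {last xs, hd xs})"
      "pathstart g' = p (last xs)" "pathfinish g' = p (hd xs)"
    using oriented_arc[OF lh] .
  have "path_image g \<inter> path_image g' \<subseteq> {pathstart g, pathstart g'}"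
  proof
    fix z assume z: "z \<in> path_image g \<inter> path_image g'"
    then obtain e where e: "e \<in> path_edges xs" "z \<in> path_image (\<gamma> e)"
      using g unfolding drawn_edges_def by blast
    \<comment> \<open>With at least three vertices the first and last index are not consecutive; on
      two vertices the closing edge would repeat the path edge.\<close>
    have "e \<noteq> {last xs, hd xs}"
    proof
      assume "e = {last xs, hd xs}"
      then obtain i where i: "Suc i < length xs" "{xs ! i, xs ! Suc i} = {xs ! (length xs - 1), xs ! 0}"
        using e ne unfolding path_edges_nth by (auto simp: last_conv_nth hd_conv_nth)
      then have "{i, Suc i} = {length xs - 1, 0}" using dist ne
        by (auto simp: doubleton_eq_iff nth_eq_iff_index_eq)
      then show False using len by (auto simp: doubleton_eq_iff)
    qed
    then have "z \<in> p ` (e \<inter> {last xs, hd xs})" using edges_meet[of e "{last xs, hd xs}"] e sub z g' by blast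
    then show "z \<in> {pathstart g, pathstart g'}" using g g' by auto
  qed
  then have "simple_path (g +++ g')" using simple_path_join_loop[OF g(1) g'(1)] g g' by simp
  moreover have "path_image (g +++ g') = drawn_edges \<gamma> (cycle_edges xs)"
    using g g' cycle_edges_path_edges[OF ne] by (simp add: path_image_join drawn_edges_def Un_commute)
  ultimately show thesis using that[of "g +++ g'"] g g' by simp
qed

lemma Jordan_cycle:
  assumes "is_cycle G xs" and "J = drawn_edges \<gamma> (cycle_edges xs)"
  shows "inside J \<noteq> {}" "open (inside J)" "connected (inside J)" "open (outside J)"
    "connected (outside J)" "bounded (inside J)" "\<not> bounded (outside J)"
    "inside J \<inter> outside J = {}" "inside J \<union> outside J = - J"
    "frontier (inside J) = J" "frontier (outside J) = J"
proof -
  obtain g where g: "simple_path g" "pathfinish g = pathstart g" "path_image g = J"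
    using drawn_cycle_simple_path[OF assms(1)] assms(2) by blast
  show "inside J \<noteq> {}" "open (inside J)" "connected (inside J)" "open (outside J)"
    "connected (outside J)" "bounded (inside J)" "\<not> bounded (outside J)"
    "inside J \<inter> outside J = {}" "inside J \<union> outside J = - J"
    "frontier (inside J) = J" "frontier (outside J) = J"
    using Jordan_inside_outside[OF g(1,2)] unfolding g(3) by auto
qed

lemma compact_drawn: "compact drawn"
proof -
  have "finite (verts G)" using simple unfolding simple_graph_def by simp
  then have "compact (p ` verts G)" by (simp add: finite_imp_compact)
  moreover have "compact (drawn_edges \<gamma> (edges G))"
    unfolding drawn_edges_def
    by (intro compact_UN finite_edges simple) (use arc_edge in \<open>auto simp: compact_arc_image\<close>)
  ultimately show ?thesis by (rule compact_Un)
qed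

lemma face_open: "\<phi> \<in> faces G p \<gamma> \<Longrightarrow> open \<phi>"
  and face_connected: "\<phi> \<in> faces G p \<gamma> \<Longrightarrow> connected \<phi>"
  and face_subset: "\<phi> \<in> faces G p \<gamma> \<Longrightarrow> \<phi> \<subseteq> - drawn"
  and face_nonempty: "\<phi> \<in> faces G p \<gamma> \<Longrightarrow> \<phi> \<noteq> {}"
proof -
  assume \<phi>: "\<phi> \<in> faces G p \<gamma>"
  have "open (- drawn)" using compact_imp_closed[OF compact_drawn] by (rule open_Compl)
  then show "open \<phi>" using \<phi> unfolding faces_def by (rule open_components)
  show "connected \<phi>" "\<phi> \<subseteq> - drawn" "\<phi> \<noteq> {}"
    using \<phi> unfolding faces_def
    by (rule in_components_connected in_components_subset in_components_nonempty)+
qed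

text \<open>Provides a test point at which the two sides of an edge are inspected. Any interior
  parameter would do: injectivity keeps the point off the ends, hence off all vertices and all other
  edges.\<close>

lemma edge_midpoint:
  assumes "e \<in> edges G"
  obtains x where "x \<in> path_image (\<gamma> e)" "x \<notin> p ` verts G"
    "\<forall>e'\<in>edges G. x \<in> path_image (\<gamma> e') \<longrightarrow> e' = e"
proof -
  let ?x = "\<gamma> e (1/2)"
  have a: "inj_on (\<gamma> e) {0..1}" using arc_edge[OF assms] unfolding arc_def by simp
  have x: "?x \<in> path_image (\<gamma> e)" unfolding path_image_def by auto
  have "?x \<noteq> pathstart (\<gamma> e)" "?x \<noteq> pathfinish (\<gamma> e)"
    unfolding pathstart_def pathfinish_def using inj_onD[OF a, of "1/2" 0] inj_onD[OF a, of "1/2" 1] by auto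
  then have "?x \<notin> p ` e" using ends_edge[OF assms] by auto
  then have v: "?x \<notin> p ` verts G" using edge_verts[OF assms] x by blast
  have "\<forall>e'\<in>edges G. ?x \<in> path_image (\<gamma> e') \<longrightarrow> e' = e"
    using edges_meet[OF assms] x \<open>?x \<notin> p ` e\<close> by blast
  then show thesis using that x v by blast
qed

end

text \<open>The two face conditions of \<open>benzenoid\<close> on their own: in this form they can
  be transferred to a subdrawing by topology alone.\<close>

locale benzenoid_drawing = plane_graph +
  assumes face_hexagon: "\<And>\<phi>. \<phi> \<in> inner_faces G p \<gamma> \<Longrightarrow> \<exists>h\<in>hexagons G. frontier \<phi> = drawn_edges \<gamma> h"
    and hexagon_face: "\<And>h. h \<in> hexagons G \<Longrightarrow> \<exists>\<phi>\<in>inner_faces G p \<gamma>. frontier \<phi> = drawn_edges \<gamma> h"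
begin

text \<open>The face misses the curve \<open>?J\<close>, which is its own frontier, so a side of
  \<open>?J\<close> that meets the face is contained in it. For the unbounded outside this is
  impossible; hence the face meets the inside, and the two contain each other.\<close>

lemma inner_face_is_inside:
  assumes "h \<in> hexagons G" "\<phi> \<in> inner_faces G p \<gamma>" "frontier \<phi> = drawn_edges \<gamma> h"
  shows "\<phi> = inside (drawn_edges \<gamma> h)"
proof -
  let ?J = "drawn_edges \<gamma> h"
  obtain xs where xs: "is_cycle G xs" "h = cycle_edges xs" using hexagon_is_cycle[OF assms(1)] .
  have J: "?J = drawn_edges \<gamma> (cycle_edges xs)" using xs by simp
  note Jd = Jordan_cycle[OF xs(1) J]
  have f: "\<phi> \<in> faces G p \<gamma>" "bounded \<phi>" using assms(2) unfolding inner_faces_def by auto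
  have "?J \<subseteq> drawn" using drawn_edges_mono[OF hexagon_subset_edges[OF assms(1)]] by blast
  then have d: "\<phi> \<inter> ?J = {}" using face_subset[OF f(1)] by blast
  have absorb: "W \<subseteq> \<phi>" if "connected W" "W \<inter> ?J = {}" "W \<inter> \<phi> \<noteq> {}" for W
    using connected_Int_frontier[OF that(1,3)] assms(3) that(2) by blast
  have absorb': "\<phi> \<subseteq> W" if "frontier W = ?J" "W \<inter> \<phi> \<noteq> {}" for W
    using connected_Int_frontier[OF face_connected[OF f(1)], of W] that d by blast
  have "\<phi> \<inter> outside ?J = {}"
  proof (rule ccontr)
    assume "\<phi> \<inter> outside ?J \<noteq> {}"
    then have "outside ?J \<subseteq> \<phi>" using absorb[OF Jd(5)] Jd(9) by blast
    then show False using f(2) Jd(7) bounded_subset by blast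
  qed
  then have "inside ?J \<inter> \<phi> \<noteq> {}" using d Jd(9) face_nonempty[OF f(1)] by blast
  then show ?thesis using absorb[OF Jd(3)] absorb'[OF Jd(10)] Jd(9) by blast
qed

lemma inner_faces_eq: "inner_faces G p \<gamma> = (\<lambda>h. inside (drawn_edges \<gamma> h)) ` hexagons G"
proof
  show "inner_faces G p \<gamma> \<subseteq> (\<lambda>h. inside (drawn_edges \<gamma> h)) ` hexagons G"
    using face_hexagon inner_face_is_inside by blast
  show "(\<lambda>h. inside (drawn_edges \<gamma> h)) ` hexagons G \<subseteq> inner_faces G p \<gamma>"
    using hexagon_face inner_face_is_inside by blast
qed

text \<open>The complement of a bounded set in the plane has at most one unbounded component.
  Finiteness lets \<open>face_beside_edge\<close> interchange closure and union.\<close>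

lemma finite_faces: "finite (faces G p \<gamma>)"
proof -
  let ?U = "{\<phi> \<in> faces G p \<gamma>. \<not> bounded \<phi>}"
  have "finite (inner_faces G p \<gamma>)" unfolding inner_faces_eq using finite_hexagons[OF simple] by simp
  moreover have "finite ?U"
  proof (cases "?U = {}")
    case False
    then obtain \<phi> where \<phi>: "\<phi> \<in> ?U" by blast
    have "\<psi> = \<phi>" if "\<psi> \<in> ?U" for \<psi>
      using cobounded_unique_unbounded_components[of "- drawn" \<phi> \<psi>] \<phi> that
        compact_imp_bounded[OF compact_drawn] unfolding faces_def by simp
    then have "?U \<subseteq> {\<phi>}" by blast
    then show ?thesis using finite_subset by blast
  next
    case True
    show ?thesis unfolding True by simp
  qed
  moreover have "faces G p \<gamma> = inner_faces G p \<gamma> \<union> ?U" unfolding inner_faces_def by blast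
  ultimately show ?thesis by (metis finite_UnI)
qed

lemma hexagon_frontier:
  assumes "h \<in> hexagons G"
  shows "frontier (inside (drawn_edges \<gamma> h)) = drawn_edges \<gamma> h"
    "inside (drawn_edges \<gamma> h) \<in> inner_faces G p \<gamma>"
    "inside (drawn_edges \<gamma> h) \<in> faces G p \<gamma>"
    "bounded (inside (drawn_edges \<gamma> h))"
proof -
  show a: "inside (drawn_edges \<gamma> h) \<in> inner_faces G p \<gamma>" using inner_faces_eq assms by blast
  then show "inside (drawn_edges \<gamma> h) \<in> faces G p \<gamma>" "bounded (inside (drawn_edges \<gamma> h))"
    unfolding inner_faces_def by auto
  obtain xs where xs: "is_cycle G xs" "h = cycle_edges xs" using hexagon_is_cycle[OF assms(1)] .
  show "frontier (inside (drawn_edges \<gamma> h)) = drawn_edges \<gamma> h"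
    using Jordan_cycle(10)[OF xs(1)] xs(2) by simp
qed

text \<open>\<open>W\<close> is the inside or the outside of a cycle through \<open>e\<close> in the applications.\<close>

lemma face_beside_edge:
  assumes "e \<in> edges G" "x \<in> path_image (\<gamma> e)" "x \<notin> p ` verts G"
    "\<forall>e'\<in>edges G. x \<in> path_image (\<gamma> e') \<longrightarrow> e' = e"
    and W: "open W" "frontier W = J" "path_image (\<gamma> e) \<subseteq> J" "J \<subseteq> drawn"
  obtains \<psi> where "\<psi> \<in> faces G p \<gamma>" "\<psi> \<subseteq> W" "x \<in> closure \<psi>"
proof -
  let ?K = "p ` verts G \<union> drawn_edges \<gamma> (edges G - {e})"
  have "compact ?K"
  proof -
    have "finite (verts G)" using simple unfolding simple_graph_def by simp
    then have "compact (p ` verts G)" by (simp add: finite_imp_compact)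
    moreover have "compact (drawn_edges \<gamma> (edges G - {e}))"
      unfolding drawn_edges_def
      by (intro compact_UN finite_Diff finite_edges simple) (use arc_edge in \<open>auto simp: compact_arc_image\<close>)
    ultimately show ?thesis by (rule compact_Un)
  qed
  then have opn: "open (- ?K)" by (intro open_Compl compact_imp_closed)
  have xK: "x \<in> - ?K" using assms(2-4) unfolding drawn_edges_def by blast
  have xW: "x \<in> closure W" using W(2,3) assms(2) unfolding frontier_def by blast
  \<comment> \<open>Near \<open>x\<close> the drawing consists of the edge \<open>e\<close> alone,
    because \<open>?K\<close> is closed and misses \<open>x\<close>. That edge lies in the frontier
    of the open set \<open>W\<close>, so points of \<open>W\<close> close to \<open>x\<close> are
    off the drawing.\<close>
  have "x \<in> closure (W - drawn)"
  proof (rule closure_iff_nhds_not_empty[THEN iffD2], intro allI impI)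
    fix A V assume "V \<subseteq> A" "open V" "x \<in> V"
    then have "open (V \<inter> - ?K)" "x \<in> V \<inter> - ?K" using opn xK by auto
    then have "W \<inter> (V \<inter> - ?K) \<noteq> {}"
      using xW by (metis closure_iff_nhds_not_empty order_refl)
    then obtain y where y: "y \<in> W" "y \<in> V" "y \<notin> ?K" by blast
    have "y \<notin> J" using y(1) W(1,2) by (metis Int_iff frontier_disjoint_eq empty_iff)
    then have "y \<notin> drawn" using y(3) W(3) unfolding drawn_edges_def by blast
    then show "(W - drawn) \<inter> A \<noteq> {}" using y \<open>V \<subseteq> A\<close> by blast
  qed
  moreover have "W - drawn \<subseteq> \<Union> {\<psi> \<in> faces G p \<gamma>. \<psi> \<subseteq> W}"
  proof
    fix y assume y: "y \<in> W - drawn"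
    then obtain \<psi> where \<psi>: "\<psi> \<in> faces G p \<gamma>" "y \<in> \<psi>"
      unfolding faces_def using Union_components[of "- drawn"] by blast
    have "\<psi> \<inter> frontier W = {}" using face_subset[OF \<psi>(1)] W(2,4) by blast
    then have "\<psi> \<subseteq> W" using connected_Int_frontier[OF face_connected[OF \<psi>(1)], of W] y \<psi>(2) by blast
    then show "y \<in> \<Union> {\<psi> \<in> faces G p \<gamma>. \<psi> \<subseteq> W}" using \<psi> by blast
  qed
  ultimately have "x \<in> closure (\<Union> {\<psi> \<in> faces G p \<gamma>. \<psi> \<subseteq> W})"
    using closure_mono by blast
  moreover have "closure (\<Union> {\<psi> \<in> faces G p \<gamma>. \<psi> \<subseteq> W}) \<subseteq> (\<Union>\<psi>\<in>{\<psi> \<in> faces G p \<gamma>. \<psi> \<subseteq> W}. closure \<psi>)"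
  proof (intro closure_minimal closed_UN)
    show "\<Union> {\<psi> \<in> faces G p \<gamma>. \<psi> \<subseteq> W} \<subseteq> (\<Union>\<psi>\<in>{\<psi> \<in> faces G p \<gamma>. \<psi> \<subseteq> W}. closure \<psi>)"
      using closure_subset by blast
  qed (use finite_faces in auto)
  ultimately show thesis using that by blast
qed

text \<open>The point \<open>x\<close> is on the frontier of the face, hence on some edge of its
  hexagon, and \<open>e\<close> is the only edge through \<open>x\<close>.\<close>

lemma hexagon_of_face_beside_edge:
  assumes "e \<in> edges G" "x \<in> path_image (\<gamma> e)"
    "\<forall>e'\<in>edges G. x \<in> path_image (\<gamma> e') \<longrightarrow> e' = e"
    and "\<psi> \<in> faces G p \<gamma>" "bounded \<psi>" "x \<in> closure \<psi>"
  obtains h where "h \<in> hexagons G" "e \<in> h" "\<psi> = inside (drawn_edges \<gamma> h)"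
proof -
  have "\<psi> \<in> inner_faces G p \<gamma>" using assms unfolding inner_faces_def by blast
  then obtain h where h: "h \<in> hexagons G" "\<psi> = inside (drawn_edges \<gamma> h)" unfolding inner_faces_eq by blast
  have "x \<in> drawn" using assms(1,2) unfolding drawn_edges_def by blast
  then have "x \<in> frontier \<psi>"
    using assms(4,6) face_subset[OF assms(4)] face_open[OF assms(4)]
    by (auto simp: frontier_def interior_open)
  then have "x \<in> drawn_edges \<gamma> h" using hexagon_frontier(1)[OF h(1)] h(2) by simp
  then obtain e' where "e' \<in> h" "x \<in> path_image (\<gamma> e')" unfolding drawn_edges_def by blast
  then have "e \<in> h" using assms(3) hexagon_subset_edges[OF h(1)] by blast
  then show thesis using that h by blast
qed

lemma edge_image_subset: "e \<in> F \<Longrightarrow> path_image (\<gamma> e) \<subseteq> drawn_edges \<gamma> F"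
  unfolding drawn_edges_def by blast

text \<open>\<open>I\<close> consists of the hexagons whose insides lie inside the cycle. An edge
  off the cycle has a face on each of its sides, and if one of them is inside the cycle, so is the
  other. Later this produces the forbidden third hexagon at a vertex.\<close>

lemma hexagons_inside_cycle:
  assumes C: "is_cycle G xs"
  obtains I where "I \<subseteq> hexagons G"
    "\<And>e. e \<in> cycle_edges xs \<Longrightarrow> \<exists>h\<in>I. e \<in> h"
    "\<And>e h. e \<notin> cycle_edges xs \<Longrightarrow> h \<in> I \<Longrightarrow> e \<in> h \<Longrightarrow> \<exists>h'\<in>I. h' \<noteq> h \<and> e \<in> h'"
proof
  let ?J = "drawn_edges \<gamma> (cycle_edges xs)"
  let ?I = "{h \<in> hexagons G. inside (drawn_edges \<gamma> h) \<subseteq> inside ?J}"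
  note Jd = Jordan_cycle[OF C refl]
  have sub: "cycle_edges xs \<subseteq> edges G" using C unfolding is_cycle_def by simp
  have Jdrawn: "?J \<subseteq> drawn" using drawn_edges_mono[OF sub] by blast
  have swallow: "\<psi> \<subseteq> inside ?J" if "\<psi> \<in> faces G p \<gamma>" "\<psi> \<inter> inside ?J \<noteq> {}" for \<psi>
    using connected_Int_frontier[OF face_connected[OF that(1)] that(2)] Jd(10)
      face_subset[OF that(1)] Jdrawn by blast
  show "?I \<subseteq> hexagons G" by blast
  show "\<exists>h\<in>?I. e \<in> h" if e: "e \<in> cycle_edges xs" for e
  proof -
    have eG: "e \<in> edges G" using e sub by blast
    obtain x where x: "x \<in> path_image (\<gamma> e)" "x \<notin> p ` verts G"
      "\<forall>e'\<in>edges G. x \<in> path_image (\<gamma> e') \<longrightarrow> e' = e" using edge_midpoint[OF eG] .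
    obtain \<psi> where \<psi>: "\<psi> \<in> faces G p \<gamma>" "\<psi> \<subseteq> inside ?J" "x \<in> closure \<psi>"
      using face_beside_edge[OF eG x Jd(2,10) edge_image_subset[OF e] Jdrawn] .
    have bd: "bounded \<psi>" using \<psi>(2) Jd(6) bounded_subset by blast
    obtain h where h: "h \<in> hexagons G" "e \<in> h" "\<psi> = inside (drawn_edges \<gamma> h)"
      using hexagon_of_face_beside_edge[OF eG x(1,3) \<psi>(1) bd \<psi>(3)] .
    show ?thesis by (rule bexI[of _ h]) (use h \<psi>(2) in auto)
  qed
  show "\<exists>h'\<in>?I. h' \<noteq> h \<and> e \<in> h'" if e: "e \<notin> cycle_edges xs" "h \<in> ?I" "e \<in> h" for e h
  proof -
    have h: "h \<in> hexagons G" "inside (drawn_edges \<gamma> h) \<subseteq> inside ?J" using e by auto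
    have eG: "e \<in> edges G" using e(3) hexagon_subset_edges[OF h(1)] by blast
    obtain x where x: "x \<in> path_image (\<gamma> e)" "x \<notin> p ` verts G"
      "\<forall>e'\<in>edges G. x \<in> path_image (\<gamma> e') \<longrightarrow> e' = e" using edge_midpoint[OF eG] .
    have "x \<in> closure (inside (drawn_edges \<gamma> h))"
      using hexagon_frontier(1)[OF h(1)] edge_image_subset[OF e(3)] x(1) unfolding frontier_def by blast
    then have "x \<in> closure (inside ?J)" using closure_mono[OF h(2)] by blast
    moreover have "x \<notin> ?J" using x(3) sub e(1) unfolding drawn_edges_def by blast
    ultimately have xJ: "x \<in> inside ?J" using Jd(10) by (metis DiffI Jd(2) frontier_def interior_open)
    obtain ys where ys: "is_cycle G ys" "h = cycle_edges ys" using hexagon_is_cycle[OF h(1)] .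
    note Jh = Jordan_cycle[OF ys(1) refl, folded ys(2)]
    have Jh_drawn: "drawn_edges \<gamma> h \<subseteq> drawn" using drawn_edges_mono[OF hexagon_subset_edges[OF h(1)]] by blast
    \<comment> \<open>Seen from the outside of \<open>h\<close>, the edge has a second face. As
      \<open>x\<close> lies in the open inside of the cycle, this face meets that inside and is
      contained in it.\<close>
    obtain \<psi> where \<psi>: "\<psi> \<in> faces G p \<gamma>" "\<psi> \<subseteq> outside (drawn_edges \<gamma> h)" "x \<in> closure \<psi>"
      using face_beside_edge[OF eG x(1-3) Jh(4,11) edge_image_subset[OF e(3)] Jh_drawn] .
    have "\<psi> \<inter> inside ?J \<noteq> {}"
      using \<psi>(3) xJ Jd(2) by (metis open_Int_closure_eq_empty Int_iff empty_iff inf_commute)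
    then have in_J: "\<psi> \<subseteq> inside ?J" using swallow \<psi>(1) by blast
    then have bd: "bounded \<psi>" using Jd(6) bounded_subset by blast
    obtain h' where h': "h' \<in> hexagons G" "e \<in> h'" "\<psi> = inside (drawn_edges \<gamma> h')"
      using hexagon_of_face_beside_edge[OF eG x(1,3) \<psi>(1) bd \<psi>(3)] .
    have "h' \<noteq> h" using h'(3) \<psi>(2) Jh(8) face_nonempty[OF \<psi>(1)] by blast
    then show ?thesis using h' in_J by blast
  qed
qed

text \<open>A bounded face of the subdrawing that is not a hexagon of \<open>G'\<close> would contain the inside of
  a deleted hexagon, hence a point of a deleted edge lying in no other hexagon, hence the outer face.\<close>

lemma restrict_drawing:
  assumes V': "verts G' \<subseteq> verts G" and E': "edges G' \<subseteq> edges G" and simple': "simple_graph G'"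
    and priv: "\<And>h. h \<in> hexagons G \<Longrightarrow>
      h \<subseteq> edges G' \<or> (\<exists>f\<in>h. f \<notin> edges G' \<and> (\<forall>h'\<in>hexagons G. f \<in> h' \<longrightarrow> h' = h))"
    and cover: "edges G \<subseteq> \<Union> (hexagons G)" "verts G \<subseteq> \<Union> (edges G)"
  shows "benzenoid_drawing G' p \<gamma>"
proof -
  let ?D' = "p ` verts G' \<union> drawn_edges \<gamma> (edges G')"
  have hex': "hexagons G' = {h \<in> hexagons G. h \<subseteq> edges G'}"
  proof (intro set_eqI iffI)
    fix h assume "h \<in> hexagons G'"
    then obtain xs where "h = cycle_edges xs" "length xs = 6" "distinct xs" "cycle_edges xs \<subseteq> edges G'"
      unfolding hexagons_def by blast
    then show "h \<in> {h \<in> hexagons G. h \<subseteq> edges G'}" using E' unfolding hexagons_def by blast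
  next
    fix h assume "h \<in> {h \<in> hexagons G. h \<subseteq> edges G'}"
    then show "h \<in> hexagons G'" unfolding hexagons_def by blast
  qed
  have plane': "plane_drawing G' p \<gamma>"
    unfolding plane_drawing_def
  proof (intro conjI ballI impI)
    have "inj_on p (verts G)" using drawing unfolding plane_drawing_def by simp
    then show "inj_on p (verts G')" using V' by (rule inj_on_subset)
    fix e assume e: "e \<in> edges G'"
    then have eG: "e \<in> edges G" using E' by blast
    show "arc (\<gamma> e)" "{pathstart (\<gamma> e), pathfinish (\<gamma> e)} = p ` e"
      using arc_edge[OF eG] ends_edge[OF eG] .
    have "e \<subseteq> verts G'" using simple' e unfolding simple_graph_def by blast
    then show "path_image (\<gamma> e) \<inter> p ` verts G' = p ` e" using edge_verts[OF eG] V' by blast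
  next
    fix e e' assume "e \<in> edges G'" "e' \<in> edges G'" "e \<noteq> e'"
    then show "path_image (\<gamma> e) \<inter> path_image (\<gamma> e') \<subseteq> p ` (e \<inter> e')" using edges_meet E' by blast
  qed
  interpret P: plane_graph G' p \<gamma> using simple' plane' by unfold_locales
  have D'D: "?D' \<subseteq> drawn" using V' drawn_edges_mono[OF E'] by blast
  \<comment> \<open>The whole frontier of the face is still drawn, so erasing the rest does not
    enlarge it.\<close>
  have old: "inside (drawn_edges \<gamma> h) \<in> inner_faces G' p \<gamma>" if h: "h \<in> hexagons G'" for h
  proof -
    have hG: "h \<in> hexagons G" "h \<subseteq> edges G'" using h hex' by auto
    have "inside (drawn_edges \<gamma> h) \<subseteq> - ?D'" using face_subset[OF hexagon_frontier(3)[OF hG(1)]] D'D by blast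
    moreover have "frontier (inside (drawn_edges \<gamma> h)) \<inter> - ?D' = {}"
      unfolding hexagon_frontier(1)[OF hG(1)] using drawn_edges_mono[OF hG(2)] by blast
    ultimately have "inside (drawn_edges \<gamma> h) \<in> components (- ?D')"
      using face_connected[OF hexagon_frontier(3)[OF hG(1)]] face_nonempty[OF hexagon_frontier(3)[OF hG(1)]]
      by (intro component_if_frontier_disjoint)
    then show ?thesis using hexagon_frontier(4)[OF hG(1)] unfolding inner_faces_def faces_def by simp
  qed
  have new: "\<exists>h\<in>hexagons G'. K = inside (drawn_edges \<gamma> h)" if K: "K \<in> inner_faces G' p \<gamma>" for K
  proof (rule ccontr)
    assume neg: "\<not> ?thesis"
    have Kf: "K \<in> faces G' p \<gamma>" and Kb: "bounded K" using K unfolding inner_faces_def by auto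
    have Kc: "K \<in> components (- ?D')" using Kf unfolding faces_def .
    have swallow: "T \<subseteq> K" if "connected T" "T \<subseteq> - ?D'" "K \<inter> T \<noteq> {}" for T
      using components_maximal[OF Kc that] .
    have swallow_face: "\<psi> \<subseteq> K" if "\<psi> \<in> faces G p \<gamma>" "K \<inter> \<psi> \<noteq> {}" for \<psi>
      using swallow[OF face_connected[OF that(1)]] face_subset[OF that(1)] that(2) D'D by blast
    have outer: False if f: "f \<in> edges G" "f \<notin> edges G'" and h: "h \<in> hexagons G" "f \<in> h"
        "\<forall>h'\<in>hexagons G. f \<in> h' \<longrightarrow> h' = h" and meet: "K \<inter> inside (drawn_edges \<gamma> h) \<noteq> {}" for f h
    proof -
      obtain x where x: "x \<in> path_image (\<gamma> f)" "x \<notin> p ` verts G"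
        "\<forall>e'\<in>edges G. x \<in> path_image (\<gamma> e') \<longrightarrow> e' = f" using edge_midpoint[OF f(1)] .
      have xD': "x \<notin> ?D'" using x V' E' f(2) unfolding drawn_edges_def by blast
      let ?\<phi> = "inside (drawn_edges \<gamma> h)"
      have "x \<in> closure ?\<phi>"
        using hexagon_frontier(1)[OF h(1)] edge_image_subset[OF h(2)] x(1) unfolding frontier_def by blast
      then have "connected (insert x ?\<phi>)"
        using connected_intermediate_closure[OF face_connected[OF hexagon_frontier(3)[OF h(1)]], of "insert x ?\<phi>"]
          closure_subset by blast
      moreover have "insert x ?\<phi> \<subseteq> - ?D'"
        using xD' face_subset[OF hexagon_frontier(3)[OF h(1)]] D'D by blast
      ultimately have xK: "x \<in> K" using swallow[of "insert x ?\<phi>"] meet by blast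
      obtain ys where ys: "is_cycle G ys" "h = cycle_edges ys" using hexagon_is_cycle[OF h(1)] .
      note Jh = Jordan_cycle[OF ys(1) refl, folded ys(2)]
      have Jh_drawn: "drawn_edges \<gamma> h \<subseteq> drawn" using drawn_edges_mono[OF hexagon_subset_edges[OF h(1)]] by blast
      obtain \<psi> where \<psi>: "\<psi> \<in> faces G p \<gamma>" "\<psi> \<subseteq> outside (drawn_edges \<gamma> h)" "x \<in> closure \<psi>"
        using face_beside_edge[OF f(1) x Jh(4,11) edge_image_subset[OF h(2)] Jh_drawn] .
      have "K \<inter> \<psi> \<noteq> {}"
        using \<psi>(3) xK P.face_open[OF Kf] by (metis open_Int_closure_eq_empty Int_iff empty_iff)
      then have bd: "bounded \<psi>" using swallow_face[OF \<psi>(1)] Kb by (meson bounded_subset)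
      obtain h' where h': "h' \<in> hexagons G" "f \<in> h'" "\<psi> = inside (drawn_edges \<gamma> h')"
        using hexagon_of_face_beside_edge[OF f(1) x(1,3) \<psi>(1) bd \<psi>(3)] .
      then have "h' = h" using h(3) by blast
      then show False using h'(3) \<psi>(2) Jh(8) face_nonempty[OF \<psi>(1)] by blast
    qed
    \<comment> \<open>If \<open>K\<close> were contained in the old drawing, a point of it would lie
      on an edge of some hexagon, and the open set \<open>K\<close> would reach the inside of that
      hexagon after all.\<close>
    have "\<exists>\<psi>\<in>faces G p \<gamma>. K \<inter> \<psi> \<noteq> {}"
    proof (cases "K \<subseteq> drawn")
      case False
      then show ?thesis unfolding faces_def using Union_components[of "- drawn"] by blast
    next
      case True
      obtain z where z: "z \<in> K" using P.face_nonempty[OF Kf] by blast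
      have "\<exists>e\<in>edges G. z \<in> path_image (\<gamma> e)"
      proof (cases "z \<in> p ` verts G")
        case True
        then obtain v e where "z = p v" "v \<in> e" "e \<in> edges G" using cover(2) by blast
        then show ?thesis using edge_verts by blast
      qed (use True z in \<open>auto simp: drawn_edges_def\<close>)
      then obtain e h where e: "z \<in> path_image (\<gamma> e)" "e \<in> h" "h \<in> hexagons G" using cover(1) by blast
      have "z \<in> closure (inside (drawn_edges \<gamma> h))"
        using hexagon_frontier(1)[OF e(3)] edge_image_subset[OF e(2)] e(1) unfolding frontier_def by blast
      then have "K \<inter> inside (drawn_edges \<gamma> h) \<noteq> {}"
        using z P.face_open[OF Kf] by (metis open_Int_closure_eq_empty Int_iff empty_iff)
      then show ?thesis using hexagon_frontier(3)[OF e(3)] by blast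
    qed
    then obtain \<psi> where \<psi>: "\<psi> \<in> faces G p \<gamma>" "K \<inter> \<psi> \<noteq> {}" by blast
    then have "bounded \<psi>" using swallow_face[OF \<psi>] Kb by (meson bounded_subset)
    then have "\<psi> \<in> inner_faces G p \<gamma>" using \<psi>(1) unfolding inner_faces_def by blast
    then obtain h where h: "h \<in> hexagons G" "\<psi> = inside (drawn_edges \<gamma> h)" unfolding inner_faces_eq by blast
    show False
    proof (cases "h \<subseteq> edges G'")
      case True
      then have "\<psi> \<in> inner_faces G' p \<gamma>" using old[of h] h hex' by simp
      then have "\<psi> \<in> components (- ?D')" unfolding inner_faces_def faces_def by simp
      then have "\<psi> = K" using components_nonoverlap[OF Kc] \<psi>(2) by metis
      moreover have "h \<in> hexagons G'" using h(1) True hex' by simp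
      ultimately show False using neg h(2) \<open>\<psi> = K\<close> by blast
    next
      case False
      then obtain f where f: "f \<in> h" "f \<notin> edges G'" "\<forall>h'\<in>hexagons G. f \<in> h' \<longrightarrow> h' = h"
        using priv h(1) by blast
      have "f \<in> edges G" using f(1) hexagon_subset_edges[OF h(1)] by blast
      then show False using outer[OF _ f(2) h(1) f(1,3)] \<psi>(2) h(2) by simp
    qed
  qed
  show ?thesis
  proof unfold_locales
    fix \<phi> assume "\<phi> \<in> inner_faces G' p \<gamma>"
    then obtain h where "h \<in> hexagons G'" "\<phi> = inside (drawn_edges \<gamma> h)" using new by metis
    then show "\<exists>h\<in>hexagons G'. frontier \<phi> = drawn_edges \<gamma> h"
      using hexagon_frontier(1) hex' by auto
  next
    fix h assume h: "h \<in> hexagons G'"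
    then have "frontier (inside (drawn_edges \<gamma> h)) = drawn_edges \<gamma> h" using hexagon_frontier(1) hex' by simp
    then show "\<exists>\<phi>\<in>inner_faces G' p \<gamma>. frontier \<phi> = drawn_edges \<gamma> h"
      using old[OF h] by metis
  qed
qed

end

section \<open>Hexagons at a vertex\<close>

lemma path_edges_append: "path_edges ys \<subseteq> path_edges (as @ ys)"
proof (induction as)
  case (Cons a as)
  then show ?case by (cases "as @ ys") auto
qed simp

lemma path_verts_subset: "2 \<le> length xs \<Longrightarrow> set xs \<subseteq> \<Union> (path_edges xs)"
proof (induction xs rule: path_edges.induct)
  case (1 a b xs)
  then show ?case by (cases xs) auto
qed auto

text \<open>When the new first vertex already occurs on the path, the loop is dropped by keeping
  only the suffix that starts there.\<close>

lemma simple_path_of_rtrancl: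
  assumes "(x, y) \<in> {(a, b). {a, b} \<in> F}\<^sup>*"
  shows "\<exists>xs. distinct xs \<and> xs \<noteq> [] \<and> hd xs = x \<and> last xs = y \<and> path_edges xs \<subseteq> F"
  using assms
proof (induction rule: converse_rtrancl_induct)
  case base
  show ?case by (rule exI[of _ "[y]"]) simp
next
  case (step x x')
  then obtain xs where xs: "distinct xs" "xs \<noteq> []" "hd xs = x'" "last xs = y" "path_edges xs \<subseteq> F"
    by blast
  show ?case
  proof (cases "x \<in> set xs")
    case True
    then obtain as bs where s: "xs = as @ x # bs" by (metis split_list)
    then have "path_edges (x # bs) \<subseteq> F" using path_edges_append xs(5) by blast
    then show ?thesis using xs s by (intro exI[of _ "x # bs"]) auto
  next
    case False
    then show ?thesis using xs step(1) by (intro exI[of _ "x # xs"]) (cases xs; auto)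
  qed
qed

text \<open>No edge of \<open>F\<close> contains \<open>v\<close>, so \<open>v\<close> closes a
  simple path in \<open>F\<close> to a cycle. The set \<open>F\<close> stays a parameter in order to
  prescribe which edges the cycle may use.\<close>

lemma cycle_through:
  assumes "(x, y) \<in> {(a, b). {a, b} \<in> F}\<^sup>*" "x \<noteq> y" "v \<notin> \<Union> F"
    "F \<subseteq> edges G" "{v, x} \<in> edges G" "{v, y} \<in> edges G"
  obtains xs where "is_cycle G xs" "{v, x} \<in> cycle_edges xs" "{v, y} \<in> cycle_edges xs"
    "cycle_edges xs \<subseteq> {{v, x}, {v, y}} \<union> F"
proof -
  obtain xs where xs: "distinct xs" "xs \<noteq> []" "hd xs = x" "last xs = y" "path_edges xs \<subseteq> F"
    using simple_path_of_rtrancl[OF assms(1)] by blast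
  have len: "2 \<le> length xs"
  proof (rule ccontr)
    assume "\<not> 2 \<le> length xs"
    then have "length xs = 1" using xs(2) by (cases xs) (auto simp: not_less_eq_eq)
    then show False using xs assms(2) by (auto simp: length_Suc_conv)
  qed
  then have v: "v \<notin> set xs" using path_verts_subset[OF len] xs(5) assms(3) by blast
  have ce: "cycle_edges (v # xs) = insert {v, y} (insert {v, x} (path_edges xs))"
    using xs by (cases xs) (auto simp: cycle_edges_path_edges insert_commute)
  have "is_cycle G (v # xs)" unfolding is_cycle_def using ce xs v len assms(4-6) by auto
  then show thesis using that[of "v # xs"] ce xs(5) by auto
qed

lemma path_rel_sym: "(x, y) \<in> {(a, b). {a, b} \<in> F}\<^sup>* \<Longrightarrow> (y, x) \<in> {(a, b). {a, b} \<in> F}\<^sup>*"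
  by (metis (mono_tags, lifting) case_prodD case_prodI insert_commute mem_Collect_eq sym_rtrancl symD symI)

definition hexagon_edges :: "'a \<Rightarrow> 'a \<Rightarrow> 'a \<Rightarrow> 'a \<Rightarrow> 'a \<Rightarrow> 'a \<Rightarrow> 'a set set" where
  "hexagon_edges a b c d e f = {{a, b}, {b, c}, {c, d}, {d, e}, {e, f}, {f, a}}"

lemma hexagon_edges_rotate: "hexagon_edges a b c d e f = hexagon_edges b c d e f a"
  unfolding hexagon_edges_def by (simp add: insert_commute)

lemma hexagon_edges_flip: "hexagon_edges a b c d e f = hexagon_edges b a f e d c"
  unfolding hexagon_edges_def by (simp add: insert_commute)

lemma cycle_edges_6: "cycle_edges [a, b, c, d, e, f] = hexagon_edges a b c d e f"
  unfolding hexagon_edges_def by (subst cycle_edges_path_edges) (auto simp: insert_commute)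

text \<open>Rotations and the flip carry the first directed edge of a hexagon to each of the twelve,
  so any edge can be put first in either direction; \<open>ok\<close> records the directed edges for
  which this has been achieved.\<close>

lemma hexagon_at_edge:
  assumes "h \<in> hexagons G" "{u, v} \<in> h"
  obtains a b c d where "distinct [u, v, a, b, c, d]" "h = hexagon_edges u v a b c d"
proof -
  obtain xs where xs: "h = cycle_edges xs" "length xs = 6" "distinct xs"
    using assms(1) unfolding hexagons_def by blast
  then obtain p q r s t w where l: "xs = [p, q, r, s, t, w]"
    by (auto simp: numeral_eq_Suc length_Suc_conv)
  then have h: "h = hexagon_edges p q r s t w" using xs(1) cycle_edges_6 by simp
  have d: "distinct [p, q, r, s, t, w]" using xs(3) l by simp
  define ok where "ok = (\<lambda>u v. \<exists>a b c d. distinct [u, v, a, b, c, d] \<and> h = hexagon_edges u v a b c d)"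
  have okI: "ok u v" "ok v u" if "distinct [u, v, a, b, c, d]" "h = hexagon_edges u v a b c d" for u v a b c d
  proof -
    show "ok u v" unfolding ok_def using that by blast
    have "distinct [v, u, d, c, b, a]" "h = hexagon_edges v u d c b a"
      using that hexagon_edges_flip[of u v a b c d] by auto
    then show "ok v u" unfolding ok_def by blast
  qed
  have 1: "ok p q" "ok q p" using okI[OF d h] .
  have h2: "h = hexagon_edges q r s t w p" using h hexagon_edges_rotate[of p q r s t w] by simp
  have 2: "ok q r" "ok r q" using okI[OF _ h2] d by auto
  have h3: "h = hexagon_edges r s t w p q" using h2 hexagon_edges_rotate[of q r s t w p] by simp
  have 3: "ok r s" "ok s r" using okI[OF _ h3] d by auto
  have h4: "h = hexagon_edges s t w p q r" using h3 hexagon_edges_rotate[of r s t w p q] by simp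
  have 4: "ok s t" "ok t s" using okI[OF _ h4] d by auto
  have h5: "h = hexagon_edges t w p q r s" using h4 hexagon_edges_rotate[of s t w p q r] by simp
  have 5: "ok t w" "ok w t" using okI[OF _ h5] d by auto
  have h6: "h = hexagon_edges w p q r s t" using h5 hexagon_edges_rotate[of t w p q r s] by simp
  have 6: "ok w p" "ok p w" using okI[OF _ h6] d by auto
  have "{u, v} \<in> hexagon_edges p q r s t w" using assms(2) h by simp
  then have "ok u v" using 1 2 3 4 5 6 unfolding hexagon_edges_def by (auto simp: doubleton_eq_iff)
  then show thesis using that unfolding ok_def by blast
qed

lemma simple_edgeE:
  assumes "simple_graph G" "e \<in> edges G" "v \<in> e"
  obtains w where "e = {v, w}" "v \<noteq> w"
proof -
  have "card e = 2" using assms unfolding simple_graph_def by blast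
  then show thesis using assms(3) that by (auto simp: card_2_iff)
qed

lemma hexagon_at_vertex:
  assumes "simple_graph G" "h \<in> hexagons G" "w \<in> \<Union> h"
  obtains a b c d e where "distinct [w, a, b, c, d, e]" "h = hexagon_edges w a b c d e"
proof -
  obtain f where f: "f \<in> h" "w \<in> f" using assms(3) by blast
  then have "f \<in> edges G" using hexagon_subset_edges[OF assms(2)] by blast
  then obtain a where "f = {w, a}" using simple_edgeE[OF assms(1) _ f(2)] by metis
  then show thesis using hexagon_at_edge[OF assms(2), of w a] f(1) that by metis
qed

lemma hexagon_edges_verts: "\<Union> (hexagon_edges a b c d e f) = {a, b, c, d, e, f}"
  unfolding hexagon_edges_def by auto

lemma hexagon_edges_at: "distinct [a, b, c, d, e, f] \<Longrightarrow> {g \<in> hexagon_edges a b c d e f. a \<in> g} = {{a, b}, {a, f}}"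
  unfolding hexagon_edges_def by auto

lemma hexagon_card_verts:
  assumes "h \<in> hexagons G" shows "card (\<Union> h) = 6" "finite (\<Union> h)"
proof -
  obtain xs where xs: "h = cycle_edges xs" "length xs = 6" "distinct xs"
    using assms(1) unfolding hexagons_def by blast
  then obtain p q r s t w where l: "xs = [p, q, r, s, t, w]"
    by (auto simp: numeral_eq_Suc length_Suc_conv)
  then have "\<Union> h = {p, q, r, s, t, w}" using xs(1) cycle_edges_6 hexagon_edges_verts by metis
  then show "card (\<Union> h) = 6" "finite (\<Union> h)" using xs(3) l by auto
qed

section \<open>Combinatorics of a catacondensed graph\<close>

locale catacond =
  fixes G :: "'a graph"
  assumes cat: "catacondensed G"
begin

lemma simple: "simple_graph G" and two_conn: "two_connected G"
  and hexagons_meet: "h \<in> hexagons G \<Longrightarrow> h' \<in> hexagons G \<Longrightarrow> h \<noteq> h' \<Longrightarrow>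
     \<Union> h \<inter> \<Union> h' = {} \<or> card (h \<inter> h') = 1"
  and hexagons_at_edge: "e \<in> edges G \<Longrightarrow> card {h \<in> hexagons G. e \<in> h} \<le> 2"
  and no_internal: "\<not> internal_vertex G v"
  using cat unfolding catacondensed_def benzenoid_def by auto

lemma drawing: obtains p \<gamma> where "benzenoid_drawing G p \<gamma>"
proof -
  have "\<exists>p \<gamma>. plane_drawing G p \<gamma> \<and>
      (\<forall>\<phi>\<in>inner_faces G p \<gamma>. \<exists>h\<in>hexagons G. frontier \<phi> = drawn_edges \<gamma> h) \<and>
      (\<forall>h\<in>hexagons G. \<exists>\<phi>\<in>inner_faces G p \<gamma>. frontier \<phi> = drawn_edges \<gamma> h)"
    using cat unfolding catacondensed_def benzenoid_def by (elim conjE)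
  then obtain p \<gamma> where D: "plane_drawing G p \<gamma>"
    "\<forall>\<phi>\<in>inner_faces G p \<gamma>. \<exists>h\<in>hexagons G. frontier \<phi> = drawn_edges \<gamma> h"
    "\<forall>h\<in>hexagons G. \<exists>\<phi>\<in>inner_faces G p \<gamma>. frontier \<phi> = drawn_edges \<gamma> h"
    by (elim exE conjE)
  interpret plane_graph G p \<gamma> using simple D(1) by (rule plane_graph.intro)
  have "benzenoid_drawing G p \<gamma>" by unfold_locales (use D(2,3) in metis)+
  then show thesis using that by blast
qed

lemma finite_hex: "finite (hexagons G)" using finite_hexagons[OF simple] .

lemma hexagon_verts: "h \<in> hexagons G \<Longrightarrow> \<Union> h \<subseteq> verts G"
  using hexagon_subset_edges simple unfolding simple_graph_def by blast

text \<open>Stated as uniqueness of the second hexagon at \<open>w\<close>, the form in which the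
  absence of internal vertices is applied.\<close>

lemma no_three_hexagons:
  assumes "h1 \<in> hexagons G" "h2 \<in> hexagons G" "h3 \<in> hexagons G"
    "w \<in> \<Union> h1" "w \<in> \<Union> h2" "w \<in> \<Union> h3" "h1 \<noteq> h2" "h1 \<noteq> h3" shows "h2 = h3"
proof (rule ccontr)
  assume "h2 \<noteq> h3"
  then have "card {h1, h2, h3} = 3" using assms by simp
  moreover have "{h1, h2, h3} \<subseteq> {h \<in> hexagons G. w \<in> \<Union> h}" using assms by auto
  ultimately have "3 \<le> card {h \<in> hexagons G. w \<in> \<Union> h}"
    using card_mono[of "{h \<in> hexagons G. w \<in> \<Union> h}" "{h1, h2, h3}"] finite_hex by simp
  moreover have "w \<in> verts G" using hexagon_verts assms(1,4) by blast
  ultimately show False using cat unfolding catacondensed_def internal_vertex_def by blast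
qed

lemma connected_avoiding:
  assumes "w \<in> verts G" "x \<in> verts G" "y \<in> verts G" "x \<noteq> w" "y \<noteq> w"
  shows "(x, y) \<in> {(a, b). {a, b} \<in> {e \<in> edges G. w \<notin> e}}\<^sup>*"
proof -
  have "graph_connected (delete_vertex G w)" using two_conn assms(1) unfolding two_connected_def by blast
  then have "\<forall>u\<in>verts G - {w}. \<forall>v\<in>verts G - {w}. (u, v) \<in> {(x, y). {x, y} \<in> {e \<in> edges G. w \<notin> e}}\<^sup>*"
    unfolding graph_connected_def delete_vertex_def fst_conv snd_conv by blast
  then show ?thesis using assms by blast
qed

lemma third_vertex: obtains w where "w \<in> verts G" "w \<noteq> x" "w \<noteq> y"
proof -
  have "\<not> card (verts G) \<le> card {x, y}"
    using two_conn card_insert_le_m1[of 2 "{y}" x] unfolding two_connected_def by simp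
  then have "\<not> verts G \<subseteq> {x, y}" using card_mono[of "{x, y}" "verts G"] by auto
  then show thesis using that by blast
qed

lemma other_edge:
  assumes "v \<in> verts G" "x \<in> verts G" "v \<noteq> x"
  obtains y where "{v, y} \<in> edges G" "y \<noteq> x"
proof -
  obtain w where w: "w \<in> verts G" "w \<noteq> v" "w \<noteq> x" using third_vertex .
  have "(v, w) \<in> {(a, b). {a, b} \<in> {e \<in> edges G. x \<notin> e}}\<^sup>*"
    using connected_avoiding[of x v w] w assms by blast
  then show thesis using w(2) that by (cases rule: converse_rtranclE) auto
qed

text \<open>Two neighbours of \<open>v\<close> are still joined after \<open>v\<close> is deleted,
  and closing such a path through \<open>v\<close> uses no other edge at \<open>v\<close>.\<close>

lemma cycle_through_two_edges:
  assumes "{v, x} \<in> edges G" "{v, y} \<in> edges G" "x \<noteq> y"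
  obtains xs where "is_cycle G xs" "{v, x} \<in> cycle_edges xs" "{v, y} \<in> cycle_edges xs"
    "\<forall>e\<in>cycle_edges xs. v \<in> e \<longrightarrow> e = {v, x} \<or> e = {v, y}"
proof -
  let ?F = "{e \<in> edges G. v \<notin> e}"
  have "(x, y) \<in> {(a, b). {a, b} \<in> ?F}\<^sup>*"
    by (rule connected_avoiding) (use assms edge_distinct[OF simple] in auto)
  then obtain xs where xs: "is_cycle G xs" "{v, x} \<in> cycle_edges xs" "{v, y} \<in> cycle_edges xs"
    "cycle_edges xs \<subseteq> {{v, x}, {v, y}} \<union> ?F"
    using cycle_through[of x y ?F v G] assms by blast
  then show thesis using that by blast
qed

lemma hexagons_inside:
  assumes "is_cycle G xs"
  obtains I where "I \<subseteq> hexagons G"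
    "\<forall>e\<in>cycle_edges xs. \<exists>h\<in>I. e \<in> h"
    "\<forall>h\<in>I. \<forall>e\<in>h. e \<notin> cycle_edges xs \<longrightarrow> (\<exists>h'\<in>I. h' \<noteq> h \<and> e \<in> h')"
proof -
  obtain p \<gamma> where "benzenoid_drawing G p \<gamma>" using drawing .
  then interpret benzenoid_drawing G p \<gamma> .
  obtain I where "I \<subseteq> hexagons G" "\<And>e. e \<in> cycle_edges xs \<Longrightarrow> \<exists>h\<in>I. e \<in> h"
    "\<And>e h. e \<notin> cycle_edges xs \<Longrightarrow> h \<in> I \<Longrightarrow> e \<in> h \<Longrightarrow> \<exists>h'\<in>I. h' \<noteq> h \<and> e \<in> h'"
    using hexagons_inside_cycle[OF assms] by metis
  then show thesis using that by metis
qed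

text \<open>By 2-connectedness an end of the edge has a second edge; a cycle through both has a
  hexagon inside at the given one.\<close>

lemma edge_in_hexagon:
  assumes "e \<in> edges G" obtains h where "h \<in> hexagons G" "e \<in> h"
proof -
  obtain v x where e: "e = {v, x}" using assms simple unfolding simple_graph_def card_2_iff by blast
  then have vx: "v \<noteq> x" "v \<in> verts G" "x \<in> verts G" using edge_distinct[OF simple] assms by auto
  obtain y where y: "{v, y} \<in> edges G" "y \<noteq> x" using other_edge vx by metis
  obtain xs where xs: "is_cycle G xs" "{v, x} \<in> cycle_edges xs"
    using cycle_through_two_edges[of v x y] assms e y by metis
  then show thesis using hexagons_inside[OF xs(1)] e that by (metis subsetD)
qed

lemma vertex_in_hexagon:
  assumes "v \<in> verts G" obtains h where "h \<in> hexagons G" "v \<in> \<Union> h"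
proof -
  obtain x where x: "x \<in> verts G" "x \<noteq> v" using third_vertex[of v v] by metis
  obtain y where "{v, y} \<in> edges G" using other_edge[of v x] assms x by metis
  then show thesis using edge_in_hexagon[of "{v, y}"] that by (metis UnionI insertI1)
qed

lemma hexagons_nonempty: "hexagons G \<noteq> {}"
proof -
  obtain v where "v \<in> verts G" using third_vertex[of undefined undefined] by metis
  then show ?thesis using vertex_in_hexagon by (metis empty_iff)
qed

text \<open>If \<open>w\<close> were a further common vertex, a cycle through an edge of \<open>h\<close> and an edge of \<open>h'\<close> at \<open>w\<close>
  would enclose \<open>h\<close>, and then the other edge of \<open>h\<close> at \<open>w\<close> would lie in a third hexagon.\<close>

lemma hexagons_common_verts:
  assumes h: "h \<in> hexagons G" and h': "h' \<in> hexagons G" and ne: "h \<noteq> h'" and e: "e \<in> h" "e \<in> h'"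
  shows "h \<inter> h' = {e}" "\<Union> h \<inter> \<Union> h' = e"
proof -
  have "\<Union> h \<inter> \<Union> h' \<noteq> {}"
  proof -
    have "e \<in> edges G" using hexagon_subset_edges[OF h] e by blast
    then have "e \<noteq> {}" using simple unfolding simple_graph_def by force
    then show ?thesis using e by blast
  qed
  then have "card (h \<inter> h') = 1" using hexagons_meet[OF h h' ne] by blast
  then show int: "h \<inter> h' = {e}" using e by (auto simp: card_1_singleton_iff)
  have "w \<in> e" if w: "w \<in> \<Union> h" "w \<in> \<Union> h'" for w
  proof (rule ccontr)
    assume we: "w \<notin> e"
    obtain a b c d f where a: "distinct [w, a, b, c, d, f]" "h = hexagon_edges w a b c d f"
      using hexagon_at_vertex[OF simple h w(1)] .
    obtain a' b' c' d' f' where a': "distinct [w, a', b', c', d', f']" "h' = hexagon_edges w a' b' c' d' f'"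
      using hexagon_at_vertex[OF simple h' w(2)] .
    have in_h: "{w, a} \<in> h" "{w, f} \<in> h" "{w, a'} \<in> h'"
      using a(2) a'(2) unfolding hexagon_edges_def by (auto simp: insert_commute)
    have nin': "g \<notin> h'" if "g \<in> h" "w \<in> g" for g using that int we by (metis IntI singletonD)
    have nin: "{w, a} \<notin> h'" "{w, f} \<notin> h'" using nin' in_h by simp_all
    then have ne': "a \<noteq> a'" "f \<noteq> a'" using in_h(3) by auto
    have E: "{w, a} \<in> edges G" "{w, a'} \<in> edges G"
      using in_h hexagon_subset_edges[OF h] hexagon_subset_edges[OF h'] by auto
    obtain xs where xs: "is_cycle G xs" "{w, a} \<in> cycle_edges xs"
      "\<forall>e\<in>cycle_edges xs. w \<in> e \<longrightarrow> e = {w, a} \<or> e = {w, a'}"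
      using cycle_through_two_edges[OF E ne'(1)] by metis
    have fn: "{w, f} \<notin> cycle_edges xs" using xs(3) a(1) ne' by (auto simp: doubleton_eq_iff)
    obtain I where I: "I \<subseteq> hexagons G" "\<forall>e\<in>cycle_edges xs. \<exists>h\<in>I. e \<in> h"
      "\<forall>h\<in>I. \<forall>e\<in>h. e \<notin> cycle_edges xs \<longrightarrow> (\<exists>h'\<in>I. h' \<noteq> h \<and> e \<in> h')"
      using hexagons_inside[OF xs(1)] .
    obtain k where k: "k \<in> I" "{w, a} \<in> k" using I(2) xs(2) by blast
    have only: "k = h \<or> k = h'" if "k \<in> hexagons G" "w \<in> \<Union> k" for k
      using no_three_hexagons[OF h h' that(1) w that(2) ne] by metis
    have "k \<in> hexagons G" using k(1) I(1) by blast
    then have "k = h" using only[of k] k(2) nin(1) by auto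
    then obtain k' where k': "k' \<in> I" "k' \<noteq> h" "{w, f} \<in> k'" using I(3) k(1) in_h(2) fn by metis
    then have "k' = h'" using only[of k'] I(1) by auto
    then show False using k'(3) nin(2) by simp
  qed
  then show "\<Union> h \<inter> \<Union> h' = e" using e by blast
qed

lemma common_vertex_edge:
  assumes "h \<in> hexagons G" "h' \<in> hexagons G" "h \<noteq> h'" "w \<in> \<Union> h" "w \<in> \<Union> h'"
  obtains x where "{w, x} \<in> h" "{w, x} \<in> h'" "w \<noteq> x" "\<Union> h \<inter> \<Union> h' = {w, x}" "h \<inter> h' = {{w, x}}"
proof -
  have "card (h \<inter> h') = 1" using hexagons_meet[OF assms(1-3)] assms(4,5) by blast
  then obtain e where e: "e \<in> h" "e \<in> h'" by (auto simp: card_1_singleton_iff)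
  have c: "h \<inter> h' = {e}" "\<Union> h \<inter> \<Union> h' = e" using hexagons_common_verts[OF assms(1-3) e] .
  then have "w \<in> e" using assms by blast
  moreover have "e \<in> edges G" using e hexagon_subset_edges[OF assms(1)] by blast
  ultimately obtain x where "e = {w, x}" "w \<noteq> x" using simple_edgeE[OF simple] by metis
  then show thesis using that e c by metis
qed

lemma incident_edges_hexagon:
  assumes "h \<in> hexagons G" "w \<in> \<Union> h"
  shows "card {e \<in> h. w \<in> e} = 2"
proof -
  obtain a b c d f where a: "distinct [w, a, b, c, d, f]" "h = hexagon_edges w a b c d f"
    using hexagon_at_vertex[OF simple assms] .
  have "{e \<in> h. w \<in> e} = {{w, a}, {w, f}}" unfolding a(2) using hexagon_edges_at[OF a(1)] .
  moreover have "{w, a} \<noteq> {w, f}" using a(1) by (auto simp: doubleton_eq_iff)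
  ultimately show ?thesis by simp
qed

lemma degree_one_hexagon:
  assumes "h \<in> hexagons G" "w \<in> \<Union> h" "\<forall>h'\<in>hexagons G. w \<in> \<Union> h' \<longrightarrow> h' = h"
  shows "degree G w = 2" "{e \<in> edges G. w \<in> e} = {e \<in> h. w \<in> e}"
proof -
  show e: "{e \<in> edges G. w \<in> e} = {e \<in> h. w \<in> e}"
  proof
    show "{e \<in> edges G. w \<in> e} \<subseteq> {e \<in> h. w \<in> e}"
    proof clarify
      fix e assume "e \<in> edges G" "w \<in> e"
      then show "e \<in> h" using edge_in_hexagon assms(3) by (metis UnionI)
    qed
  qed (use hexagon_subset_edges[OF assms(1)] in blast)
  show "degree G w = 2" unfolding degree_def e using incident_edges_hexagon[OF assms(1,2)] .
qed

text \<open>Each of the two hexagons contributes two edges at \<open>w\<close>, and exactly one edge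
  is common: 2 + 2 - 1. A third hexagon at \<open>w\<close> is excluded.\<close>

lemma degree_two_hexagons:
  assumes "h \<in> hexagons G" "h' \<in> hexagons G" "h \<noteq> h'" "w \<in> \<Union> h" "w \<in> \<Union> h'"
  shows "degree G w = 3"
proof -
  obtain x where x: "{w, x} \<in> h" "{w, x} \<in> h'" "h \<inter> h' = {{w, x}}"
    using common_vertex_edge[OF assms] by metis
  have e: "{e \<in> edges G. w \<in> e} = {e \<in> h. w \<in> e} \<union> {e \<in> h'. w \<in> e}"
  proof
    show "{e \<in> edges G. w \<in> e} \<subseteq> {e \<in> h. w \<in> e} \<union> {e \<in> h'. w \<in> e}"
    proof clarify
      fix e assume e: "e \<in> edges G" "w \<in> e" "e \<notin> h'"
      then obtain k where k: "k \<in> hexagons G" "e \<in> k" using edge_in_hexagon by metis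
      then have "k = h \<or> k = h'" using no_three_hexagons[OF assms(1,2) k(1) assms(4,5) _ assms(3)] e by blast
      then show "e \<in> h" using k e by blast
    qed
  qed (use hexagon_subset_edges[OF assms(1)] hexagon_subset_edges[OF assms(2)] in blast)
  have "{e \<in> h. w \<in> e} \<inter> {e \<in> h'. w \<in> e} = {{w, x}}" using x by blast
  moreover have "finite {e \<in> h. w \<in> e}" "finite {e \<in> h'. w \<in> e}"
    using incident_edges_hexagon assms by (metis card.infinite zero_neq_numeral)+
  ultimately show ?thesis unfolding degree_def e
    using card_Un_Int[of "{e \<in> h. w \<in> e}" "{e \<in> h'. w \<in> e}"] incident_edges_hexagon assms by simp
qed

text \<open>Degree 2 or 3 tells whether one or two hexagons meet at a vertex, which turns the degree
  conditions in \<open>angular\<close> and \<open>is_B1\<close> into statements about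
  hexagons.\<close>

lemma degree_2_iff:
  assumes "h \<in> hexagons G" "w \<in> \<Union> h"
  shows "degree G w = 2 \<longleftrightarrow> (\<forall>h'\<in>hexagons G. w \<in> \<Union> h' \<longrightarrow> h' = h)"
  using degree_one_hexagon(1)[OF assms] degree_two_hexagons[OF assms(1) _ _ assms(2)] by fastforce

text \<open>If both edges of \<open>h\<close> at a vertex were shared, the hexagons sharing them
  would coincide, as no three meet there, and would have two edges in common with \<open>h\<close>.
  A private edge is what \<open>restrict_drawing\<close> asks of a deleted hexagon.\<close>

lemma private_edge:
  assumes "h \<in> hexagons G"
  obtains f where "f \<in> h" "\<forall>h'\<in>hexagons G. f \<in> h' \<longrightarrow> h' = h"
proof -
  obtain xs where xs: "h = cycle_edges xs" "length xs = 6" using assms unfolding hexagons_def by blast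
  then have "{xs ! 0, xs ! (Suc 0 mod 6)} \<in> h" unfolding cycle_edges_def by force
  then obtain w where w: "w \<in> \<Union> h" by blast
  obtain a b c d f where a: "distinct [w, a, b, c, d, f]" "h = hexagon_edges w a b c d f"
    using hexagon_at_vertex[OF simple assms w] .
  have in_h: "{w, a} \<in> h" "{w, f} \<in> h" using a(2) unfolding hexagon_edges_def by (auto simp: insert_commute)
  have wne: "{w, a} \<noteq> {w, f}" using a(1) by (auto simp: doubleton_eq_iff)
  show thesis
  proof (rule ccontr)
    assume neg: "\<not> thesis"
    have "\<exists>k\<in>hexagons G. {w, a} \<in> k \<and> k \<noteq> h" "\<exists>k\<in>hexagons G. {w, f} \<in> k \<and> k \<noteq> h"
      using neg that[OF in_h(1)] that[OF in_h(2)] by metis+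
    then obtain k k' where k: "k \<in> hexagons G" "{w, a} \<in> k" "k \<noteq> h"
      "k' \<in> hexagons G" "{w, f} \<in> k'" "k' \<noteq> h" by metis
    then have "k = k'" using no_three_hexagons[OF assms, of k k' w] w by blast
    then have "{w, f} \<in> h \<inter> k" using k(5) in_h(2) by simp
    then show False using hexagons_common_verts(1)[OF assms k(1) k(3)[symmetric] in_h(1) k(2)] wne by simp
  qed
qed

lemma edges_cover: "edges G \<subseteq> \<Union> (hexagons G)" "verts G \<subseteq> \<Union> (edges G)"
proof -
  show "edges G \<subseteq> \<Union> (hexagons G)" using edge_in_hexagon by blast
  show "verts G \<subseteq> \<Union> (edges G)"
  proof
    fix v assume "v \<in> verts G"
    then obtain h where "h \<in> hexagons G" "v \<in> \<Union> h" using vertex_in_hexagon by metis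
    then show "v \<in> \<Union> (edges G)" using hexagon_subset_edges by blast
  qed
qed

lemma hexagons_subgraph: "edges G' \<subseteq> edges G \<Longrightarrow> hexagons G' = {h \<in> hexagons G. h \<subseteq> edges G'}"
  unfolding hexagons_def by fast

text \<open>The hexagons of the subgraph are among those of \<open>G\<close>, so every condition on
  how they meet is inherited; the drawing comes from \<open>restrict_drawing\<close>.\<close>

lemma catacondensed_subgraph:
  assumes V': "verts G' \<subseteq> verts G" and E': "edges G' \<subseteq> edges G" and s': "simple_graph G'"
    and tc: "two_connected G'"
    and priv: "\<And>h. h \<in> hexagons G \<Longrightarrow>
      h \<subseteq> edges G' \<or> (\<exists>f\<in>h. f \<notin> edges G' \<and> (\<forall>h'\<in>hexagons G. f \<in> h' \<longrightarrow> h' = h))"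
  shows "catacondensed G'"
proof -
  obtain p \<gamma> where "benzenoid_drawing G p \<gamma>" using drawing .
  then interpret benzenoid_drawing G p \<gamma> .
  have "benzenoid_drawing G' p \<gamma>" using restrict_drawing[OF V' E' s' priv edges_cover] by blast
  then interpret D: benzenoid_drawing G' p \<gamma> .
  have hs: "hexagons G' \<subseteq> hexagons G" using hexagons_subgraph[OF E'] by blast
  have "card {h \<in> hexagons G'. e \<in> h} \<le> 2" if e: "e \<in> edges G'" for e
  proof -
    have "card {h \<in> hexagons G'. e \<in> h} \<le> card {h \<in> hexagons G. e \<in> h}"
      by (rule card_mono) (use finite_hex hs in auto)
    moreover have "card {h \<in> hexagons G. e \<in> h} \<le> 2"
      using hexagons_at_edge E' e by blast
    ultimately show ?thesis by simp
  qed
  moreover have "\<forall>h\<in>hexagons G'. \<forall>h'\<in>hexagons G'. h \<noteq> h' \<longrightarrow> \<Union> h \<inter> \<Union> h' = {} \<or> card (h \<inter> h') = 1"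
    using hexagons_meet hs by blast
  moreover have "\<exists>p \<gamma>. plane_drawing G' p \<gamma> \<and>
        (\<forall>\<phi>\<in>inner_faces G' p \<gamma>. \<exists>h\<in>hexagons G'. frontier \<phi> = drawn_edges \<gamma> h) \<and>
        (\<forall>h\<in>hexagons G'. \<exists>\<phi>\<in>inner_faces G' p \<gamma>. frontier \<phi> = drawn_edges \<gamma> h)"
    using D.drawing D.face_hexagon D.hexagon_face by metis
  ultimately have "benzenoid G'" using s' tc unfolding benzenoid_def by (intro conjI ballI) simp_all
  moreover have "\<not> internal_vertex G' v" for v
  proof
    assume a: "internal_vertex G' v"
    have "card {h \<in> hexagons G'. v \<in> \<Union> h} \<le> card {h \<in> hexagons G. v \<in> \<Union> h}"
      by (rule card_mono) (use finite_hex hs in auto)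
    then have "internal_vertex G v" using a V' unfolding internal_vertex_def by auto
    then show False using no_internal by simp
  qed
  ultimately show ?thesis unfolding catacondensed_def by simp
qed

end

section \<open>Cutting along a common edge of two hexagons\<close>

definition induced :: "'a graph \<Rightarrow> 'a set \<Rightarrow> 'a graph" where
  "induced G V = (V, {e \<in> edges G. e \<subseteq> V})"

lemma induced_simps [simp]: "verts (induced G V) = V" "edges (induced G V) = {e \<in> edges G. e \<subseteq> V}"
  unfolding induced_def by simp_all

text \<open>A walk can leave \<open>V\<close> only from \<open>u\<close> or \<open>v\<close>. At the
  first exit it is at \<open>t\<close> or one step from it along \<open>{u, v}\<close>, and the rest
  of the walk is discarded. The set \<open>W\<close> of deleted vertices will be empty for
  connectedness and a singleton for 2-connectedness.\<close>

lemma walk_inside: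
  assumes "(z, t) \<in> {(a, b). {a, b} \<in> {e \<in> edges G. e \<inter> W = {}}}\<^sup>*"
    and "z \<in> V" "z \<notin> W" "t \<in> {u, v}" "t \<notin> W" "u \<in> V" "v \<in> V" "{u, v} \<in> edges G"
    and "\<And>a b. {a, b} \<in> edges G \<Longrightarrow> a \<in> V \<Longrightarrow> b \<notin> V \<Longrightarrow> a \<in> {u, v}"
  shows "(z, t) \<in> {(a, b). {a, b} \<in> {e \<in> edges G. e \<subseteq> V \<and> e \<inter> W = {}}}\<^sup>*"
  using assms(1-3)
proof (induction rule: converse_rtrancl_induct)
  case base
  show ?case by simp
next
  case (step z z')
  have e: "{z, z'} \<in> edges G" "{z, z'} \<inter> W = {}" using step(1) by auto
  show ?case
  proof (cases "z' \<in> V")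
    case True
    then have "(z', t) \<in> {(a, b). {a, b} \<in> {e \<in> edges G. e \<subseteq> V \<and> e \<inter> W = {}}}\<^sup>*"
      using step e by auto
    moreover have "(z, z') \<in> {(a, b). {a, b} \<in> {e \<in> edges G. e \<subseteq> V \<and> e \<inter> W = {}}}"
      using e True step(4) by auto
    ultimately show ?thesis by (rule converse_rtrancl_into_rtrancl[rotated])
  next
    case False
    then have "z \<in> {u, v}" using assms(9)[OF e(1) step(4)] by simp
    show ?thesis
    proof (cases "z = t")
      case True
      then show ?thesis by simp
    next
      case False
      then have "{z, t} = {u, v}" using \<open>z \<in> {u, v}\<close> assms(4) by auto
      then have "(z, t) \<in> {(a, b). {a, b} \<in> {e \<in> edges G. e \<subseteq> V \<and> e \<inter> W = {}}}"
        using assms(5-8) step(5) by auto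
      then show ?thesis by (rule r_into_rtrancl)
    qed
  qed
qed

lemma (in catacond) two_connected_induced:
  assumes V: "V \<subseteq> verts G" "u \<in> V" "v \<in> V" "z0 \<in> V" "z0 \<notin> {u, v}" and uv: "{u, v} \<in> edges G"
    and closed: "\<And>a b. {a, b} \<in> edges G \<Longrightarrow> a \<in> V \<Longrightarrow> b \<notin> V \<Longrightarrow> a \<in> {u, v}"
  shows "two_connected (induced G V)"
proof -
  have ne: "u \<noteq> v" using edge_distinct[OF simple uv] by simp
  have fin: "finite V" using V(1) simple unfolding simple_graph_def by (meson finite_subset)
  have "card {u, v, z0} = 3" using ne V(5) by auto
  then have c3: "3 \<le> card V" using card_mono[OF fin, of "{u, v, z0}"] V by simp
  have reach: "(a, b) \<in> {(x, y). {x, y} \<in> {e \<in> edges G. e \<subseteq> V \<and> e \<inter> W = {}}}\<^sup>*"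
    if t: "t \<in> {u, v}" "t \<notin> W" and ab: "a \<in> V" "b \<in> V" "a \<notin> W" "b \<notin> W"
      and conn: "\<And>x y. x \<in> verts G \<Longrightarrow> y \<in> verts G \<Longrightarrow> x \<notin> W \<Longrightarrow> y \<notin> W \<Longrightarrow>
        (x, y) \<in> {(a, b). {a, b} \<in> {e \<in> edges G. e \<inter> W = {}}}\<^sup>*" for a b t W
  proof -
    have tv: "t \<in> verts G" using t V by auto
    have "(z, t) \<in> {(a, b). {a, b} \<in> {e \<in> edges G. e \<subseteq> V \<and> e \<inter> W = {}}}\<^sup>*" if "z \<in> V" "z \<notin> W" for z
      by (rule walk_inside[OF conn[of z t] that t(1,2) V(2,3) uv closed]) (use that V(1) tv t in auto)
    then have at: "(a, t) \<in> {(a, b). {a, b} \<in> {e \<in> edges G. e \<subseteq> V \<and> e \<inter> W = {}}}\<^sup>*"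
      and bt: "(b, t) \<in> {(a, b). {a, b} \<in> {e \<in> edges G. e \<subseteq> V \<and> e \<inter> W = {}}}\<^sup>*" using ab by auto
    show ?thesis using at path_rel_sym[OF bt] by (rule rtrancl_trans)
  qed
  have "graph_connected (induced G V)"
  proof -
    have conn: "(x, y) \<in> {(a, b). {a, b} \<in> {e \<in> edges G. e \<inter> {} = {}}}\<^sup>*"
      if "x \<in> verts G" "y \<in> verts G" for x y
      using two_conn that unfolding two_connected_def graph_connected_def by simp
    show ?thesis unfolding graph_connected_def
      using reach[of u "{}"] conn V by auto
  qed
  moreover have "graph_connected (delete_vertex (induced G V) w)" if w: "w \<in> V" for w
  proof -
    \<comment> \<open>At least one end of the cut survives the deletion of \<open>w\<close>, and
      every remaining vertex of \<open>V\<close> is joined to it.\<close>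
    obtain t where t: "t \<in> {u, v}" "t \<noteq> w" using ne by auto
    have conn: "(x, y) \<in> {(a, b). {a, b} \<in> {e \<in> edges G. e \<inter> {w} = {}}}\<^sup>*"
      if "x \<in> verts G" "y \<in> verts G" "x \<notin> {w}" "y \<notin> {w}" for x y
      using connected_avoiding[of w x y] that w V(1) by auto
    have "(a, b) \<in> {(x, y). {x, y} \<in> {e \<in> edges G. e \<subseteq> V \<and> e \<inter> {w} = {}}}\<^sup>*"
      if "a \<in> V - {w}" "b \<in> V - {w}" for a b
      using reach[of t "{w}" a b] conn t that by blast
    moreover have "{e \<in> edges G. e \<subseteq> V \<and> e \<inter> {w} = {}} = {e \<in> edges (induced G V). w \<notin> e}" by auto
    ultimately show ?thesis unfolding graph_connected_def delete_vertex_def fst_conv snd_conv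
      using t V by auto
  qed
  ultimately show ?thesis using c3 unfolding two_connected_def by simp
qed

text \<open>\<open>G\<close> is glued from the parts induced on \<open>VA\<close> and
  \<open>VB\<close> along \<open>{u, v}\<close>, and \<open>h\<close>, \<open>h'\<close> are the
  hexagons at that edge. Exchanging the sides gives the same structure (\<open>swap\<close>), so
  facts about one side are proved for \<open>VA\<close> alone.\<close>

locale split_graph = catacond +
  fixes u v :: 'a and VA VB :: "'a set" and h h' :: "'a set set"
  assumes cover: "VA \<union> VB = verts G" and meet: "VA \<inter> VB = {u, v}"
    and side: "e \<in> edges G \<Longrightarrow> e \<subseteq> VA \<or> e \<subseteq> VB"
    and hh': "h \<in> hexagons G" "h' \<in> hexagons G" "{u, v} \<in> h" "{u, v} \<in> h'"
    and sides: "\<Union> h \<subseteq> VA" "\<Union> h' \<subseteq> VB"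
begin

lemma uv: "{u, v} \<in> edges G" "u \<noteq> v"
proof -
  show "{u, v} \<in> edges G" using hh' hexagon_subset_edges by blast
  then show "u \<noteq> v" using edge_distinct[OF simple] by blast
qed

lemma hexagon_not_in_edge: "k \<in> hexagons G \<Longrightarrow> \<not> \<Union> k \<subseteq> {u, v}"
proof
  assume k: "k \<in> hexagons G" "\<Union> k \<subseteq> {u, v}"
  have "card (\<Union> k) \<le> card {u, v}" using k(2) by (intro card_mono) auto
  then show False using hexagon_card_verts(1)[OF k(1)] card_insert_le_m1[of 2 "{v}" u] by simp
qed

lemma not_both: "k \<in> hexagons G \<Longrightarrow> \<Union> k \<subseteq> VA \<Longrightarrow> \<not> \<Union> k \<subseteq> VB"
  using hexagon_not_in_edge meet by (metis le_inf_iff)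

lemma ne: "h \<noteq> h'" using not_both hh' sides by metis

lemma swap: "split_graph G u v VB VA h' h"
  using cover meet side hh' sides by unfold_locales auto

lemma hexagon_at_cut: "k \<in> hexagons G \<Longrightarrow> u \<in> \<Union> k \<or> v \<in> \<Union> k \<Longrightarrow> k = h \<or> k = h'"
  using no_three_hexagons[OF hh'(1,2), of k] hh'(3,4) ne by (metis UnionI insertCI)

text \<open>Only \<open>h\<close> and \<open>h'\<close> contain \<open>u\<close> or
  \<open>v\<close>. Any other hexagon avoids the cut, and consecutive vertices on it stay on the
  same side.\<close>

lemma hexagon_side:
  assumes k: "k \<in> hexagons G" shows "\<Union> k \<subseteq> VA \<or> \<Union> k \<subseteq> VB"
proof (cases "u \<in> \<Union> k \<or> v \<in> \<Union> k")
  case True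
  then show ?thesis using hexagon_at_cut[OF k] sides by blast
next
  case False
  obtain w where "w \<in> \<Union> k" using hexagon_not_in_edge[OF k] by blast
  then obtain a b c d e where d: "distinct [w, a, b, c, d, e]" "k = hexagon_edges w a b c d e"
    using hexagon_at_vertex[OF simple k] by metis
  have step: "x \<in> VA \<longleftrightarrow> y \<in> VA" "x \<in> VB \<longleftrightarrow> y \<in> VB" if xy: "{x, y} \<in> k" for x y
  proof -
    have "{x, y} \<subseteq> VA \<or> {x, y} \<subseteq> VB" using side hexagon_subset_edges[OF k] xy by blast
    moreover have "x \<notin> VA \<inter> VB" "y \<notin> VA \<inter> VB" using False xy unfolding meet by blast+
    ultimately show "x \<in> VA \<longleftrightarrow> y \<in> VA" "x \<in> VB \<longleftrightarrow> y \<in> VB" by auto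
  qed
  have "{w, a} \<in> k" "{a, b} \<in> k" "{b, c} \<in> k" "{c, d} \<in> k" "{d, e} \<in> k"
    unfolding d(2) hexagon_edges_def by auto
  note step[OF this(1)] step[OF this(2)] step[OF this(3)] step[OF this(4)] step[OF this(5)]
  moreover have "w \<in> VA \<or> w \<in> VB" using cover hexagon_verts[OF k] \<open>w \<in> \<Union> k\<close> by blast
  ultimately show ?thesis unfolding d(2) hexagon_edges_verts by auto
qed

lemma hexagons_side: "hexagons (induced G VA) = {k \<in> hexagons G. \<Union> k \<subseteq> VA}"
proof -
  have "hexagons (induced G VA) = {k \<in> hexagons G. k \<subseteq> edges (induced G VA)}"
    by (rule hexagons_subgraph) auto
  also have "\<dots> = {k \<in> hexagons G. \<Union> k \<subseteq> VA}"
  proof -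
    have "k \<subseteq> edges (induced G VA) \<longleftrightarrow> \<Union> k \<subseteq> VA" if "k \<in> hexagons G" for k
      using hexagon_subset_edges[OF that] by auto
    then show ?thesis by blast
  qed
  finally show ?thesis .
qed

lemma closed:
  assumes "{a, b} \<in> edges G" "a \<in> VA" "b \<notin> VA" shows "a \<in> {u, v}"
  using side[OF assms(1)] assms meet by blast

lemma two_connected_side: "two_connected (induced G VA)"
proof -
  obtain z0 where "z0 \<in> \<Union> h" "z0 \<notin> {u, v}" using hexagon_not_in_edge[OF hh'(1)] by blast
  then show ?thesis
    by (intro two_connected_induced[where u = u and v = v and ?z0.0 = z0])
      (use cover meet sides uv closed in auto)
qed

lemma catacondensed_side: "catacondensed (induced G VA)"
proof (rule catacondensed_subgraph)
  show "verts (induced G VA) \<subseteq> verts G" "edges (induced G VA) \<subseteq> edges G" using cover by auto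
  show "simple_graph (induced G VA)"
    using simple cover unfolding simple_graph_def by (auto intro: finite_subset)
  show "two_connected (induced G VA)" by (rule two_connected_side)
  fix k assume k: "k \<in> hexagons G"
  show "k \<subseteq> edges (induced G VA) \<or>
      (\<exists>f\<in>k. f \<notin> edges (induced G VA) \<and> (\<forall>h'\<in>hexagons G. f \<in> h' \<longrightarrow> h' = k))"
  proof (cases "\<Union> k \<subseteq> VA")
    case True
    then show ?thesis using hexagon_subset_edges[OF k] by auto
  next
    case False
    then have kB: "\<Union> k \<subseteq> VB" using hexagon_side[OF k] by blast
    \<comment> \<open>A private edge of a hexagon of the other side is really erased: within
      \<open>VA\<close> it could only be \<open>{u, v}\<close>, which two hexagons share.\<close>
    obtain f where f: "f \<in> k" "\<forall>h'\<in>hexagons G. f \<in> h' \<longrightarrow> h' = k" using private_edge[OF k] .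
    have "\<not> f \<subseteq> VA"
    proof
      assume "f \<subseteq> VA"
      then have "f \<subseteq> {u, v}" using f(1) kB meet by blast
      moreover have "card f = 2" using f(1) hexagon_subset_edges[OF k] simple unfolding simple_graph_def by blast
      ultimately have "f = {u, v}" using uv(2) by (intro card_subset_eq) auto
      then have "h = k" "h' = k" using f(2) hh' by auto
      then show False using ne by simp
    qed
    then show ?thesis using f by auto
  qed
qed

lemma common_edge: "edges (induced G VA) \<inter> edges (induced G VB) = {{u, v}}"
proof
  show "edges (induced G VA) \<inter> edges (induced G VB) \<subseteq> {{u, v}}"
  proof
    fix e assume "e \<in> edges (induced G VA) \<inter> edges (induced G VB)"
    then have "e \<subseteq> {u, v}" "e \<in> edges G" using meet by auto
    moreover from this have "card e = 2" using simple unfolding simple_graph_def by blast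
    ultimately have "e = {u, v}" using uv(2) by (intro card_subset_eq) auto
    then show "e \<in> {{u, v}}" by simp
  qed
qed (use uv meet in auto)

lemma all_edges: "edges (induced G VA) \<union> edges (induced G VB) = edges G"
  using side by auto

lemma all_hexagons: "hexagons G = hexagons (induced G VA) \<union> hexagons (induced G VB)"
  "hexagons (induced G VA) \<inter> hexagons (induced G VB) = {}"
  "h \<in> hexagons (induced G VA)" "h' \<in> hexagons (induced G VB)"
proof -
  interpret S: split_graph G u v VB VA h' h by (rule swap)
  show "hexagons G = hexagons (induced G VA) \<union> hexagons (induced G VB)"
    unfolding hexagons_side S.hexagons_side using hexagon_side by auto
  show "hexagons (induced G VA) \<inter> hexagons (induced G VB) = {}"
    unfolding hexagons_side S.hexagons_side using not_both by auto
  show "h \<in> hexagons (induced G VA)" "h' \<in> hexagons (induced G VB)"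
    unfolding hexagons_side S.hexagons_side using hh' sides by simp_all
qed

text \<open>Hexagons of different sides can meet only in \<open>u\<close> or \<open>v\<close>, where
  \<open>h\<close> and \<open>h'\<close> are the only hexagons.\<close>

lemma across:
  assumes "k \<in> hexagons (induced G VA)" "k' \<in> hexagons (induced G VB)" "\<Union> k \<inter> \<Union> k' \<noteq> {}"
  shows "k = h" "k' = h'"
proof -
  interpret S: split_graph G u v VB VA h' h by (rule swap)
  have k: "k \<in> hexagons G" "\<Union> k \<subseteq> VA" "k' \<in> hexagons G" "\<Union> k' \<subseteq> VB"
    using assms unfolding hexagons_side S.hexagons_side by auto
  then obtain w where w: "w \<in> {u, v}" "w \<in> \<Union> k" "w \<in> \<Union> k'" using assms(3) meet by blast
  then have "u \<in> \<Union> k \<or> v \<in> \<Union> k" "u \<in> \<Union> k' \<or> v \<in> \<Union> k'" by auto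
  then have "k = h \<or> k = h'" "k' = h \<or> k' = h'"
    using hexagon_at_cut[OF k(1)] hexagon_at_cut[OF k(3)] by simp_all
  then show "k = h" "k' = h'" using k(2,4) not_both[OF hh'(1)] not_both[OF hh'(2)] sides by metis+
qed

text \<open>After the cut \<open>h\<close> is the only hexagon of its side at \<open>u\<close> and
  \<open>v\<close>. This is the degree condition required by \<open>glue\<close> and
  \<open>is_B1\<close>.\<close>

lemma degree_side:
  assumes "w \<in> {u, v}" shows "degree (induced G VA) w = 2"
proof -
  interpret A: catacond "induced G VA" using catacondensed_side by unfold_locales
  have w: "w \<in> \<Union> h" using assms hh'(3) by blast
  have "\<forall>k\<in>hexagons (induced G VA). w \<in> \<Union> k \<longrightarrow> k = h"
  proof (intro ballI impI)
    fix k assume k: "k \<in> hexagons (induced G VA)" "w \<in> \<Union> k"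
    have "w \<in> \<Union> h'" using assms hh'(4) by blast
    then have "\<Union> k \<inter> \<Union> h' \<noteq> {}" using k(2) by blast
    then show "k = h" by (rule across(1)[OF k(1) all_hexagons(4)])
  qed
  then show ?thesis using A.degree_2_iff[OF all_hexagons(3) w] by simp
qed

end

text \<open>A cycle passing through \<open>u\<close> from \<open>h\<close> to \<open>h'\<close> and avoiding \<open>v\<close> would enclose \<open>h\<close>, so that the
  other edge of \<open>h\<close> at \<open>v\<close> would lie in a third hexagon at \<open>v\<close>.\<close>

lemma (in catacond) separated:
  assumes h: "h \<in> hexagons G" and h': "h' \<in> hexagons G" and ne: "h \<noteq> h'"
    and d: "distinct [u, v, a, b, c, d]" "h = hexagon_edges u v a b c d"
    and d': "distinct [u, v, a', b', c', d']" "h' = hexagon_edges u v a' b' c' d'"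
  shows "(d, d') \<notin> {(x, y). {x, y} \<in> {e \<in> edges G. e \<inter> {u, v} = {}}}\<^sup>*"
proof
  assume walk: "(d, d') \<in> {(x, y). {x, y} \<in> {e \<in> edges G. e \<inter> {u, v} = {}}}\<^sup>*"
  have mem: "{u, v} \<in> h" "{u, d} \<in> h" "{v, a} \<in> h" "{u, v} \<in> h'" "{u, d'} \<in> h'"
    using d(2) d'(2) unfolding hexagon_edges_def by (auto simp: insert_commute)
  have int: "h \<inter> h' = {{u, v}}" "\<Union> h \<inter> \<Union> h' = {u, v}"
    using hexagons_common_verts[OF h h' ne mem(1,4)] by auto
  have dd: "d \<noteq> d'"
  proof
    assume "d = d'"
    then have "d \<in> \<Union> h \<inter> \<Union> h'" using mem by auto
    then show False using int d(1) by auto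
  qed
  have n1: "u \<notin> \<Union> {e \<in> edges G. e \<inter> {u, v} = {}}" by blast
  have n2: "{e \<in> edges G. e \<inter> {u, v} = {}} \<subseteq> edges G" by blast
  have n3: "{u, d} \<in> edges G" "{u, d'} \<in> edges G"
    using mem hexagon_subset_edges[OF h] hexagon_subset_edges[OF h'] by auto
  obtain xs where xs: "is_cycle G xs" "{u, d} \<in> cycle_edges xs" "{u, d'} \<in> cycle_edges xs"
    "cycle_edges xs \<subseteq> {{u, d}, {u, d'}} \<union> {e \<in> edges G. e \<inter> {u, v} = {}}"
    using cycle_through[OF walk dd n1 n2 n3] .
  have va: "{v, a} \<notin> cycle_edges xs" using xs(4) d(1) d'(1) by (auto simp: doubleton_eq_iff)
  obtain I where I: "I \<subseteq> hexagons G" "\<forall>e\<in>cycle_edges xs. \<exists>h\<in>I. e \<in> h"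
    "\<forall>h\<in>I. \<forall>e\<in>h. e \<notin> cycle_edges xs \<longrightarrow> (\<exists>h'\<in>I. h' \<noteq> h \<and> e \<in> h')"
    using hexagons_inside[OF xs(1)] .
  have only: "k = h \<or> k = h'" if "k \<in> hexagons G" "w \<in> \<Union> k" "w \<in> {u, v}" for k w
  proof -
    have "w \<in> \<Union> h" "w \<in> \<Union> h'" using that(3) mem(1,4) by blast+
    then show ?thesis using no_three_hexagons[OF h h' that(1) _ _ that(2) ne] by blast
  qed
  obtain k where k: "k \<in> I" "{u, d} \<in> k" using I(2) xs(2) by metis
  have "{u, d} \<notin> h'"
  proof
    assume "{u, d} \<in> h'"
    then have "{u, d} \<in> h \<inter> h'" using mem by simp
    then show False using int(1) d(1) by (auto simp: doubleton_eq_iff)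
  qed
  then have "k = h" using only[of k u] k I(1) by auto
  then obtain k' where k': "k' \<in> I" "k' \<noteq> h" "{v, a} \<in> k'" using I(3) k(1) mem(3) va by metis
  then have "k' = h'" using only[of k' v] I(1) by auto
  then have "{v, a} \<in> h \<inter> h'" using k' mem by simp
  then show False using int(1) d(1) by (auto simp: doubleton_eq_iff)
qed

text \<open>The vertex \<open>d\<close> is the neighbour of \<open>u\<close> on \<open>h\<close>
  other than \<open>v\<close>. One side is its component after deleting \<open>u\<close> and
  \<open>v\<close>, with these two added back. By \<open>separated\<close> it misses
  \<open>d'\<close>, and the remaining vertices of each hexagon follow along its path avoiding
  \<open>u\<close> and \<open>v\<close>.\<close>

lemma (in catacond) split_exists:
  assumes h: "h \<in> hexagons G" and h': "h' \<in> hexagons G" and ne: "h \<noteq> h'"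
    and e: "{u, v} \<in> h" "{u, v} \<in> h'"
  obtains VA VB where "split_graph G u v VA VB h h'"
proof -
  obtain a b c d where d: "distinct [u, v, a, b, c, d]" "h = hexagon_edges u v a b c d"
    using hexagon_at_edge[OF h e(1)] .
  obtain a' b' c' d' where d': "distinct [u, v, a', b', c', d']" "h' = hexagon_edges u v a' b' c' d'"
    using hexagon_at_edge[OF h' e(2)] .
  define R where "R = {(x, y). {x, y} \<in> {e \<in> edges G. e \<inter> {u, v} = {}}}"
  define A where "A = {z. (d, z) \<in> R\<^sup>*}"
  have nd': "d' \<notin> A" using separated[OF h h' ne d d'] unfolding A_def R_def by simp
  have dA: "d \<in> A" unfolding A_def by simp
  have step: "y \<in> A" if "x \<in> A" "{x, y} \<in> edges G" "{x, y} \<inter> {u, v} = {}" for x y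
  proof -
    have "(x, y) \<in> R" using that unfolding R_def by simp
    then show ?thesis using that(1) unfolding A_def by (auto intro: rtrancl_into_rtrancl)
  qed
  have sub: "A \<subseteq> verts G - {u, v}"
  proof
    fix z assume "z \<in> A"
    then have "(d, z) \<in> R\<^sup>*" unfolding A_def by simp
    then show "z \<in> verts G - {u, v}"
    proof (cases rule: rtranclE)
      case base
      have "d \<in> \<Union> h" unfolding d(2) hexagon_edges_verts by simp
      then have "d \<in> verts G" using hexagon_verts[OF h] by blast
      then show ?thesis using base d(1) by auto
    next
      case (step y)
      then have "{y, z} \<in> edges G" "{y, z} \<inter> {u, v} = {}" unfolding R_def by auto
      then show ?thesis using edge_distinct[OF simple] by auto
    qed
  qed
  have E: "{d, c} \<in> edges G" "{c, b} \<in> edges G" "{b, a} \<in> edges G"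
    "{a', b'} \<in> edges G" "{b', c'} \<in> edges G" "{c', d'} \<in> edges G"
    using hexagon_subset_edges[OF h] hexagon_subset_edges[OF h'] unfolding d(2) d'(2) hexagon_edges_def
    by (auto simp: insert_commute)
  have inA: "c \<in> A" "b \<in> A" "a \<in> A"
  proof -
    show "c \<in> A" using step[OF dA E(1)] d(1) by auto
    then show "b \<in> A" using step[OF _ E(2)] d(1) by auto
    then show "a \<in> A" using step[OF _ E(3)] d(1) by auto
  qed
  have notA: "c' \<notin> A" "b' \<notin> A" "a' \<notin> A"
  proof -
    show "c' \<notin> A" using step[OF _ E(6)] d'(1) nd' by auto
    then show "b' \<notin> A" using step[OF _ E(5)] d'(1) by auto
    then show "a' \<notin> A" using step[OF _ E(4)] d'(1) by auto
  qed
  have uvV: "u \<in> verts G" "v \<in> verts G"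
    using edge_distinct[OF simple, of u v] e hexagon_subset_edges[OF h] by auto
  have "split_graph G u v (A \<union> {u, v}) (verts G - A) h h'"
  proof unfold_locales
    show "A \<union> {u, v} \<union> (verts G - A) = verts G" using sub uvV by blast
    show "(A \<union> {u, v}) \<inter> (verts G - A) = {u, v}" using sub uvV by blast
    show "\<Union> h \<subseteq> A \<union> {u, v}" unfolding d(2) hexagon_edges_verts using inA dA by auto
    have "\<Union> h' \<subseteq> verts G" using hexagon_verts[OF h'] .
    moreover have "\<Union> h' \<inter> A = {}" unfolding d'(2) hexagon_edges_verts using notA nd' sub by auto
    ultimately show "\<Union> h' \<subseteq> verts G - A" by blast
    fix f assume f: "f \<in> edges G"
    then obtain x y where xy: "f = {x, y}" using simple unfolding simple_graph_def card_2_iff by blast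
    then have V: "x \<in> verts G" "y \<in> verts G" using edge_distinct[OF simple] f by auto
    have "x \<in> A \<longleftrightarrow> y \<in> A" if "{x, y} \<inter> {u, v} = {}"
      using step[of x y] step[of y x] that f xy by (auto simp: insert_commute)
    then show "f \<subseteq> A \<union> {u, v} \<or> f \<subseteq> verts G - A" using xy V sub by auto
  qed (use assms in auto)
  then show thesis using that by blast
qed

section \<open>Trees of maximum degree three\<close>

text \<open>A tree given by neighbourhoods: connectedness says that no proper nonempty subset is
  closed under neighbours, and acyclicity is replaced by the degree sum for
  \<open>card H - 1\<close> edges, with 2 added on the left to avoid subtraction.\<close>

locale subcubic_tree =
  fixes H :: "'b set" and nb :: "'b \<Rightarrow> 'b set"
  assumes fin: "finite H" and ne: "H \<noteq> {}"
    and nb_sub: "k \<in> H \<Longrightarrow> nb k \<subseteq> H" and irrefl: "k \<notin> nb k"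
    and sym: "k \<in> H \<Longrightarrow> k' \<in> nb k \<Longrightarrow> k \<in> nb k'"
    and connected: "X \<subseteq> H \<Longrightarrow> X \<noteq> {} \<Longrightarrow> (\<And>k. k \<in> X \<Longrightarrow> nb k \<subseteq> X) \<Longrightarrow> X = H"
    and degree_sum: "(\<Sum>k\<in>H. card (nb k)) + 2 = 2 * card H"
    and degree_le: "k \<in> H \<Longrightarrow> card (nb k) \<le> 3"
begin

lemma fin_nb: "k \<in> H \<Longrightarrow> finite (nb k)"
  using nb_sub fin finite_subset by metis

lemma degree_pos:
  assumes "k \<in> H" "2 \<le> card H" shows "1 \<le> card (nb k)"
proof (rule ccontr)
  assume "\<not> ?thesis"
  then have "nb k = {}" using fin_nb[OF assms(1)] by (simp add: not_less_eq_eq)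
  then have "{k} = H" using connected[of "{k}"] assms(1) by auto
  then show False using assms(2) by (metis One_nat_def card_1_singleton_iff not_less_eq_eq numeral_2_eq_2 order_refl)
qed

definition "leaves = {k \<in> H. card (nb k) = 1}"

lemma leaf_nb: assumes "l \<in> leaves" "a \<in> nb l" shows "nb l = {a}"
  using assms unfolding leaves_def by (auto simp: card_1_singleton_iff)

text \<open>All degrees are 1, 2 or 3, and their sum is two less than twice the number of vertices;
  so leaves outnumber the vertices of degree 3 by two.\<close>

lemma leaf_count:
  assumes "2 \<le> card H"
  shows "card leaves = card {k \<in> H. card (nb k) = 3} + 2"
proof -
  let ?B3 = "{k \<in> H. card (nb k) = 3}"
  have "(\<Sum>k\<in>H. card (nb k) + of_bool (k \<in> leaves)) = (\<Sum>k\<in>H. 2 + of_bool (k \<in> ?B3))"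
  proof (rule sum.cong)
    fix k assume k: "k \<in> H"
    then have "card (nb k) = 1 \<or> card (nb k) = 2 \<or> card (nb k) = 3"
      using degree_pos[OF k assms] degree_le[OF k] by linarith
    then show "card (nb k) + of_bool (k \<in> leaves) = 2 + of_bool (k \<in> ?B3)"
      using k unfolding leaves_def by auto
  qed simp
  moreover have "(\<Sum>k\<in>H. of_bool (k \<in> leaves)) = card leaves"
    using fin unfolding leaves_def by (simp add: of_bool_def sum.If_cases Int_def conj_commute)
  moreover have "(\<Sum>k\<in>H. of_bool (k \<in> ?B3)) = card ?B3"
    using fin by (simp add: of_bool_def sum.If_cases Int_def conj_commute)
  moreover have "(\<Sum>k\<in>H. (2::nat)) = 2 * card H" by simp
  ultimately show ?thesis using degree_sum unfolding sum.distrib by linarith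
qed

section \<open>Edge count against an independent set\<close>

context
  fixes S :: "'b set"
  assumes SH: "S \<subseteq> H" and indep: "\<And>s. s \<in> S \<Longrightarrow> nb s \<inter> S = {}"
begin

abbreviation "N \<equiv> H - S"

lemma finS: "finite S" and finN: "finite N"
  using SH fin finite_subset by auto

lemma card_H: "card H = card S + card N"
  using card_Diff_subset[OF finS SH] card_mono[OF fin SH] by simp

text \<open>The degrees over \<open>N\<close> count every edge of the tree once and the edges inside
  \<open>N\<close> a second time. Doubling matches the last sum, which sees each edge inside
  \<open>N\<close> from both ends.\<close>

lemma edges_from_N:
  "2 * (\<Sum>k\<in>N. card (nb k)) + 2 = 2 * card H + (\<Sum>k\<in>N. card (nb k \<inter> N))"
proof -
  have "(\<Sum>s\<in>S. card (nb s)) = (\<Sum>s\<in>S. \<Sum>k\<in>N. of_bool (k \<in> nb s))"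
  proof (rule sum.cong)
    fix s assume s: "s \<in> S"
    then have "nb s = {k \<in> N. k \<in> nb s}" using indep nb_sub SH by blast
    moreover have "card {k \<in> N. k \<in> nb s} = (\<Sum>k\<in>N. of_bool (k \<in> nb s))"
      using finN by (simp add: sum.inter_filter[symmetric] of_bool_def)
    ultimately show "card (nb s) = (\<Sum>k\<in>N. of_bool (k \<in> nb s))" by simp
  qed simp
  also have "\<dots> = (\<Sum>k\<in>N. \<Sum>s\<in>S. of_bool (k \<in> nb s))" by (rule sum.swap)
  also have "\<dots> = (\<Sum>k\<in>N. card (nb k \<inter> S))"
  proof (rule sum.cong)
    fix k assume k: "k \<in> N"
    have "nb k \<inter> S = {s \<in> S. k \<in> nb s}" using sym k SH by blast
    moreover have "card {s \<in> S. k \<in> nb s} = (\<Sum>s\<in>S. of_bool (k \<in> nb s))"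
      using finS by (simp add: sum.inter_filter[symmetric] of_bool_def)
    ultimately show "(\<Sum>s\<in>S. of_bool (k \<in> nb s)) = card (nb k \<inter> S)" by simp
  qed simp
  finally have SN: "(\<Sum>s\<in>S. card (nb s)) = (\<Sum>k\<in>N. card (nb k \<inter> S))" .
  have "(\<Sum>k\<in>N. card (nb k)) = (\<Sum>k\<in>N. card (nb k \<inter> S) + card (nb k \<inter> N))"
  proof (rule sum.cong)
    fix k assume k: "k \<in> N"
    have "nb k = (nb k \<inter> S) \<union> (nb k \<inter> N)" using nb_sub[of k] k by blast
    then show "card (nb k) = card (nb k \<inter> S) + card (nb k \<inter> N)"
      using card_Un_disjoint[of "nb k \<inter> S" "nb k \<inter> N"] fin_nb[of k] k by auto
  qed simp
  then have "(\<Sum>k\<in>N. card (nb k)) = (\<Sum>s\<in>S. card (nb s)) + (\<Sum>k\<in>N. card (nb k \<inter> N))"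
    using SN by (simp add: sum.distrib)
  moreover have "(\<Sum>k\<in>H. card (nb k)) = (\<Sum>s\<in>S. card (nb s)) + (\<Sum>k\<in>N. card (nb k))"
    using sum.subset_diff[OF SH fin] by (simp add: add.commute)
  ultimately show ?thesis using degree_sum by linarith
qed

text \<open>The exact form of \<open>card H - 1 \<le> 3 * card N\<close>, doubled. The slack comes
  from vertices of \<open>N\<close> with fewer than three neighbours and from edges inside
  \<open>N\<close>. The subtraction never truncates, since degrees are at most 3.\<close>

lemma defect:
  "(\<Sum>k\<in>N. 6 - 2 * card (nb k)) + (\<Sum>k\<in>N. card (nb k \<inter> N)) + 6 * card S = 4 * card H + 2"
proof -
  have "(\<Sum>k\<in>N. 6 - 2 * card (nb k)) + 2 * (\<Sum>k\<in>N. card (nb k)) = (\<Sum>k\<in>N. 6)"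
    unfolding sum_distrib_left sum.distrib[symmetric]
  proof (rule sum.cong)
    fix k assume "k \<in> N"
    then show "6 - 2 * card (nb k) + 2 * card (nb k) = 6" using degree_le[of k] by auto
  qed simp
  also have "\<dots> = 6 * card N" by simp
  finally show ?thesis using edges_from_N card_H by linarith
qed

lemma independent_bound: "3 * card S \<le> 2 * card H + 1"
  using defect by linarith

text \<open>A vertex of \<open>N\<close> with three neighbours, two of which are leaves in \<open>S\<close>, can be removed together
  with these leaves. If there is none, the leaves inject into \<open>N\<close>, and
  comparing their number with the number of vertices of degree 3 forces equality everywhere.\<close>

lemma rigid_structure:
  assumes large: "2 * card H \<le> 3 * card S + 1" and n3: "3 \<le> card H"
    and not3: "\<And>a. a \<in> N \<Longrightarrow> nb a \<subseteq> leaves \<inter> S \<Longrightarrow> card (nb a) \<noteq> 2"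
    and irreducible: "\<And>a s t. a \<in> N \<Longrightarrow> card (nb a) = 3 \<Longrightarrow> s \<in> nb a \<Longrightarrow> t \<in> nb a \<Longrightarrow>
      s \<in> leaves \<inter> S \<Longrightarrow> t \<in> leaves \<inter> S \<Longrightarrow> s = t"
  shows "leaves \<subseteq> S" "card {a \<in> N. card (nb a) = 2} = 2"
    "\<And>a. a \<in> N \<Longrightarrow> nb a \<subseteq> S" "\<And>a. a \<in> N \<Longrightarrow> card (nb a) = 2 \<or> card (nb a) = 3"
    "\<And>a. a \<in> N \<Longrightarrow> \<exists>l. nb a \<inter> leaves = {l}"
    "\<And>s. s \<in> S \<Longrightarrow> card (nb s) = 1 \<or> card (nb s) = 2"
proof -
  let ?L1 = "{a \<in> N. card (nb a) = 1}" and ?D2 = "{a \<in> N. card (nb a) = 2}"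
    and ?D3 = "{a \<in> N. card (nb a) = 3}" and ?B3 = "{k \<in> H. card (nb k) = 3}"
  have n2: "2 \<le> card H" using n3 by simp
  have fins: "finite ?L1" "finite ?D2" "finite ?D3" "finite ?B3" "finite leaves"
    using fin finN unfolding leaves_def by auto
  have "(\<Sum>k\<in>N. 6 - 2 * card (nb k)) = (\<Sum>k\<in>N. 4 * of_bool (k \<in> ?L1) + 2 * of_bool (k \<in> ?D2))"
  proof (rule sum.cong)
    fix k assume k: "k \<in> N"
    then have kH: "k \<in> H" by simp
    have "card (nb k) = 1 \<or> card (nb k) = 2 \<or> card (nb k) = 3"
      using degree_pos[OF kH n2] degree_le[OF kH] by linarith
    then show "6 - 2 * card (nb k) = 4 * of_bool (k \<in> ?L1) + 2 * of_bool (k \<in> ?D2)" using k by auto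
  qed simp
  also have "\<dots> = 4 * (\<Sum>k\<in>N. of_bool (k \<in> ?L1)) + 2 * (\<Sum>k\<in>N. of_bool (k \<in> ?D2))"
    by (simp only: sum.distrib sum_distrib_left)
  also have "(\<Sum>k\<in>N. of_bool (k \<in> ?L1)) = card ?L1"
    using finN by (simp add: of_bool_def sum.If_cases Int_def conj_commute)
  also have "(\<Sum>k\<in>N. of_bool (k \<in> ?D2)) = card ?D2"
    using finN by (simp add: of_bool_def sum.If_cases Int_def conj_commute)
  \<comment> \<open>The left side is twice the slack: a leaf outside \<open>S\<close> costs 4, a
    vertex of \<open>N\<close> of degree 2 costs 2, an edge inside \<open>N\<close> costs 2.\<close>
  finally have small: "4 * card ?L1 + 2 * card ?D2 + (\<Sum>k\<in>N. card (nb k \<inter> N)) \<le> 4"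
    using defect large by linarith
  define g where "g l = (THE a. nb l = {a})" for l
  have g: "nb l = {g l}" "g l \<in> H" if l: "l \<in> leaves" for l
  proof -
    obtain a where a: "nb l = {a}" using l unfolding leaves_def by (auto simp: card_1_singleton_iff)
    then show "nb l = {g l}" unfolding g_def by auto
    then show "g l \<in> H" using nb_sub[of l] l unfolding leaves_def by auto
  qed
  have gN: "g l \<in> ?D2 \<union> ?D3" "l \<in> nb (g l)" if l: "l \<in> leaves \<inter> S" for l
  proof -
    have lH: "l \<in> H" using l SH by blast
    have nbl: "nb l = {g l}" using g l by blast
    then have "g l \<notin> S" using indep[of l] l by blast
    then have gN: "g l \<in> N" using g(2) l by blast
    show lg: "l \<in> nb (g l)" using sym[OF lH] nbl by blast
    \<comment> \<open>Two adjacent leaves would form the whole tree.\<close>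
    have "card (nb (g l)) \<noteq> 1"
    proof
      assume "card (nb (g l)) = 1"
      then have "nb (g l) = {l}" using lg by (auto simp: card_1_singleton_iff)
      then have "{l, g l} = H" using connected[of "{l, g l}"] nbl lH gN by auto
      then have "card H \<le> 2" using card_insert_le_m1[of 2 "{g l}" l] by simp
      then show False using n3 by simp
    qed
    then show "g l \<in> ?D2 \<union> ?D3" using degree_pos[of "g l"] degree_le[of "g l"] n2 gN by fastforce
  qed
  have inj: "inj_on g (leaves \<inter> S)"
  proof (rule inj_onI, rule ccontr)
    fix l l' assume l: "l \<in> leaves \<inter> S" "l' \<in> leaves \<inter> S" and eq: "g l = g l'" and "l \<noteq> l'"
    have mem: "l \<in> nb (g l)" "l' \<in> nb (g l)" using gN(2)[OF l(1)] gN(2)[OF l(2)] eq by simp_all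
    have "g l \<in> ?D2"
      using gN(1)[OF l(1)] irreducible[of "g l" l l'] mem l \<open>l \<noteq> l'\<close> by blast
    then have c: "card (nb (g l)) = 2" and gNl: "g l \<in> N" by auto
    have "nb (g l) = {l, l'}"
      using mem \<open>l \<noteq> l'\<close> c fin_nb[of "g l"] gNl by (intro card_subset_eq[symmetric]) auto
    then show False using not3[OF gNl] l c by auto
  qed
  have img: "g ` (leaves \<inter> S) \<subseteq> ?D2 \<union> ?D3" using gN by blast
  have disj: "?D2 \<inter> ?D3 = {}" by auto
  then have cD: "card (?D2 \<union> ?D3) = card ?D2 + card ?D3" using fins by (intro card_Un_disjoint) auto
  have le1: "card (leaves \<inter> S) \<le> card ?D2 + card ?D3"
    using card_mono[OF _ img] card_image[OF inj] fins cD by simp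
  have D3B3: "?D3 \<subseteq> ?B3" by auto
  then have le2: "card ?D3 \<le> card ?B3" using fins by (intro card_mono) auto
  have "leaves = (leaves \<inter> S) \<union> ?L1" unfolding leaves_def using SH by auto
  then have le3: "card leaves \<le> card (leaves \<inter> S) + card ?L1" by (metis card_Un_le)
  note lc = leaf_count[OF n2]
  \<comment> \<open>The leaf counts give \<open>card ?D3 + 2 \<le> card leaves \<le> card ?D2 + card
    ?D3 + card ?L1\<close>, so \<open>?D2\<close> and \<open>?L1\<close> together have at least two
    elements. Under \<open>small\<close> this leaves only \<open>card ?D2 = 2\<close>, with
    \<open>?L1\<close> empty and no edge inside \<open>N\<close>.\<close>
  have L1: "card ?L1 = 0" and D2: "card ?D2 = 2" and Y: "(\<Sum>k\<in>N. card (nb k \<inter> N)) = 0"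
    using small le1 le2 le3 lc by linarith+
  show "card ?D2 = 2" by (rule D2)
  have L1e: "?L1 = {}" using L1 fins by simp
  show LS: "leaves \<subseteq> S" using L1e unfolding leaves_def by auto
  show "nb a \<subseteq> S" if "a \<in> N" for a
  proof -
    have "card (nb a \<inter> N) = 0" using Y that finN by simp
    then have "nb a \<inter> N = {}" using fin_nb[of a] that by auto
    then show ?thesis using nb_sub[of a] that by blast
  qed
  show N23: "card (nb a) = 2 \<or> card (nb a) = 3" if a: "a \<in> N" for a
  proof -
    have "card (nb a) \<noteq> 1" using L1e a by blast
    then show ?thesis using degree_pos[of a] degree_le[of a] n2 a by fastforce
  qed
  have Leq: "leaves \<inter> S = leaves" using LS by blast
  have cardL: "card leaves = card ?D2 + card ?D3" "card ?D3 = card ?B3"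
    using le1 le2 lc D2 unfolding Leq by linarith+
  have "?D3 = ?B3" using D3B3 cardL(2) fins by (intro card_subset_eq) auto
  show "card (nb s) = 1 \<or> card (nb s) = 2" if s: "s \<in> S" for s
  proof -
    have sH: "s \<in> H" using s SH by blast
    have "card (nb s) \<noteq> 3" using \<open>?D3 = ?B3\<close> s sH by blast
    then show ?thesis using degree_pos[OF sH n2] degree_le[OF sH] by linarith
  qed
  have gim: "g ` leaves = ?D2 \<union> ?D3"
    using img card_image[OF inj] cardL(1) cD fins unfolding Leq by (intro card_subset_eq) auto
  show "\<exists>l. nb a \<inter> leaves = {l}" if a: "a \<in> N" for a
  proof -
    have "a \<in> ?D2 \<union> ?D3" using N23[OF a] a by blast
    then obtain l where l: "l \<in> leaves" "a = g l" using gim by blast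
    have "l' = l" if "l' \<in> nb a" "l' \<in> leaves" for l'
    proof -
      have "a \<in> nb l'" using sym[of a l'] that a by blast
      then have "g l' = a" using g(1)[OF that(2)] by simp
      then show "l' = l" using inj l that unfolding Leq inj_on_def by blast
    qed
    moreover have "l \<in> nb a" using gN(2)[of l] l Leq by blast
    ultimately show ?thesis using l by blast
  qed
qed

text \<open>The non-leaves induce a graph with two vertices of degree 1, all others having degree 2; a longest
  path in it starting at a vertex of degree 1 is closed under adjacency, hence contains all non-leaves.\<close>

lemma spine:
  assumes L: "leaves \<subseteq> S" and D2: "card {a \<in> N. card (nb a) = 2} = 2"
    and NS: "\<And>a. a \<in> N \<Longrightarrow> nb a \<subseteq> S" and N23: "\<And>a. a \<in> N \<Longrightarrow> card (nb a) = 2 \<or> card (nb a) = 3"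
    and lf: "\<And>a. a \<in> N \<Longrightarrow> \<exists>l. nb a \<inter> leaves = {l}"
    and S12: "\<And>s. s \<in> S \<Longrightarrow> card (nb s) = 1 \<or> card (nb s) = 2"
  obtains xs where "distinct xs" "set xs = H - leaves" "3 \<le> length xs"
    "{a \<in> N. card (nb a) = 2} = {hd xs, last xs}" "hd xs \<noteq> last xs"
    "\<forall>i. Suc i < length xs \<longrightarrow> xs ! Suc i \<in> nb (xs ! i)"
proof -
  let ?K = "H - leaves" and ?D2 = "{a \<in> N. card (nb a) = 2}"
  define nk where "nk x = nb x - leaves" for x
  have nk_sub: "nk x \<subseteq> ?K" if "x \<in> H" for x using nb_sub[OF that] unfolding nk_def by blast
  have nk_sym: "x \<in> nk y" if "y \<in> nk x" "x \<in> ?K" for x y using sym[of x y] that unfolding nk_def by blast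
  have fnk: "finite (nk x)" if "x \<in> H" for x using fin_nb[OF that] unfolding nk_def by blast
  have NK: "N \<subseteq> ?K" using L by blast
  have nkN: "card (nk a) = card (nb a) - 1" if a: "a \<in> N" for a
  proof -
    obtain l where l: "nb a \<inter> leaves = {l}" using lf[OF a] by blast
    then have "nk a = nb a - {l}" "l \<in> nb a" unfolding nk_def by blast+
    then show ?thesis using fin_nb[of a] a by simp
  qed
  \<comment> \<open>All leaves lie in the independent set \<open>S\<close>, so a member of
    \<open>S\<close> has no leaf beside it and loses nothing in \<open>nk\<close>.\<close>
  have nkS: "card (nk s) = 2" if s: "s \<in> S" "s \<notin> leaves" for s
  proof -
    have "nb s \<inter> leaves = {}" using indep[OF s(1)] L by blast
    then have "nk s = nb s" unfolding nk_def by blast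
    then show ?thesis using S12[OF s(1)] s SH unfolding leaves_def by auto
  qed
  have nk12: "card (nk x) = (if x \<in> ?D2 then 1 else 2)" if x: "x \<in> ?K" for x
  proof (cases "x \<in> S")
    case True
    then show ?thesis using nkS[OF True] x by auto
  next
    case False
    then have "x \<in> N" using x by blast
    then show ?thesis using nkN[of x] N23[of x] by auto
  qed
  have "?D2 \<noteq> {}" using D2 by (metis card.empty zero_neq_numeral)
  then obtain a where a: "a \<in> ?D2" by blast
  then have aK: "a \<in> ?K" using NK by blast
  define walk where "walk xs \<longleftrightarrow> distinct xs \<and> xs \<noteq> [] \<and> hd xs = a \<and> set xs \<subseteq> ?K \<and>
      (\<forall>i. Suc i < length xs \<longrightarrow> xs ! Suc i \<in> nk (xs ! i))" for xs
  have w1: "walk [a]" unfolding walk_def using aK by simp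
  have bound: "length xs \<le> card H" if "walk xs" for xs
  proof -
    have "length xs = card (set xs)" using that unfolding walk_def by (simp add: distinct_card)
    also have "\<dots> \<le> card H" using that fin unfolding walk_def by (intro card_mono) auto
    finally show ?thesis .
  qed
  have "\<forall>ys. walk ys \<longrightarrow> length ys < Suc (card H)" using bound by (simp add: less_Suc_eq_le)
  then have "\<exists>xs. walk xs \<and> (\<forall>ys. walk ys \<longrightarrow> length ys \<le> length xs)"
    using ex_has_greatest_nat[where P = walk and k = "[a]" and f = length] w1 by blast
  then obtain xs where xs: "walk xs" and max: "\<And>ys. walk ys \<Longrightarrow> length ys \<le> length xs"
    by blast
  have dist: "distinct xs" and nonempty: "xs \<noteq> []" and hd: "hd xs = a" and setK: "set xs \<subseteq> ?K"
    and adj: "\<And>i. Suc i < length xs \<Longrightarrow> xs ! Suc i \<in> nk (xs ! i)"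
    using xs unfolding walk_def by auto
  let ?m = "length xs"
  have x0: "xs ! 0 = a" using hd nonempty by (simp add: hd_conv_nth)
  have lst: "last xs = xs ! (?m - 1)" using nonempty by (simp add: last_conv_nth)
  have stuck: "nk (last xs) \<subseteq> set xs"
  proof
    fix y assume y: "y \<in> nk (last xs)"
    show "y \<in> set xs"
    proof (rule ccontr)
      assume ny: "y \<notin> set xs"
      have "last xs \<in> H" using nonempty setK last_in_set by blast
      then have yK: "y \<in> ?K" using nk_sub y by blast
      have "walk (xs @ [y])"
        unfolding walk_def
      proof (intro conjI allI impI)
        fix i assume i: "Suc i < length (xs @ [y])"
        show "(xs @ [y]) ! Suc i \<in> nk ((xs @ [y]) ! i)"
        proof (cases "Suc i < ?m")
          case True
          then show ?thesis using adj by (simp add: nth_append)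
        next
          case False
          then have i: "Suc i = ?m" using i by simp
          then have "i = ?m - 1" "i < ?m" by simp_all
          then have "(xs @ [y]) ! i = last xs" using lst by (simp add: nth_append)
          moreover have "(xs @ [y]) ! Suc i = y" using i by (simp add: nth_append)
          ultimately show ?thesis using y by simp
        qed
      qed (use dist ny nonempty hd setK yK in auto)
      then show False using max[of "xs @ [y]"] by simp
    qed
  qed
  have backward: "xs ! i \<in> nk (xs ! Suc i)" if "Suc i < ?m" for i
    using nk_sym[OF adj[OF that]] setK that by (meson Suc_lessD nth_mem subsetD)
  have xK: "xs ! i \<in> ?K" if "i < ?m" for i using setK that by (meson nth_mem subsetD)
  have m2: "2 \<le> ?m"
  proof (rule ccontr)
    assume "\<not> 2 \<le> ?m"
    then have "?m = 1" using nonempty by (cases xs) (auto simp: not_less_eq_eq)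
    then have e: "xs = [a]" using x0 by (auto simp: length_Suc_conv)
    have "card (nk a) = 1" using nk12[OF aK] a by simp
    then obtain c where c: "nk a = {c}" by (auto simp: card_1_singleton_iff)
    then have "c \<in> nb a" "c = a" using stuck e unfolding nk_def by auto
    then show False using irrefl by blast
  qed
  have nk0: "nk (xs ! 0) = {xs ! 1}"
  proof -
    have "card (nk a) = 1" using nk12[OF aK] a by simp
    then obtain c where "nk a = {c}" by (auto simp: card_1_singleton_iff)
    then show ?thesis using adj[of 0] m2 x0 by auto
  qed
  have nki: "nk (xs ! i) = {xs ! (i - 1), xs ! Suc i}" if i: "0 < i" "Suc i < ?m" for i
  proof -
    have sub: "{xs ! (i - 1), xs ! Suc i} \<subseteq> nk (xs ! i)" using adj[of i] backward[of "i - 1"] i by auto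
    have "xs ! (i - 1) \<noteq> xs ! Suc i" using dist i by (simp add: nth_eq_iff_index_eq)
    then have c2: "card {xs ! (i - 1), xs ! Suc i} = 2" by simp
    have K: "xs ! i \<in> ?K" using xK i by simp
    have "card (nk (xs ! i)) \<le> 2" using nk12[OF K] by simp
    moreover have "finite (nk (xs ! i))" using fnk K by blast
    ultimately show ?thesis using card_seteq[of "nk (xs ! i)", OF _ sub] c2 by simp
  qed
  have nkset: "nk x \<subseteq> set xs" if x: "x \<in> set xs" for x
  proof -
    obtain i where i: "x = xs ! i" "i < ?m" using x by (auto simp: in_set_conv_nth)
    consider "i = 0" | "0 < i" "Suc i < ?m" | "i = ?m - 1" using i(2) by linarith
    then show ?thesis
    proof cases
      case 1 then show ?thesis using nk0 i m2 by auto
    next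
      case 2
      have "xs ! (i - 1) \<in> set xs" "xs ! Suc i \<in> set xs" using 2 by auto
      then show ?thesis using nki[OF 2] i by simp
    next
      case 3 then show ?thesis using stuck lst i by simp
    qed
  qed
  \<comment> \<open>The path together with its pendant leaves is closed under neighbours, so
    connectedness leaves nothing outside.\<close>
  have "set xs \<union> {l \<in> leaves. nb l \<subseteq> set xs} = H"
  proof (rule connected)
    show "set xs \<union> {l \<in> leaves. nb l \<subseteq> set xs} \<subseteq> H" using setK unfolding leaves_def by blast
    show "set xs \<union> {l \<in> leaves. nb l \<subseteq> set xs} \<noteq> {}" using nonempty by simp
    fix k assume k: "k \<in> set xs \<union> {l \<in> leaves. nb l \<subseteq> set xs}"
    show "nb k \<subseteq> set xs \<union> {l \<in> leaves. nb l \<subseteq> set xs}"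
    proof (cases "k \<in> set xs")
      case True
      show ?thesis
      proof
        fix y assume y: "y \<in> nb k"
        show "y \<in> set xs \<union> {l \<in> leaves. nb l \<subseteq> set xs}"
        proof (cases "y \<in> leaves")
          case yl: True
          have "k \<in> nb y" using sym[of k y] y True setK by blast
          then have "nb y = {k}" using leaf_nb[OF yl] by blast
          then show ?thesis using yl True by simp
        next
          case False
          then show ?thesis using nkset[OF True] y unfolding nk_def by blast
        qed
      qed
    next
      case False
      then show ?thesis using k by blast
    qed
  qed
  then have setxs: "set xs = ?K" using setK by blast
  let ?z = "last xs"
  have zK: "?z \<in> ?K" using setK nonempty last_in_set by blast
  have za: "?z \<noteq> a" using x0 lst dist m2 nonempty nth_eq_iff_index_eq[OF dist, of "?m - 1" 0] by auto
  \<comment> \<open>A neighbour of the last vertex lies on the path, and the neighbours of every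
    earlier vertex are already known; only the predecessor qualifies.\<close>
  have "card (nk ?z) = 1"
  proof -
    have "nk ?z \<subseteq> {xs ! (?m - 2)}"
    proof
      fix y assume y: "y \<in> nk ?z"
      then obtain j where j: "y = xs ! j" "j < ?m" using stuck by (metis in_set_conv_nth subsetD)
      have zj: "xs ! (?m - 1) \<in> nk (xs ! j)" using nk_sym[OF y zK] lst j by simp
      have "j \<noteq> ?m - 1"
      proof
        assume "j = ?m - 1"
        then have "xs ! j \<in> nb (xs ! j)" using zj unfolding nk_def by simp
        then show False using irrefl by blast
      qed
      moreover have "xs ! (?m - 1) = xs ! i \<longleftrightarrow> ?m - 1 = i" if "i < ?m" for i
        using nth_eq_iff_index_eq[OF dist, of "?m - 1" i] that nonempty by simp
      ultimately have "j = ?m - 2"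
        using zj nk0 nki[of j] j(2) m2 by (cases "j = 0") auto
      then show "y \<in> {xs ! (?m - 2)}" using j by simp
    qed
    then have "card (nk ?z) \<le> 1" using card_mono[of "{xs ! (?m - 2)}"] by simp
    then show ?thesis using nk12[OF zK] by (simp split: if_splits)
  qed
  then have zD: "?z \<in> ?D2" using nk12[OF zK] by (cases "?z \<in> ?D2") (simp_all only: if_False)
  have "{a, ?z} = ?D2"
    using D2 za a zD fin by (intro card_subset_eq) auto
  then have D2eq: "?D2 = {hd xs, last xs}" using hd by simp
  \<comment> \<open>On two vertices the ends would be adjacent, but both lie in \<open>N\<close>,
    inside which there is no edge.\<close>
  have m3: "3 \<le> ?m"
  proof (rule ccontr)
    assume "\<not> 3 \<le> ?m"
    then have "?m = 2" using m2 by simp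
    then have "?z \<in> nb a" using adj[of 0] x0 lst unfolding nk_def by simp
    then show False using NS[of a] a zD by blast
  qed
  show thesis
    by (rule that[of xs]) (use dist setxs m3 D2eq za hd adj in \<open>auto simp: nk_def\<close>)
qed

end

end

text \<open>The label of the leaf attached to \<open>v\<^sub>j\<close>, where the ends \<open>v\<^sub>1\<close> and \<open>v\<^sub>2\<^sub>k\<^sub>+\<^sub>1\<close> of the path count
  as leaves attached to \<open>v\<^sub>2\<close> and \<open>v\<^sub>2\<^sub>k\<close>.\<close>

definition leaf_label :: "nat \<Rightarrow> nat \<Rightarrow> nat + nat" where
  "leaf_label k j = (if j = 2 then Inl 1 else if j = 2 * k then Inl (2 * k + 1) else Inr j)"

text \<open>Reads \<open>T_k\<close> as a spine from \<open>v_2\<close> to \<open>v_(2k)\<close>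
  with exactly one pendant leaf at each even position, so that the ends of the defining path become
  ordinary leaves.\<close>

lemma tree_T_verts:
  assumes "2 \<le> k"
  shows "verts (tree_T k) = Inl ` {2..2 * k} \<union> leaf_label k ` {j. even j \<and> 2 \<le> j \<and> j \<le> 2 * k}"
    (is "?L = ?R")
proof
  show "?L \<subseteq> ?R"
  proof
    fix x assume "x \<in> ?L"
    then consider i where "x = Inl i" "1 \<le> i" "i \<le> 2 * k + 1"
      | j where "x = Inr (2 * j)" "2 \<le> j" "j + 1 \<le> k"
      unfolding tree_T_def by auto
    then show "x \<in> ?R"
    proof cases
      case 1
      consider "i = 1" | "i = 2 * k + 1" | "i \<in> {2..2 * k}" using 1 by force
      then show ?thesis
      proof cases
        case 1
        then have "x = leaf_label k 2" using \<open>x = Inl i\<close> unfolding leaf_label_def by simp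
        then show ?thesis using assms by auto
      next
        case 2
        then have "x = leaf_label k (2 * k)" using \<open>x = Inl i\<close> assms unfolding leaf_label_def by simp
        then show ?thesis using assms by auto
      qed (use \<open>x = Inl i\<close> in auto)
    next
      case 2
      then have "x = leaf_label k (2 * j)" unfolding leaf_label_def by simp
      then show ?thesis using 2 by auto
    qed
  qed
  show "?R \<subseteq> ?L"
  proof
    fix x assume "x \<in> ?R"
    then consider i where "x = Inl i" "i \<in> {2..2 * k}"
      | j where "x = leaf_label k (2 * j)" "1 \<le> j" "j \<le> k" by (auto elim!: evenE)
    then show "x \<in> ?L"
      unfolding tree_T_def leaf_label_def using assms by cases (auto split: if_splits)
  qed
qed

lemma tree_T_edges:
  assumes "2 \<le> k"
  shows "edges (tree_T k) = {{Inl i, Inl (i + 1)} | i. 2 \<le> i \<and> i < 2 * k} \<union>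
    {{Inl j, leaf_label k j} | j. even j \<and> 2 \<le> j \<and> j \<le> 2 * k}" (is "?L = ?P \<union> ?Q")
proof
  show "?L \<subseteq> ?P \<union> ?Q"
  proof
    fix e assume "e \<in> ?L"
    then consider i where "e = {Inl i, Inl (i + 1)}" "1 \<le> i" "i \<le> 2 * k"
      | j where "e = {Inl (2 * j), Inr (2 * j)}" "2 \<le> j" "j + 1 \<le> k"
      unfolding tree_T_def by auto
    then show "e \<in> ?P \<union> ?Q"
    proof cases
      case 1
      consider "i = 1" | "i = 2 * k" | "2 \<le> i" "i < 2 * k" using 1 by force
      then show ?thesis
      proof cases
        case 1
        then have "e = {Inl 2, leaf_label k 2}" using \<open>e = {Inl i, Inl (i + 1)}\<close> unfolding leaf_label_def
          by (simp add: insert_commute numeral_2_eq_2)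
        then have "e \<in> ?Q" using assms by force
        then show ?thesis by simp
      next
        case 2
        then have "e = {Inl (2 * k), leaf_label k (2 * k)}" using \<open>e = {Inl i, Inl (i + 1)}\<close> assms
          unfolding leaf_label_def by simp
        moreover have "even (2 * k)" "2 \<le> 2 * k" "2 * k \<le> 2 * k" using assms by auto
        ultimately have "e \<in> ?Q" by blast
        then show ?thesis by simp
      next
        case 3
        then have "e \<in> ?P" using \<open>e = {Inl i, Inl (i + 1)}\<close> by blast
        then show ?thesis by simp
      qed
    next
      case 2
      then have "e = {Inl (2 * j), leaf_label k (2 * j)}" unfolding leaf_label_def by simp
      moreover have "even (2 * j)" "2 \<le> 2 * j" "2 * j \<le> 2 * k" using 2 by auto
      ultimately have "e \<in> ?Q" by blast
      then show ?thesis by simp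
    qed
  qed
  show "?P \<union> ?Q \<subseteq> ?L"
  proof
    fix e assume "e \<in> ?P \<union> ?Q"
    then consider i where "e = {Inl i, Inl (i + 1)}" "2 \<le> i" "i < 2 * k"
      | j where "e = {Inl (2 * j), leaf_label k (2 * j)}" "1 \<le> j" "j \<le> k" by (auto elim!: evenE)
    then show "e \<in> ?L"
    proof cases
      case 1
      then have "1 \<le> i \<and> i \<le> 2 * k" by simp
      then show ?thesis using 1(1) unfolding tree_T_def snd_conv by blast
    next
      case 2
      consider "j = 1" | "j = k" "j \<noteq> 1" | "2 \<le> j" "j + 1 \<le> k" using 2 by force
      then show ?thesis
      proof cases
        case 1
        then have "e = {Inl 1, Inl (1 + 1)} \<and> 1 \<le> (1::nat) \<and> 1 \<le> 2 * k"
          using 2 assms unfolding leaf_label_def by (simp add: insert_commute numeral_2_eq_2)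
        then show ?thesis unfolding tree_T_def snd_conv by blast
      next
        case c: 2
        then have "e = {Inl (2 * k), Inl (2 * k + 1)} \<and> 1 \<le> 2 * k \<and> 2 * k \<le> 2 * k"
          using 2 assms unfolding leaf_label_def by simp
        then show ?thesis unfolding tree_T_def snd_conv by blast
      next
        case 3
        then have "e = {Inl (2 * j), Inr (2 * j)}" using 2 unfolding leaf_label_def by simp
        then show ?thesis using 3 unfolding tree_T_def snd_conv by blast
      qed
    qed
  qed
qed

context subcubic_tree
begin

text \<open>Membership in \<open>S\<close> alternates along the spine, and both ends lie outside
  \<open>S\<close>; so the spine has an odd number \<open>2 * k - 1\<close> of vertices, and those
  outside \<open>S\<close> take the even labels. Each of these carries exactly one leaf, as in
  \<open>T_k\<close>.\<close>

lemma tree_T_iso: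
  assumes SH: "S \<subseteq> H" and indep: "\<And>s. s \<in> S \<Longrightarrow> nb s \<inter> S = {}"
    and L: "leaves \<subseteq> S" and D2: "card {a \<in> H - S. card (nb a) = 2} = 2"
    and NS: "\<And>a. a \<in> H - S \<Longrightarrow> nb a \<subseteq> S" and N23: "\<And>a. a \<in> H - S \<Longrightarrow> card (nb a) = 2 \<or> card (nb a) = 3"
    and lf: "\<And>a. a \<in> H - S \<Longrightarrow> \<exists>l. nb a \<inter> leaves = {l}"
    and S12: "\<And>s. s \<in> S \<Longrightarrow> card (nb s) = 1 \<or> card (nb s) = 2"
  obtains k f where "2 \<le> k" "bij_betw f (verts (tree_T k)) H"
    "(\<lambda>e. f ` e) ` edges (tree_T k) = {{h, h'} | h h'. h \<in> H \<and> h' \<in> nb h}"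
    "f (Inl 2) \<in> H - S" "card (nb (f (Inl 2))) = 2"
    "f (Inl (2 * k)) \<in> H - S" "card (nb (f (Inl (2 * k)))) = 2"
proof -
  obtain xs where dist: "distinct xs" and setxs: "set xs = H - leaves" and m3: "3 \<le> length xs"
    and ends: "{a \<in> H - S. card (nb a) = 2} = {hd xs, last xs}" and "hd xs \<noteq> last xs"
    and adj': "\<forall>i. Suc i < length xs \<longrightarrow> xs ! Suc i \<in> nb (xs ! i)"
    using spine[OF SH indep L D2 NS N23 lf S12] .
  then have adj: "xs ! Suc i \<in> nb (xs ! i)" if "Suc i < length xs" for i using that by blast
  let ?m = "length xs"
  have nonempty: "xs \<noteq> []" using m3 by auto
  have hd0: "hd xs = xs ! 0" and lst: "last xs = xs ! (?m - 1)"
    using nonempty by (simp_all add: hd_conv_nth last_conv_nth)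
  have xH: "xs ! i \<in> H" if "i < ?m" for i using setxs that nth_mem by blast
  have endsN: "xs ! 0 \<in> H - S" "card (nb (xs ! 0)) = 2" "xs ! (?m - 1) \<in> H - S" "card (nb (xs ! (?m - 1))) = 2"
    using ends hd0 lst by auto
  have alt: "xs ! i \<in> S \<longleftrightarrow> odd i" if "i < ?m" for i
    using that
  proof (induction i)
    case 0
    then show ?case using endsN by simp
  next
    case (Suc i)
    have a: "xs ! Suc i \<in> nb (xs ! i)" using adj Suc by simp
    show ?case
    proof (cases "xs ! i \<in> S")
      case True
      then have "xs ! Suc i \<notin> S" using indep a by blast
      then show ?thesis using Suc True by simp
    next
      case False
      then have "xs ! Suc i \<in> S" using NS[of "xs ! i"] xH[of i] a Suc by auto
      then show ?thesis using Suc False by simp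
    qed
  qed
  have "even (?m - 1)" using alt[of "?m - 1"] endsN(3) nonempty by auto
  then obtain n where n: "?m - 1 = 2 * n" by (rule evenE)
  define k where "k = Suc n"
  have mk: "?m = 2 * k - 1" and k2: "2 \<le> k" using n m3 unfolding k_def by auto
  \<comment> \<open>Position 0 of the spine is \<open>v_2\<close>, because \<open>v_1\<close> is a
    leaf.\<close>
  define X where "X j = xs ! (j - 2)" for j
  define l where "l a = (THE y. nb a \<inter> leaves = {y})" for a
  have l: "nb a \<inter> leaves = {l a}" if "a \<in> H - S" for a
  proof -
    obtain y where "nb a \<inter> leaves = {y}" using lf[OF \<open>a \<in> H - S\<close>] by blast
    then show ?thesis unfolding l_def by simp
  qed
  have X_in: "X j \<in> H" "X j \<notin> leaves" if "2 \<le> j" "j \<le> 2 * k" for j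
  proof -
    have "xs ! (j - 2) \<in> set xs" using that mk by (intro nth_mem) auto
    then show "X j \<in> H" "X j \<notin> leaves" unfolding X_def setxs by auto
  qed
  have X_S: "X j \<in> S \<longleftrightarrow> odd j" if "2 \<le> j" "j \<le> 2 * k" for j
    using alt[of "j - 2"] that mk unfolding X_def by auto
  have X_inj: "i = j" if "X i = X j" "2 \<le> i" "i \<le> 2 * k" "2 \<le> j" "j \<le> 2 * k" for i j
  proof -
    have "i - 2 = j - 2" using that dist mk unfolding X_def by (subst (asm) nth_eq_iff_index_eq) auto
    then show ?thesis using that by simp
  qed
  have X_around: "X (j - 1) \<noteq> X (j + 1)" if j: "2 < j" "j < 2 * k" for j
  proof
    assume "X (j - 1) = X (j + 1)"
    then have "j - 1 = j + 1" by (rule X_inj) (use j in auto)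
    then show False by simp
  qed
  have X_next: "X (j + 1) \<in> nb (X j)" if "2 \<le> j" "j < 2 * k" for j
  proof -
    have "Suc (j - 2) = j + 1 - 2" "Suc (j - 2) < ?m" using that mk by auto
    then show ?thesis using adj[of "j - 2"] unfolding X_def by simp
  qed
  have X_prev: "X (j - 1) \<in> nb (X j)" if "2 < j" "j \<le> 2 * k" for j
    using sym[OF X_in(1)[of "j - 1"], of "X j"] X_next[of "j - 1"] that by simp
  have X_N: "X j \<in> H - S" if "2 \<le> j" "j \<le> 2 * k" "even j" for j using X_in(1) X_S that by auto
  have l_in: "l (X j) \<in> nb (X j)" "l (X j) \<in> leaves" if "2 \<le> j" "j \<le> 2 * k" "even j" for j
    using l[OF X_N[OF that]] by blast+
  have l_nb: "nb (l (X j)) = {X j}" if "2 \<le> j" "j \<le> 2 * k" "even j" for j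
    by (rule leaf_nb[OF l_in(2)[OF that] sym[OF X_in(1)[OF that(1,2)] l_in(1)[OF that]]])
  have X2: "card (nb (X 2)) = 2" "card (nb (X (2 * k))) = 2"
  proof -
    show "card (nb (X 2)) = 2" using endsN(2) unfolding X_def by simp
    have "2 * k - 2 = ?m - 1" using mk by simp
    then show "card (nb (X (2 * k))) = 2" using endsN(4) unfolding X_def by simp
  qed
  \<comment> \<open>The listed neighbours are distinct and already exhaust the degree, which is at
    most 2 at odd positions, 2 at the two ends and at most 3 elsewhere.\<close>
  have nb_X: "y = X (j - 1) \<and> 2 < j \<or> y = X (j + 1) \<and> j < 2 * k \<or> y = l (X j) \<and> even j"
    if j: "2 \<le> j" "j \<le> 2 * k" and y: "y \<in> nb (X j)" for j y
  proof -
    have fnb: "finite (nb (X j))" by (rule fin_nb[OF X_in(1)[OF j]])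
    have ldiff: "l (X j) \<noteq> X i" if "even j" "2 \<le> i" "i \<le> 2 * k" for i
      using l_in(2)[OF j that(1)] X_in(2)[OF that(2,3)] by auto
    consider "odd j" | "j = 2" | "j = 2 * k" | "even j" "2 < j" "j < 2 * k" using j by force
    then show ?thesis
    proof cases
      case 1
      have jj: "2 < j" "j < 2 * k" using 1 j by (auto simp: order_less_le)
      have "X (j - 1) \<noteq> X (j + 1)" using X_around[OF jj] .
      then have c: "card {X (j - 1), X (j + 1)} = 2" by simp
      have sub: "{X (j - 1), X (j + 1)} \<subseteq> nb (X j)" using X_next[of j] X_prev[of j] jj j by auto
      have "X j \<in> S" using X_S[OF j] 1 by simp
      then have "card (nb (X j)) \<le> 2" using S12 by force
      then have "{X (j - 1), X (j + 1)} = nb (X j)" using card_seteq[OF fnb sub] c by simp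
      then show ?thesis using y jj by blast
    next
      case 2
      have "l (X j) \<noteq> X (j + 1)" using ldiff[of "j + 1"] 2 k2 by simp
      then have c: "card {l (X j), X (j + 1)} = 2" by simp
      have sub: "{l (X j), X (j + 1)} \<subseteq> nb (X j)" using X_next[of j] l_in(1)[OF j] 2 k2 by auto
      have "{l (X j), X (j + 1)} = nb (X j)" using card_seteq[OF fnb sub] c X2(1) 2 by simp
      then show ?thesis using y 2 k2 by auto
    next
      case 3
      have "l (X j) \<noteq> X (j - 1)" using ldiff[of "j - 1"] 3 k2 by simp
      then have c: "card {l (X j), X (j - 1)} = 2" by simp
      have sub: "{l (X j), X (j - 1)} \<subseteq> nb (X j)" using X_prev[of j] l_in(1)[OF j] 3 k2 by auto
      have "{l (X j), X (j - 1)} = nb (X j)" using card_seteq[OF fnb sub] c X2(2) 3 by simp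
      then show ?thesis using y 3 k2 by auto
    next
      case 4
      have "X (j - 1) \<noteq> X (j + 1)" using X_around[OF 4(2,3)] .
      moreover have "l (X j) \<noteq> X (j - 1)" "l (X j) \<noteq> X (j + 1)"
        using ldiff[OF 4(1), of "j - 1"] ldiff[OF 4(1), of "j + 1"] 4 by auto
      ultimately have c: "card {l (X j), X (j - 1), X (j + 1)} = 3" by simp
      have sub: "{l (X j), X (j - 1), X (j + 1)} \<subseteq> nb (X j)"
        using X_prev[of j] X_next[of j] l_in(1)[OF j] 4 by auto
      have "card (nb (X j)) \<le> 3" using degree_le[OF X_in(1)[OF j]] .
      then have "{l (X j), X (j - 1), X (j + 1)} = nb (X j)" using card_seteq[OF fnb sub] c by simp
      then show ?thesis using y 4 by blast
    qed
  qed
  define f where "f x = (case x of Inl j \<Rightarrow> if j = 1 then l (X 2) else if j = 2 * k + 1 then l (X (2 * k)) else X j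
      | Inr j \<Rightarrow> l (X j))" for x
  have f_X: "f (Inl j) = X j" if "2 \<le> j" "j \<le> 2 * k" for j using that unfolding f_def by auto
  have f_l: "f (leaf_label k j) = l (X j)" for j unfolding f_def leaf_label_def using k2 by auto
  let ?E = "{j. even j \<and> 2 \<le> j \<and> j \<le> 2 * k}"
  have leaves_eq: "\<exists>j\<in>?E. y = l (X j)" if y: "y \<in> leaves" for y
  proof -
    obtain a where a: "nb y = {a}" using y unfolding leaves_def by (auto simp: card_1_singleton_iff)
    have yS: "y \<in> S" using y L by blast
    have aN: "a \<in> H - S" using indep[OF yS] nb_sub[of y] a yS SH by blast
    then have "a \<in> set xs" using setxs L by blast
    then obtain i where i: "a = xs ! i" "i < ?m" by (auto simp: in_set_conv_nth)
    then have aX: "a = X (i + 2)" "i + 2 \<le> 2 * k" unfolding X_def using mk by auto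
    then have "even (i + 2)" using X_S[of "i + 2"] aN by auto
    have "y \<in> H" using yS SH by blast
    then have "y \<in> nb a \<inter> leaves" using sym[of y a] a y by simp
    then have "y = l (X (i + 2))" using l[OF aN] aX(1) by blast
    moreover have "i + 2 \<in> ?E" using aX(2) \<open>even (i + 2)\<close> by simp
    ultimately show ?thesis by blast
  qed
  have X_eq: "\<exists>j\<in>{2..2 * k}. y = X j" if y: "y \<in> H" "y \<notin> leaves" for y
  proof -
    have "y \<in> set xs" using setxs y by blast
    then obtain i where "y = xs ! i" "i < ?m" by (auto simp: in_set_conv_nth)
    then have "y = X (i + 2)" "i + 2 \<in> {2..2 * k}" unfolding X_def using mk by auto
    then show ?thesis by blast
  qed
  have img: "f ` verts (tree_T k) = H"
  proof
    show "f ` verts (tree_T k) \<subseteq> H"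
      unfolding tree_T_verts[OF k2] using f_X X_in(1) f_l l_in(2) by (auto simp: leaves_def)
    show "H \<subseteq> f ` verts (tree_T k)"
    proof
      fix y assume y: "y \<in> H"
      show "y \<in> f ` verts (tree_T k)"
      proof (cases "y \<in> leaves")
        case True
        then obtain j where "j \<in> ?E" "y = f (leaf_label k j)" using leaves_eq f_l by auto
        then show ?thesis unfolding tree_T_verts[OF k2] by blast
      next
        case False
        then obtain j where "j \<in> {2..2 * k}" "y = f (Inl j)" using X_eq[OF y] f_X by auto
        then show ?thesis unfolding tree_T_verts[OF k2] by blast
      qed
    qed
  qed
  have inj: "inj_on f (verts (tree_T k))"
  proof (rule inj_onI)
    fix x y assume x: "x \<in> verts (tree_T k)" and y: "y \<in> verts (tree_T k)" and eq: "f x = f y"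
    have cases: "(\<exists>j. z = Inl j \<and> 2 \<le> j \<and> j \<le> 2 * k \<and> f z = X j) \<or>
        (\<exists>j. z = leaf_label k j \<and> even j \<and> 2 \<le> j \<and> j \<le> 2 * k \<and> f z = l (X j))"
      if "z \<in> verts (tree_T k)" for z
      using that f_X f_l unfolding tree_T_verts[OF k2] by auto
    have l_inj: "i = j" if "l (X i) = l (X j)" "even i" "2 \<le> i" "i \<le> 2 * k" "even j" "2 \<le> j" "j \<le> 2 * k" for i j
    proof -
      have "{X i} = {X j}" using l_nb[OF that(3,4,2)] l_nb[OF that(6,7,5)] that(1) by metis
      then have "X i = X j" by simp
      then show ?thesis using that(3,4,6,7) by (rule X_inj)
    qed
    have diff: "l (X i) \<noteq> X j" if "even i" "2 \<le> i" "i \<le> 2 * k" "2 \<le> j" "j \<le> 2 * k" for i j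
      using l_in(2)[OF that(2,3,1)] X_in(2)[OF that(4,5)] by metis
    show "x = y"
      using cases[OF x]
    proof (elim disjE exE conjE)
      fix i assume i: "x = Inl i" "2 \<le> i" "i \<le> 2 * k" "f x = X i"
      show ?thesis
        using cases[OF y]
      proof (elim disjE exE conjE)
        fix j assume j: "y = Inl j" "2 \<le> j" "j \<le> 2 * k" "f y = X j"
        show ?thesis using X_inj[OF _ i(2,3) j(2,3)] i j eq by simp
      next
        fix j assume j: "even j" "2 \<le> j" "j \<le> 2 * k" "f y = l (X j)"
        show ?thesis using diff[OF j(1-3) i(2,3)] i(4) j(4) eq by simp
      qed
    next
      fix i assume i: "x = leaf_label k i" "even i" "2 \<le> i" "i \<le> 2 * k" "f x = l (X i)"
      show ?thesis
        using cases[OF y]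
      proof (elim disjE exE conjE)
        fix j assume j: "2 \<le> j" "j \<le> 2 * k" "f y = X j"
        show ?thesis using diff[OF i(2-4) j(1,2)] i(5) j(3) eq by simp
      next
        fix j assume j: "y = leaf_label k j" "even j" "2 \<le> j" "j \<le> 2 * k" "f y = l (X j)"
        show ?thesis using l_inj[OF _ i(2-4) j(2-4)] i j eq by simp
      qed
    qed
  qed
  have edges: "(\<lambda>e. f ` e) ` edges (tree_T k) = {{h, h'} | h h'. h \<in> H \<and> h' \<in> nb h}" (is "?A = ?B")
  proof
    show "?A \<subseteq> ?B"
    proof
      fix e assume "e \<in> ?A"
      then consider i where "e = f ` {Inl i, Inl (i + 1)}" "2 \<le> i" "i < 2 * k"
        | j where "e = f ` {Inl j, leaf_label k j}" "even j" "2 \<le> j" "j \<le> 2 * k"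
        unfolding tree_T_edges[OF k2] by blast
      then show "e \<in> ?B"
      proof cases
        case 1
        then have "e = {X i, X (i + 1)}" using f_X by simp
        moreover have "X i \<in> H" "X (i + 1) \<in> nb (X i)" using X_in(1) X_next 1 by auto
        ultimately show ?thesis by blast
      next
        case 2
        then have "e = {X j, l (X j)}" using f_X f_l by simp
        moreover have "X j \<in> H" "l (X j) \<in> nb (X j)" using X_in(1) l_in(1) 2 by auto
        ultimately show ?thesis by blast
      qed
    qed
    show "?B \<subseteq> ?A"
    proof
      fix e assume "e \<in> ?B"
      then obtain h h' where e: "e = {h, h'}" "h \<in> H" "h' \<in> nb h" by blast
      have path: "{X i, X (i + 1)} \<in> ?A" if "2 \<le> i" "i < 2 * k" for i
      proof -
        have "{X i, X (i + 1)} = f ` {Inl i, Inl (i + 1)}" using f_X that by simp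
        moreover have "{Inl i, Inl (i + 1)} \<in> edges (tree_T k)" unfolding tree_T_edges[OF k2] using that by blast
        ultimately show ?thesis by (rule image_eqI)
      qed
      have leaf: "{X j, l (X j)} \<in> ?A" if "even j" "2 \<le> j" "j \<le> 2 * k" for j
      proof -
        have "{X j, l (X j)} = f ` {Inl j, leaf_label k j}" using f_X f_l that by simp
        moreover have "{Inl j, leaf_label k j} \<in> edges (tree_T k)" unfolding tree_T_edges[OF k2] using that by blast
        ultimately show ?thesis by (rule image_eqI)
      qed
      show "e \<in> ?A"
      proof (cases "h \<in> leaves")
        case True
        then obtain j where j: "even j" "2 \<le> j" "j \<le> 2 * k" "h = l (X j)" using leaves_eq by blast
        then have "h' = X j" using l_nb[of j] e(3) by simp
        then show ?thesis using leaf[OF j(1-3)] e(1) j(4) by (simp add: insert_commute)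
      next
        case False
        then obtain j where j: "2 \<le> j" "j \<le> 2 * k" "h = X j" using X_eq[OF e(2)] by auto
        consider "h' = X (j - 1)" "2 < j" | "h' = X (j + 1)" "j < 2 * k" | "h' = l (X j)" "even j"
          using nb_X[OF j(1,2), of h'] e(3) j(3) by blast
        then show ?thesis
        proof cases
          case 1
          then show ?thesis using path[of "j - 1"] j e(1) by (simp add: insert_commute)
        next
          case 2
          then show ?thesis using path[of j] j e(1) by simp
        next
          case 3
          then show ?thesis using leaf[of j] j e(1) by simp
        qed
      qed
    qed
  qed
  show thesis
    by (rule that[OF k2 _ edges])
      (use img inj f_X X_N X2 k2 in \<open>auto simp: bij_betw_def\<close>)
qed

end

section \<open>The dualist tree and perfect matchings\<close>

definition nbrs :: "'a graph \<Rightarrow> 'a set set \<Rightarrow> 'a set set set" where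
  "nbrs G k = {k' \<in> hexagons G. adjacent_hexagons k k'}"

lemma rtrancl_edges_closed:
  assumes "(x, y) \<in> {(a, b). {a, b} \<in> F}\<^sup>*" "x \<in> W" "\<And>a b. {a, b} \<in> F \<Longrightarrow> a \<in> W \<Longrightarrow> b \<in> W"
  shows "y \<in> W"
  using assms(1,2) by (induction rule: rtrancl_induct) (use assms(3) in auto)

context catacond
begin

lemma edge_card: "e \<in> edges G \<Longrightarrow> card e = 2"
  using simple unfolding simple_graph_def by blast

text \<open>Hexagons that touch share an edge, so adjacency can be tested on vertices.\<close>

lemma nbrs_iff:
  assumes k: "k \<in> hexagons G"
  shows "k' \<in> nbrs G k \<longleftrightarrow> k' \<in> hexagons G \<and> k \<noteq> k' \<and> \<Union> k \<inter> \<Union> k' \<noteq> {}"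
proof
  assume "k' \<in> nbrs G k"
  then have k': "k' \<in> hexagons G" "k \<noteq> k'" "k \<inter> k' \<noteq> {}"
    unfolding nbrs_def adjacent_hexagons_def by auto
  then obtain e where e: "e \<in> k" "e \<in> k'" by blast
  have "card e = 2" using hexagon_subset_edges[OF k] e(1) edge_card by blast
  then have "e \<noteq> {}" by auto
  then show "k' \<in> hexagons G \<and> k \<noteq> k' \<and> \<Union> k \<inter> \<Union> k' \<noteq> {}" using k' e by blast
next
  assume a: "k' \<in> hexagons G \<and> k \<noteq> k' \<and> \<Union> k \<inter> \<Union> k' \<noteq> {}"
  then obtain w where w: "w \<in> \<Union> k" "w \<in> \<Union> k'" by blast
  have a': "k' \<in> hexagons G" "k \<noteq> k'" using a by auto
  obtain x where "{w, x} \<in> k" "{w, x} \<in> k'" using common_vertex_edge[OF k a' w] by metis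
  then have "k \<inter> k' \<noteq> {}" by blast
  then show "k' \<in> nbrs G k" using a' unfolding nbrs_def adjacent_hexagons_def by simp
qed

lemma nbrs_sym: "k \<in> hexagons G \<Longrightarrow> k' \<in> nbrs G k \<Longrightarrow> k \<in> nbrs G k'"
  unfolding nbrs_def adjacent_hexagons_def by (auto simp: Int_commute)

lemma nbrs_edge:
  assumes "k \<in> hexagons G" "k' \<in> nbrs G k"
  obtains u v where "k \<inter> k' = {{u, v}}" "\<Union> k \<inter> \<Union> k' = {u, v}" "u \<noteq> v"
proof -
  have k': "k' \<in> hexagons G" "k \<noteq> k'" "\<Union> k \<inter> \<Union> k' \<noteq> {}" using nbrs_iff[OF assms(1)] assms(2) by auto
  then obtain w where w: "w \<in> \<Union> k" "w \<in> \<Union> k'" by blast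
  show thesis using common_vertex_edge[OF assms(1) k'(1,2) w] that by metis
qed

text \<open>Follow a walk in \<open>G\<close> from a hexagon in \<open>X\<close> to any other: each
  edge of the walk lies in a hexagon that meets one of \<open>X\<close> at the current vertex, hence
  belongs to \<open>X\<close>.\<close>

lemma hexagons_connected:
  assumes X: "X \<subseteq> hexagons G" "X \<noteq> {}" and closed: "\<And>k. k \<in> X \<Longrightarrow> nbrs G k \<subseteq> X"
  shows "X = hexagons G"
proof
  have in_X: "k' \<in> X" if k: "k \<in> X" "w \<in> \<Union> k" and k': "k' \<in> hexagons G" "w \<in> \<Union> k'" for k k' w
  proof (cases "k = k'")
    case False
    have "\<Union> k \<inter> \<Union> k' \<noteq> {}" using k k' by blast
    then have "k' \<in> nbrs G k" using nbrs_iff[of k k'] X(1) k(1) k'(1) False by blast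
    then show ?thesis using closed[OF k(1)] by blast
  qed (use k in simp)
  show "hexagons G \<subseteq> X"
  proof
    fix k assume k: "k \<in> hexagons G"
    have nonempty: "\<exists>x. x \<in> \<Union> k" if "k \<in> hexagons G" for k
    proof -
      have "\<Union> k \<noteq> {}" using hexagon_card_verts(1)[OF that] by (metis card.empty zero_neq_numeral)
      then show ?thesis by blast
    qed
    obtain k0 where k0: "k0 \<in> X" using X(2) by blast
    then have k0h: "k0 \<in> hexagons G" using X(1) by blast
    obtain x y where x: "x \<in> \<Union> k0" and y: "y \<in> \<Union> k" using nonempty[OF k0h] nonempty[OF k] by blast
    have "x \<in> verts G" "y \<in> verts G" using hexagon_verts[OF k0h] hexagon_verts[OF k] x y by auto
    then have "(x, y) \<in> {(a, b). {a, b} \<in> edges G}\<^sup>*"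
      using two_conn unfolding two_connected_def graph_connected_def by blast
    then have "y \<in> \<Union> (\<Union> X)"
    proof (rule rtrancl_edges_closed)
      show "x \<in> \<Union> (\<Union> X)" using x k0 by blast
      fix a b assume ab: "{a, b} \<in> edges G" "a \<in> \<Union> (\<Union> X)"
      then obtain k1 where k1: "k1 \<in> X" "a \<in> \<Union> k1" by blast
      obtain k2 where k2: "k2 \<in> hexagons G" "{a, b} \<in> k2" using edge_in_hexagon[OF ab(1)] by metis
      have a2: "a \<in> \<Union> k2" by (rule UnionI[OF k2(2)]) simp
      have b2: "b \<in> \<Union> k2" by (rule UnionI[OF k2(2)]) simp
      have "k2 \<in> X" by (rule in_X[OF k1 k2(1) a2])
      then have "\<Union> k2 \<subseteq> \<Union> (\<Union> X)" by blast
      then show "b \<in> \<Union> (\<Union> X)" using b2 by (rule subsetD)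
    qed
    then obtain k1 where "k1 \<in> X" "y \<in> \<Union> k1" by blast
    then show "k \<in> X" using in_X k y by blast
  qed
qed (rule X(1))

text \<open>Each neighbour takes two of the six vertices, different neighbours take disjoint pairs
  as no three hexagons meet, and the vertices left over are those of degree 2. In particular there
  are at most three neighbours.\<close>

lemma shared_verts:
  assumes k: "k \<in> hexagons G"
  shows "card {w \<in> \<Union> k. degree G w = 2} + 2 * card (nbrs G k) = 6"
    "{w \<in> \<Union> k. degree G w = 2} = \<Union> k - (\<Union>k'\<in>nbrs G k. \<Union> k')"
proof -
  let ?D = "{w \<in> \<Union> k. degree G w = 2}" and ?s = "\<lambda>k'. \<Union> k \<inter> \<Union> k'"
  have fk: "finite (\<Union> k)" using hexagon_card_verts(2)[OF k] .
  have "degree G w = 2 \<longleftrightarrow> w \<notin> (\<Union>k'\<in>nbrs G k. \<Union> k')" if w: "w \<in> \<Union> k" for w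
    using degree_2_iff[OF k w] nbrs_iff[OF k] w by blast
  then show D: "?D = \<Union> k - (\<Union>k'\<in>nbrs G k. \<Union> k')" by blast
  have fn: "finite (nbrs G k)" using finite_hex unfolding nbrs_def by simp
  have "card (\<Union>k'\<in>nbrs G k. ?s k') = (\<Sum>k'\<in>nbrs G k. card (?s k'))"
  proof (rule card_UN_disjoint[OF fn])
    show "\<forall>k'\<in>nbrs G k. finite (?s k')" using fk by simp
    show "\<forall>i\<in>nbrs G k. \<forall>j\<in>nbrs G k. i \<noteq> j \<longrightarrow> ?s i \<inter> ?s j = {}"
    proof (intro ballI impI, rule ccontr)
      fix i j assume ij: "i \<in> nbrs G k" "j \<in> nbrs G k" "i \<noteq> j" "?s i \<inter> ?s j \<noteq> {}"
      then obtain w where w: "w \<in> \<Union> k" "w \<in> \<Union> i" "w \<in> \<Union> j" by blast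
      have "i \<in> hexagons G" "k \<noteq> i" "j \<in> hexagons G" "k \<noteq> j" using ij(1,2) nbrs_iff[OF k] by auto
      then show False using no_three_hexagons[OF k, of i j w] w ij(3) by blast
    qed
  qed
  also have "\<dots> = (\<Sum>k'\<in>nbrs G k. 2)"
  proof (rule sum.cong)
    fix k' assume "k' \<in> nbrs G k"
    then obtain u v where "?s k' = {u, v}" "u \<noteq> v" using nbrs_edge[OF k] by metis
    then show "card (?s k') = 2" by simp
  qed simp
  finally have c: "card (\<Union>k'\<in>nbrs G k. ?s k') = 2 * card (nbrs G k)" by simp
  have "?D = \<Union> k - (\<Union>k'\<in>nbrs G k. ?s k')" unfolding D by blast
  moreover have sub: "(\<Union>k'\<in>nbrs G k. ?s k') \<subseteq> \<Union> k" by blast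
  ultimately have "card ?D = 6 - 2 * card (nbrs G k)"
    using card_Diff_subset[OF finite_subset[OF sub fk] sub] hexagon_card_verts(1)[OF k] c by simp
  moreover have "2 * card (nbrs G k) \<le> 6" using card_mono[OF fk sub] hexagon_card_verts(1)[OF k] c by simp
  ultimately show "card ?D + 2 * card (nbrs G k) = 6" by simp
qed

end

context split_graph
begin

text \<open>The pair \<open>h\<close>, \<open>h'\<close> is the one adjacency that the cut
  destroys.\<close>

lemma nbrs_side:
  assumes k: "k \<in> hexagons (induced G VA)"
  shows "nbrs G k = nbrs (induced G VA) k \<union> (if k = h then {h'} else {})"
proof -
  have kG: "k \<in> hexagons G" using k all_hexagons(1) by blast
  have "k' \<in> nbrs G k \<longleftrightarrow> k = h \<and> k' = h'" if k': "k' \<in> hexagons (induced G VB)" for k'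
  proof
    assume "k' \<in> nbrs G k"
    then have "\<Union> k \<inter> \<Union> k' \<noteq> {}" using nbrs_iff[OF kG, of k'] by simp
    then show "k = h \<and> k' = h'" using across[OF k k'] by simp
  next
    assume a: "k = h \<and> k' = h'"
    have "u \<in> \<Union> h \<inter> \<Union> h'" using hh'(3,4) by blast
    then have "\<Union> h \<inter> \<Union> h' \<noteq> {}" by blast
    then show "k' \<in> nbrs G k" using a nbrs_iff[OF kG, of k'] hh'(2) ne by simp
  qed
  moreover have "k' \<in> nbrs G k \<longleftrightarrow> k' \<in> nbrs (induced G VA) k" if "k' \<in> hexagons (induced G VA)" for k'
    using that all_hexagons(1) unfolding nbrs_def by simp
  moreover have "nbrs (induced G VA) k \<subseteq> hexagons (induced G VA)" "nbrs G k \<subseteq> hexagons G"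
    unfolding nbrs_def by auto
  ultimately show ?thesis using all_hexagons by auto
qed

lemma card_hexagons: "card (hexagons G) = card (hexagons (induced G VA)) + card (hexagons (induced G VB))"
  using card_Un_disjoint[of "hexagons (induced G VA)" "hexagons (induced G VB)"] all_hexagons finite_hex by simp

lemma side_smaller: "card (hexagons (induced G VA)) < card (hexagons G)"
  using card_hexagons all_hexagons(4) finite_hex all_hexagons(1) by (metis card_gt_0_iff empty_iff finite_Un less_add_same_cancel1)

lemma sum_nbrs_side:
  "(\<Sum>k\<in>hexagons (induced G VA). card (nbrs G k)) = (\<Sum>k\<in>hexagons (induced G VA). card (nbrs (induced G VA) k)) + 1"
proof -
  have fA: "finite (hexagons (induced G VA))" using all_hexagons(1) finite_hex by simp
  have "(\<Sum>k\<in>hexagons (induced G VA). card (nbrs G k)) =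
      (\<Sum>k\<in>hexagons (induced G VA). card (nbrs (induced G VA) k) + (if k = h then 1 else 0))"
  proof (rule sum.cong)
    fix k assume k: "k \<in> hexagons (induced G VA)"
    have "finite (nbrs (induced G VA) k)" "h' \<notin> nbrs (induced G VA) k"
      using fA all_hexagons(2,4) unfolding nbrs_def by auto
    then show "card (nbrs G k) = card (nbrs (induced G VA) k) + (if k = h then 1 else 0)"
      unfolding nbrs_side[OF k] by auto
  qed simp
  then show ?thesis using fA all_hexagons(3) by (simp add: sum.distrib)
qed

end

text \<open>A hexagon with a neighbour allows a cut into two catacondensed graphs with fewer
  hexagons; if none has a neighbour, connectedness leaves a single hexagon.\<close>

lemma catacondensed_induct [consumes 1, case_names single split]:
  assumes "catacondensed G"
    and single: "\<And>G. catacondensed G \<Longrightarrow> card (hexagons G) = 1 \<Longrightarrow> P G"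
    and split: "\<And>G u v VA VB h h'. split_graph G u v VA VB h h' \<Longrightarrow>
      P (induced G VA) \<Longrightarrow> P (induced G VB) \<Longrightarrow> P G"
  shows "P G"
  using assms(1)
proof (induction "card (hexagons G)" arbitrary: G rule: less_induct)
  case less
  interpret catacond G using less.prems by unfold_locales
  show ?case
  proof (cases "\<exists>k\<in>hexagons G. nbrs G k \<noteq> {}")
    case False
    obtain k where k: "k \<in> hexagons G" using hexagons_nonempty by blast
    then have "{k} = hexagons G" using hexagons_connected[of "{k}"] False by blast
    then have "card (hexagons G) = 1" by (metis card_1_singleton_iff One_nat_def)
    then show ?thesis using single less.prems by blast
  next
    case True
    then obtain k k' where k: "k \<in> hexagons G" "k' \<in> nbrs G k" by blast
    have k': "k' \<in> hexagons G" "k \<noteq> k'" using nbrs_iff[OF k(1)] k(2) by auto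
    obtain u v where "k \<inter> k' = {{u, v}}" using nbrs_edge[OF k] by metis
    then have e: "{u, v} \<in> k" "{u, v} \<in> k'" by auto
    obtain VA VB where s: "split_graph G u v VA VB k k'" using split_exists[OF k(1) k' e] .
    interpret A: split_graph G u v VA VB k k' by (rule s)
    interpret B: split_graph G u v VB VA k' k by (rule A.swap)
    show ?thesis
      using split[OF s less.hyps[OF A.side_smaller A.catacondensed_side] less.hyps[OF B.side_smaller B.catacondensed_side]] .
  qed
qed

text \<open>Each side contributes twice its number of hexagons minus 2, and the restored adjacency
  adds one at \<open>h\<close> and one at \<open>h'\<close>. This supplies the acyclicity of the
  dualist graph.\<close>

lemma degree_sum_hexagons:
  "catacondensed G \<Longrightarrow> (\<Sum>k\<in>hexagons G. card (nbrs G k)) + 2 = 2 * card (hexagons G)"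
proof (induction rule: catacondensed_induct)
  case (single G)
  then obtain k where k: "hexagons G = {k}" by (auto simp: card_1_singleton_iff)
  then have "nbrs G k = {}" unfolding nbrs_def adjacent_hexagons_def by auto
  then show ?case using k by simp
next
  case (split G u v VA VB h h')
  interpret A: split_graph G u v VA VB h h' by (rule split)
  interpret B: split_graph G u v VB VA h' h by (rule A.swap)
  have "(\<Sum>k\<in>hexagons G. card (nbrs G k)) =
      (\<Sum>k\<in>hexagons (induced G VA). card (nbrs G k)) + (\<Sum>k\<in>hexagons (induced G VB). card (nbrs G k))"
    using sum.union_disjoint[of "hexagons (induced G VA)" "hexagons (induced G VB)" "\<lambda>k. card (nbrs G k)"]
      A.all_hexagons A.finite_hex by simp
  then show ?case using A.sum_nbrs_side B.sum_nbrs_side split.IH A.card_hexagons by linarith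
qed

sublocale catacond \<subseteq> dual: subcubic_tree "hexagons G" "nbrs G"
proof
  show "finite (hexagons G)" "hexagons G \<noteq> {}" using finite_hex hexagons_nonempty by auto
  show "nbrs G k \<subseteq> hexagons G" if "k \<in> hexagons G" for k unfolding nbrs_def by auto
  show "k \<notin> nbrs G k" for k unfolding nbrs_def adjacent_hexagons_def by simp
  show "k \<in> nbrs G k'" if "k \<in> hexagons G" "k' \<in> nbrs G k" for k k' using nbrs_sym that by blast
  show "X = hexagons G" if "X \<subseteq> hexagons G" "X \<noteq> {}" "\<And>k. k \<in> X \<Longrightarrow> nbrs G k \<subseteq> X" for X
    using hexagons_connected[OF that] .
  show "(\<Sum>k\<in>hexagons G. card (nbrs G k)) + 2 = 2 * card (hexagons G)" using degree_sum_hexagons[OF cat] .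
  show "card (nbrs G k) \<le> 3" if "k \<in> hexagons G" for k using shared_verts(1)[OF that] by linarith
qed

section \<open>Perfect matchings across a cut\<close>

lemma perfect_matching_unique:
  "perfect_matching G M \<Longrightarrow> w \<in> verts G \<Longrightarrow> e \<in> M \<Longrightarrow> w \<in> e \<Longrightarrow> e' \<in> M \<Longrightarrow> w \<in> e' \<Longrightarrow> e = e'"
  unfolding perfect_matching_def by blast

text \<open>\<open>MA\<close> matches \<open>u\<close> with \<open>v\<close>. Without that edge it
  covers exactly the vertices of \<open>VA\<close> off the cut, and \<open>MB\<close> covers all of
  \<open>VB\<close>.\<close>

lemma (in split_graph) perfect_matching_union:
  assumes A: "perfect_matching (induced G VA) MA" and B: "perfect_matching (induced G VB) MB"
    and e: "{u, v} \<in> MA"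
  shows "perfect_matching G (MB \<union> (MA - {{u, v}}))"
proof -
  have sA: "MA \<subseteq> edges (induced G VA)" and sB: "MB \<subseteq> edges (induced G VB)"
    using A B unfolding perfect_matching_def by auto
  have "\<exists>!e. e \<in> MB \<union> (MA - {{u, v}}) \<and> w \<in> e" if w: "w \<in> verts G" for w
  proof (cases "w \<in> VB")
    case True
    then obtain f where f: "f \<in> MB" "w \<in> f" using B unfolding perfect_matching_def by auto
    show ?thesis
    proof (rule ex1I[of _ f])
      fix g assume g: "g \<in> MB \<union> (MA - {{u, v}}) \<and> w \<in> g"
      show "g = f"
      proof (cases "g \<in> MB")
        case True
        then show ?thesis using perfect_matching_unique[OF B, of w g f] f g \<open>w \<in> VB\<close> by simp
      next
        case False
        then have gA: "g \<in> MA" "g \<noteq> {u, v}" "w \<in> g" using g by auto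
        then have "w \<in> VA" using sA by auto
        then have "w \<in> {u, v}" using True meet by blast
        then have "g = {u, v}" using perfect_matching_unique[OF A, of w g "{u, v}"] gA e \<open>w \<in> VA\<close> by simp
        then show ?thesis using gA(2) by simp
      qed
    qed (use f in simp)
  next
    case False
    then have wA: "w \<in> VA" using w cover by blast
    then obtain f where f: "f \<in> MA" "w \<in> f" using A unfolding perfect_matching_def by auto
    have "v \<in> VB" "u \<in> VB" using meet by auto
    then have "f \<noteq> {u, v}" using f(2) False by auto
    show ?thesis
    proof (rule ex1I[of _ f])
      fix g assume g: "g \<in> MB \<union> (MA - {{u, v}}) \<and> w \<in> g"
      then have "g \<in> MA" using sB False by auto
      then show "g = f" using perfect_matching_unique[OF A, of w g f] f g wA by simp
    qed (use f \<open>f \<noteq> {u, v}\<close> in simp)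
  qed
  moreover have "MB \<union> (MA - {{u, v}}) \<subseteq> edges G" using sA sB by auto
  ultimately show ?thesis unfolding perfect_matching_def by simp
qed

lemma hexagon_matching:
  assumes "h \<in> hexagons G" "e \<in> h" "simple_graph G"
  obtains m where "m \<subseteq> h" "card m = 3" "e \<in> m" "\<forall>w\<in>\<Union> h. \<exists>!f. f \<in> m \<and> w \<in> f"
proof -
  have "e \<in> edges G" using assms hexagon_subset_edges by blast
  then have "card e = 2" using assms(3) unfolding simple_graph_def by blast
  then obtain u v where "e = {u, v}" by (auto simp: card_2_iff)
  then obtain a b c d where d: "distinct [u, v, a, b, c, d]" "h = hexagon_edges u v a b c d"
    using hexagon_at_edge[OF assms(1)] assms(2) by metis
  have un: "\<Union> h = {u, v, a, b, c, d}" unfolding d(2) by (rule hexagon_edges_verts)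
  show thesis
  proof (rule that[of "{{u, v}, {a, b}, {c, d}}"])
    show "{{u, v}, {a, b}, {c, d}} \<subseteq> h" unfolding d(2) hexagon_edges_def by simp
    show "card {{u, v}, {a, b}, {c, d}} = 3" using d(1) by (auto simp: doubleton_eq_iff)
    show "e \<in> {{u, v}, {a, b}, {c, d}}" using \<open>e = {u, v}\<close> by simp
    show "\<forall>w\<in>\<Union> h. \<exists>!f. f \<in> {{u, v}, {a, b}, {c, d}} \<and> w \<in> f"
      unfolding un using d(1) by auto
  qed
qed

text \<open>Prescribing an edge makes the induction work: the side not supplying \<open>e\<close> is
  given a matching through \<open>{u, v}\<close>, which then gives up this edge.\<close>

lemma matching_containing_edge:
  "catacondensed G \<Longrightarrow> \<forall>e\<in>edges G. \<exists>M. perfect_matching G M \<and> e \<in> M"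
proof (induction rule: catacondensed_induct)
  case (single G)
  interpret catacond G using single(1) by unfold_locales
  show ?case
  proof
    fix e assume e: "e \<in> edges G"
    obtain k where k: "hexagons G = {k}" using single(2) by (auto simp: card_1_singleton_iff)
    then have kG: "k \<in> hexagons G" by simp
    have ek: "e \<in> k" using edge_in_hexagon[OF e] k by (metis singletonD)
    have V: "verts G = \<Union> k" using hexagon_verts[OF kG] vertex_in_hexagon k by (metis singletonD subsetI subset_antisym)
    obtain m where "m \<subseteq> k" "card m = 3" "e \<in> m" "\<forall>w\<in>\<Union> k. \<exists>!f. f \<in> m \<and> w \<in> f"
      using hexagon_matching[OF kG ek simple] .
    then show "\<exists>M. perfect_matching G M \<and> e \<in> M"
      using hexagon_subset_edges[OF kG] unfolding perfect_matching_def V by (intro exI[of _ m]) auto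
  qed
next
  case (split G u v VA VB h h')
  interpret A: split_graph G u v VA VB h h' by (rule split)
  interpret B: split_graph G u v VB VA h' h by (rule A.swap)
  have "{u, v} \<in> edges (induced G VA) \<inter> edges (induced G VB)" unfolding A.common_edge by simp
  then have both: "{u, v} \<in> edges (induced G VA)" "{u, v} \<in> edges (induced G VB)"
    by (rule IntD1, rule IntD2)
  show ?case
  proof
    fix e assume "e \<in> edges G"
    then consider "e \<in> edges (induced G VA)" | "e \<in> edges (induced G VB)" using A.all_edges by blast
    then show "\<exists>M. perfect_matching G M \<and> e \<in> M"
    proof cases
      case 1
      obtain MA where MA: "perfect_matching (induced G VA) MA" "e \<in> MA" using split.IH(1) 1 by blast
      obtain MB where MB: "perfect_matching (induced G VB) MB" "{u, v} \<in> MB" using split.IH(2) both by blast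
      show ?thesis using B.perfect_matching_union[OF MB(1) MA(1) MB(2)] MA(2) by blast
    next
      case 2
      obtain MA where MA: "perfect_matching (induced G VA) MA" "{u, v} \<in> MA" using split.IH(1) both by blast
      obtain MB where MB: "perfect_matching (induced G VB) MB" "e \<in> MB" using split.IH(2) 2 by blast
      show ?thesis using A.perfect_matching_union[OF MA(1) MB(1) MA(2)] MB(2) by blast
    qed
  qed
qed

section \<open>Clar matchings\<close>

definition clar_matching :: "'a graph \<Rightarrow> 'a set set set \<Rightarrow> 'a set set \<Rightarrow> bool" where
  "clar_matching G S M \<longleftrightarrow> perfect_matching G M \<and> S \<subseteq> hexagons G \<and> independent_hexagons S \<and>
     (\<forall>h\<in>S. alternating M h)"

lemma clar_number_eq: "clar_number G = Max {card S | M S. clar_matching G S M}"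
proof -
  have "{card S | M S. perfect_matching G M \<and> S \<subseteq> {h \<in> hexagons G. alternating M h} \<and> independent_hexagons S}
      = {card S | M S. clar_matching G S M}"
    unfolding clar_matching_def by (intro Collect_cong) blast
  then show ?thesis unfolding clar_number_def by simp
qed

lemma independent_disjoint:
  "independent_hexagons S \<Longrightarrow> k \<in> S \<Longrightarrow> k' \<in> S \<Longrightarrow> k \<noteq> k' \<Longrightarrow> \<Union> k \<inter> \<Union> k' = {}"
  unfolding independent_hexagons_def pairwise_def by blast

context catacond
begin

text \<open>The maximum is over a finite nonempty set: sizes are bounded by the number of hexagons,
  and any perfect matching admits the empty set of hexagons.\<close>

lemma clar_number_props:
  shows "\<exists>S M. clar_matching G S M \<and> card S = clar_number G"
    and "clar_matching G S M \<Longrightarrow> card S \<le> clar_number G"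
proof -
  let ?C = "{card S | M S. clar_matching G S M}"
  have "card S \<le> card (hexagons G)" if "clar_matching G S M" for S M
    using that card_mono[OF finite_hex] unfolding clar_matching_def by blast
  then have "?C \<subseteq> {..card (hexagons G)}" by auto
  then have fin: "finite ?C" using finite_subset by blast
  obtain h where h: "h \<in> hexagons G" using hexagons_nonempty by blast
  have "h \<noteq> {}" using hexagon_card_verts(1)[OF h] by auto
  then obtain e where "e \<in> edges G" using hexagon_subset_edges[OF h] by blast
  then obtain M0 where "perfect_matching G M0" using matching_containing_edge[OF cat] by blast
  then have "clar_matching G {} M0" unfolding clar_matching_def independent_hexagons_def by simp
  then have "?C \<noteq> {}" by blast
  then have "clar_number G \<in> ?C" unfolding clar_number_eq using Max_in[OF fin] by blast
  then show "\<exists>S M. clar_matching G S M \<and> card S = clar_number G" by auto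
  show "card S \<le> clar_number G" if "clar_matching G S M"
    unfolding clar_number_eq using Max_ge[OF fin] that by blast
qed

lemma independent_nbrs:
  assumes "S \<subseteq> hexagons G" "independent_hexagons S" "s \<in> S" shows "nbrs G s \<inter> S = {}"
proof (rule ccontr)
  assume "nbrs G s \<inter> S \<noteq> {}"
  then obtain k where k: "k \<in> nbrs G s" "k \<in> S" by blast
  have s: "s \<in> hexagons G" using assms by blast
  then have "s \<noteq> k" "\<Union> s \<inter> \<Union> k \<noteq> {}" using nbrs_iff[OF s, of k] k(1) by auto
  then show False using independent_disjoint[OF assms(2,3) k(2)] by simp
qed

lemma clar_bound:
  assumes "clar_matching G S M" shows "3 * card S \<le> 2 * card (hexagons G) + 1"
proof (rule dual.independent_bound)
  show "S \<subseteq> hexagons G" using assms unfolding clar_matching_def by simp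
  show "nbrs G s \<inter> S = {}" if "s \<in> S" for s
    using independent_nbrs that assms unfolding clar_matching_def by blast
qed

text \<open>Three disjoint edges cover all six vertices of \<open>h\<close>, so the vertices of an
  alternating hexagon are matched among themselves.\<close>

lemma alternating_covers:
  assumes M: "perfect_matching G M" and h: "h \<in> hexagons G" and alt: "alternating M h" and w: "w \<in> \<Union> h"
    and e: "e \<in> M" "w \<in> e"
  shows "e \<in> h"
proof -
  have hV: "\<Union> h \<subseteq> verts G" using hexagon_verts[OF h] .
  have sub: "M \<inter> h \<subseteq> edges G" using hexagon_subset_edges[OF h] by blast
  have disj: "disjnt f g" if fg: "f \<in> M \<inter> h" "g \<in> M \<inter> h" "f \<noteq> g" for f g
  proof (rule ccontr)
    assume "\<not> disjnt f g"
    then obtain x where x: "x \<in> f" "x \<in> g" unfolding disjnt_def by blast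
    have "x \<in> verts G" using x fg hV by blast
    then show False using perfect_matching_unique[OF M, of x f g] x fg by blast
  qed
  have c2: "card f = 2" if "f \<in> M \<inter> h" for f using sub that edge_card by blast
  have "card (\<Union> (M \<inter> h)) = sum card (M \<inter> h)"
  proof (rule card_Union_disjoint)
    show "pairwise disjnt (M \<inter> h)" unfolding pairwise_def using disj by blast
    fix f assume "f \<in> M \<inter> h"
    then have "card f = 2" by (rule c2)
    then show "finite f" by (metis card.infinite zero_neq_numeral)
  qed
  also have "\<dots> = (\<Sum>f\<in>M \<inter> h. 2)" using c2 by (rule sum.cong[OF refl])
  also have "\<dots> = 6" using alt unfolding alternating_def by simp
  finally have "card (\<Union> (M \<inter> h)) = card (\<Union> h)" using hexagon_card_verts(1)[OF h] by simp
  then have "\<Union> (M \<inter> h) = \<Union> h" using hexagon_card_verts(2)[OF h] by (intro card_subset_eq) auto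
  then obtain f where f: "f \<in> M" "f \<in> h" "w \<in> f" using w by blast
  have "w \<in> verts G" using hV w by blast
  then have "e = f" using perfect_matching_unique[OF M _ e f(1,3)] by blast
  then show ?thesis using f by simp
qed

lemma uncovered_verts:
  assumes k: "k \<in> hexagons G" "k \<notin> S" and S: "S \<subseteq> hexagons G" and nS: "nbrs G k \<subseteq> S"
  shows "\<Union> k - \<Union> (\<Union> S) = {w \<in> \<Union> k. degree G w = 2}"
proof -
  have "w \<in> \<Union> (\<Union> S) \<longleftrightarrow> w \<in> (\<Union>k'\<in>nbrs G k. \<Union> k')" if w: "w \<in> \<Union> k" for w
  proof
    assume "w \<in> \<Union> (\<Union> S)"
    then obtain s where s: "s \<in> S" "w \<in> \<Union> s" by blast
    have "\<Union> k \<inter> \<Union> s \<noteq> {}" using w s(2) by blast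
    then have "s \<in> nbrs G k" using nbrs_iff[OF k(1), of s] s(1) S k(2) by blast
    then show "w \<in> (\<Union>k'\<in>nbrs G k. \<Union> k')" using s(2) by blast
  next
    assume "w \<in> (\<Union>k'\<in>nbrs G k. \<Union> k')"
    then show "w \<in> \<Union> (\<Union> S)" using nS by blast
  qed
  then show ?thesis unfolding shared_verts(2)[OF k(1)] by blast
qed

text \<open>The matching consists of three edges of each hexagon of \<open>S\<close> and of the edges joining the two
  vertices of degree 2 of the angular hexagons outside \<open>S\<close>.\<close>

lemma clar_matching_of_cover:
  assumes S: "S \<subseteq> hexagons G" and indep: "independent_hexagons S"
    and cov: "\<And>k. k \<in> hexagons G \<Longrightarrow> k \<notin> S \<Longrightarrow> nbrs G k \<subseteq> S \<and> (card (nbrs G k) = 3 \<or> angular G k)"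
  obtains M where "clar_matching G S M"
    "\<forall>k\<in>hexagons G. k \<notin> S \<longrightarrow> angular G k \<longrightarrow> {w \<in> \<Union> k. degree G w = 2} \<in> M"
proof -
  define good where "good h m \<longleftrightarrow> m \<subseteq> h \<and> card m = 3 \<and> (\<forall>w\<in>\<Union> h. \<exists>!f. f \<in> m \<and> w \<in> f)"
    for h m :: "'a set set"
  have "\<exists>m. good h m" if h: "h \<in> hexagons G" for h
  proof -
    have "h \<noteq> {}" using hexagon_card_verts(1)[OF h] by auto
    then obtain e where e: "e \<in> h" by blast
    obtain m where "m \<subseteq> h" "card m = 3" "e \<in> m" "\<forall>w\<in>\<Union> h. \<exists>!f. f \<in> m \<and> w \<in> f"
      using hexagon_matching[OF h e simple] .
    then show ?thesis unfolding good_def by (intro exI[of _ m]) simp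
  qed
  then have "\<forall>h\<in>hexagons G. \<exists>m. good h m" by simp
  from bchoice[OF this] obtain alt where "\<forall>h\<in>hexagons G. good h (alt h)" by blast
  then have alt: "\<And>h. h \<in> hexagons G \<Longrightarrow> alt h \<subseteq> h"
    "\<And>h. h \<in> hexagons G \<Longrightarrow> card (alt h) = 3"
    "\<And>h w. h \<in> hexagons G \<Longrightarrow> w \<in> \<Union> h \<Longrightarrow> \<exists>!f. f \<in> alt h \<and> w \<in> f"
    unfolding good_def by (simp, simp, fast)
  let ?D = "\<lambda>k. {w \<in> \<Union> k. degree G w = 2}"
  define E where "E = ?D ` {k \<in> hexagons G. k \<notin> S \<and> angular G k}"
  define M where "M = (\<Union>s\<in>S. alt s) \<union> E"
  have D_edge: "?D k \<in> edges G" if "angular G k" for k using that unfolding angular_def by auto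
  have D_unc: "?D k \<inter> \<Union> (\<Union> S) = {}" if "k \<in> hexagons G" "k \<notin> S" for k
    using uncovered_verts[OF that S] cov[OF that] by blast
  \<comment> \<open>Edges of \<open>E\<close> avoid all hexagons of \<open>S\<close>, and different
    hexagons of \<open>S\<close> are disjoint; so at a vertex of \<open>s\<close> only the edges of
    \<open>alt s\<close> compete.\<close>
  have altE: "f \<in> alt s" if f: "f \<in> M" "w \<in> f" and s: "s \<in> S" "w \<in> \<Union> s" for f w s
  proof (cases "f \<in> E")
    case True
    then obtain k where "k \<in> hexagons G" "k \<notin> S" "f = ?D k" unfolding E_def by blast
    then have "f \<inter> \<Union> (\<Union> S) = {}" using D_unc by simp
    then show ?thesis using f(2) s by blast
  next
    case False
    then obtain s' where s': "s' \<in> S" "f \<in> alt s'" using f(1) unfolding M_def by blast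
    then have "w \<in> \<Union> s'" using alt(1) S f(2) by blast
    then have "s' = s" using independent_disjoint[OF indep s'(1) s(1)] s(2) by blast
    then show ?thesis using s' by simp
  qed
  have "\<exists>!e. e \<in> M \<and> w \<in> e" if w: "w \<in> verts G" for w
  proof (cases "w \<in> \<Union> (\<Union> S)")
    case True
    then obtain s where s: "s \<in> S" "w \<in> \<Union> s" by blast
    have sG: "s \<in> hexagons G" using s(1) S by blast
    obtain f where f: "f \<in> alt s" "w \<in> f" and uniq: "\<And>g. g \<in> alt s \<and> w \<in> g \<Longrightarrow> g = f"
      using alt(3)[OF sG s(2)] by (elim ex1E) blast
    show ?thesis
    proof (rule ex1I[of _ f])
      show "f \<in> M \<and> w \<in> f" using f s(1) unfolding M_def by blast
      show "g = f" if "g \<in> M \<and> w \<in> g" for g using uniq altE[of g w s] that s by simp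
    qed
  next
    case False
    obtain k where k: "k \<in> hexagons G" "w \<in> \<Union> k" using vertex_in_hexagon[OF w] .
    have kS: "k \<notin> S" using False k(2) by blast
    have wD: "w \<in> ?D k" using uncovered_verts[OF k(1) kS S] cov[OF k(1) kS] False k(2) by blast
    then have "card (?D k) \<noteq> 0" using hexagon_card_verts(2)[OF k(1)] by (metis (no_types, lifting) card_0_eq empty_iff finite_subset mem_Collect_eq subsetI)
    \<comment> \<open>A hexagon with three neighbours has no vertex of degree 2, whereas
      \<open>w\<close> is one.\<close>
    then have ang: "angular G k" using cov[OF k(1) kS] shared_verts(1)[OF k(1)] by auto
    show ?thesis
    proof (rule ex1I[of _ "?D k"])
      show "?D k \<in> M \<and> w \<in> ?D k" using wD ang k(1) kS unfolding M_def E_def by blast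
      show "g = ?D k" if g: "g \<in> M \<and> w \<in> g" for g
      proof -
        have "g \<notin> (\<Union>s\<in>S. alt s)"
        proof
          assume "g \<in> (\<Union>s\<in>S. alt s)"
          then obtain s where "s \<in> S" "g \<in> alt s" by blast
          then have "w \<in> \<Union> (\<Union> S)" using alt(1)[of s] S g by blast
          then show False using False by simp
        qed
        then obtain k' where k': "k' \<in> hexagons G" "g = ?D k'" using g unfolding M_def E_def by blast
        then have "w \<in> \<Union> k'" using g by simp
        then have "k' = k" using degree_2_iff[OF k] wD k'(1) by simp
        then show ?thesis using k' by simp
      qed
    qed
  qed
  moreover have "M \<subseteq> edges G"
  proof
    fix f assume "f \<in> M"
    then consider s where "s \<in> S" "f \<in> alt s" | k where "angular G k" "f = ?D k" unfolding M_def E_def by blast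
    then show "f \<in> edges G"
    proof cases
      case 1
      then have "s \<in> hexagons G" using S by blast
      then show ?thesis using alt(1) hexagon_subset_edges 1 by blast
    qed (use D_edge in simp)
  qed
  ultimately have pm: "perfect_matching G M" unfolding perfect_matching_def by simp
  have "alternating M s" if s: "s \<in> S" for s
  proof -
    have sG: "s \<in> hexagons G" using s S by blast
    have "M \<inter> s = alt s"
    proof
      show "alt s \<subseteq> M \<inter> s" using alt(1)[OF sG] s unfolding M_def by blast
      show "M \<inter> s \<subseteq> alt s"
      proof
        fix f assume f: "f \<in> M \<inter> s"
        then have "card f = 2" using hexagon_subset_edges[OF sG] edge_card by blast
        then obtain w where w: "w \<in> f" by (metis card.empty equals0I zero_neq_numeral)
        then have "w \<in> \<Union> s" using f by blast
        then show "f \<in> alt s" using altE[OF _ w s] f by blast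
      qed
    qed
    then show ?thesis using alt(2)[OF sG] unfolding alternating_def by simp
  qed
  then have "clar_matching G S M" using pm S indep unfolding clar_matching_def by simp
  moreover have "\<forall>k\<in>hexagons G. k \<notin> S \<longrightarrow> angular G k \<longrightarrow> ?D k \<in> M" unfolding M_def E_def by blast
  ultimately show thesis by (rule that)
qed

text \<open>A vertex of degree 2 of the hexagon cannot be matched with a vertex of a neighbour, as the
  latter are matched among themselves.\<close>

lemma angular_if_nbrs_alternating:
  assumes cm: "clar_matching G S M" and a: "a \<in> hexagons G" "a \<notin> S"
    and nS: "nbrs G a \<subseteq> S" and c2: "card (nbrs G a) = 2"
  shows "angular G a"
proof -
  have M: "perfect_matching G M" and S: "S \<subseteq> hexagons G" and alt: "\<And>s. s \<in> S \<Longrightarrow> alternating M s"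
    using cm unfolding clar_matching_def by auto
  let ?D = "{w \<in> \<Union> a. degree G w = 2}"
  have "card ?D = 2" using shared_verts(1)[OF a(1)] c2 by simp
  then obtain p q where pq: "?D = {p, q}" "p \<noteq> q" by (auto simp: card_2_iff)
  have p: "p \<in> \<Union> a" "degree G p = 2" using pq by auto
  have pV: "p \<in> verts G" using hexagon_verts[OF a(1)] p(1) by blast
  have only: "\<forall>h'\<in>hexagons G. p \<in> \<Union> h' \<longrightarrow> h' = a" using degree_2_iff[OF a(1) p(1)] p(2) by simp
  obtain e where e: "e \<in> M" "p \<in> e" using M pV unfolding perfect_matching_def by blast
  have eG: "e \<in> edges G" using e(1) M unfolding perfect_matching_def by blast
  have ea: "e \<in> a"
  proof -
    obtain k where k: "k \<in> hexagons G" "e \<in> k" using edge_in_hexagon[OF eG] .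
    then show ?thesis using only e(2) by (metis UnionI)
  qed
  obtain r where r: "e = {p, r}" "p \<noteq> r" using simple_edgeE[OF simple eG e(2)] .
  have ra: "r \<in> \<Union> a" using ea r by blast
  have "r \<in> ?D"
  proof (rule ccontr)
    assume "r \<notin> ?D"
    then obtain k where k: "k \<in> nbrs G a" "r \<in> \<Union> k" using shared_verts(2)[OF a(1)] ra by blast
    have kS: "k \<in> S" using k(1) nS by blast
    have kG: "k \<in> hexagons G" using kS S by blast
    have "e \<in> k" using alternating_covers[OF M kG alt[OF kS] k(2) e(1)] r by simp
    then have "p \<in> \<Union> k" using e(2) by blast
    then have "k = a" using only kG by simp
    then show False using kS a(2) by simp
  qed
  then have "e = {p, q}" using pq r by auto
  then show ?thesis unfolding angular_def using a(1) c2 pq eG unfolding nbrs_def by blast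
qed

end

context split_graph
begin

text \<open>Keeping \<open>h\<close> out of \<open>SA\<close> serves twice: no hexagon of
  \<open>SA\<close> touches the other side, and none contains the edge \<open>{u, v}\<close> that
  \<open>MA\<close> gives up.\<close>

lemma clar_matching_union:
  assumes A: "clar_matching (induced G VA) SA MA" and B: "clar_matching (induced G VB) SB MB"
    and e: "{u, v} \<in> MA" and hS: "h \<notin> SA"
  shows "clar_matching G (SA \<union> SB) (MB \<union> (MA - {{u, v}}))" "card (SA \<union> SB) = card SA + card SB"
proof -
  have pA: "perfect_matching (induced G VA) MA" and SA: "SA \<subseteq> hexagons (induced G VA)"
    and iA: "independent_hexagons SA" and aA: "\<And>k. k \<in> SA \<Longrightarrow> alternating MA k"
    using A unfolding clar_matching_def by auto
  have pB: "perfect_matching (induced G VB) MB" and SB: "SB \<subseteq> hexagons (induced G VB)"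
    and iB: "independent_hexagons SB" and aB: "\<And>k. k \<in> SB \<Longrightarrow> alternating MB k"
    using B unfolding clar_matching_def by auto
  have sA: "MA \<subseteq> edges (induced G VA)" and sB: "MB \<subseteq> edges (induced G VB)"
    using pA pB unfolding perfect_matching_def by auto
  have AB: "\<Union> k \<inter> \<Union> k' = {}" if "k \<in> SA" "k' \<in> SB" for k k'
    using across(1)[of k k'] that SA SB hS by blast
  let ?M = "MB \<union> (MA - {{u, v}})"
  have ce: "f = {u, v}" if "f \<in> edges (induced G VA)" "f \<in> edges (induced G VB)" for f
    using common_edge that by (metis IntI singletonD)
  have "alternating ?M k" if k: "k \<in> SA" for k
  proof -
    have kA: "k \<in> hexagons (induced G VA)" using k SA by blast
    have kE: "k \<subseteq> edges (induced G VA)" by (rule hexagon_subset_edges[OF kA])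
    have uvk: "{u, v} \<notin> k"
    proof
      assume "{u, v} \<in> k"
      then have "\<Union> k \<inter> \<Union> h' \<noteq> {}" using hh'(4) by blast
      then show False using across(1)[OF kA all_hexagons(4)] k hS by simp
    qed
    have "f \<notin> k" if "f \<in> MB" for f using ce[of f] kE sB uvk that by (metis subsetD)
    then have "?M \<inter> k = MA \<inter> k" using uvk by blast
    then show ?thesis using aA[OF k] unfolding alternating_def by simp
  qed
  moreover have "alternating ?M k" if k: "k \<in> SB" for k
  proof -
    have kB: "k \<in> hexagons (induced G VB)" using k SB by blast
    have kE: "k \<subseteq> edges (induced G VB)" by (rule hexagon_subset_edges[OF kB])
    have "f \<notin> k" if "f \<in> MA - {{u, v}}" for f using ce[of f] kE sA that by (metis DiffE singletonI subsetD)
    then have "?M \<inter> k = MB \<inter> k" by blast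
    then show ?thesis using aB[OF k] unfolding alternating_def by simp
  qed
  moreover have "independent_hexagons (SA \<union> SB)"
    unfolding independent_hexagons_def
  proof (rule pairwiseI)
    fix k k' assume k: "k \<in> SA \<union> SB" "k' \<in> SA \<union> SB" "k \<noteq> k'"
    consider "k \<in> SA" "k' \<in> SA" | "k \<in> SB" "k' \<in> SB" | "k \<in> SA" "k' \<in> SB" | "k \<in> SB" "k' \<in> SA" using k by blast
    then show "\<Union> k \<inter> \<Union> k' = {}"
    proof cases
      case 1 then show ?thesis using independent_disjoint[OF iA] k(3) by simp
    next
      case 2 then show ?thesis using independent_disjoint[OF iB] k(3) by simp
    next
      case 3 then show ?thesis using AB by simp
    next
      case 4
      have "\<Union> k' \<inter> \<Union> k = {}" by (rule AB[OF 4(2,1)])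
      then show ?thesis by blast
    qed
  qed
  moreover have "SA \<union> SB \<subseteq> hexagons G" using SA SB all_hexagons(1) by blast
  ultimately show "clar_matching G (SA \<union> SB) ?M"
    using perfect_matching_union[OF pA pB e] unfolding clar_matching_def by blast
  have "finite SA" "finite SB" "SA \<inter> SB = {}"
    using SA SB all_hexagons(1,2) finite_hex by (auto intro: finite_subset)
  then show "card (SA \<union> SB) = card SA + card SB" by (rule card_Un_disjoint)
qed

end

section \<open>The family attains the bound\<close>

lemma in_family_simple: "in_family B \<Longrightarrow> simple_graph B"
proof (induction rule: in_family.induct)
  case (B1 B e)
  then show ?case unfolding is_B1_def catacondensed_def benzenoid_def by simp
next
  case (glue B' e C)
  then have "simple_graph C" unfolding is_B1_def catacondensed_def benzenoid_def by simp
  then show ?case using glue unfolding simple_graph_def by auto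
qed (simp_all add: catacondensed_def benzenoid_def)

lemma (in catacond) card_nbrs_angular: "angular G a \<Longrightarrow> card (nbrs G a) = 2"
  unfolding angular_def nbrs_def by simp

text \<open>\<open>S\<close> consists of the two outer hexagons. The angular one stays outside, and
  its two vertices of degree 2 are matched along \<open>e\<close>, just as
  \<open>clar_matching_union\<close> requires.\<close>

lemma is_B1_clar_matching:
  assumes "is_B1 C e"
  obtains a S M where "catacondensed C" "a \<in> hexagons C" "e \<in> a" "clar_matching C S M" "card S = 2" "e \<in> M" "a \<notin> S"
proof -
  obtain a where cC: "catacondensed C" and c3: "card (hexagons C) = 3" and ang: "angular C a" and ea: "e \<in> a"
    and deg: "\<forall>v\<in>e. degree C v = 2" using assms unfolding is_B1_def by blast
  interpret catacond C using cC by unfold_locales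
  have a: "a \<in> hexagons C" using ang unfolding angular_def by simp
  have c2: "card (nbrs C a) = 2" by (rule card_nbrs_angular[OF ang])
  then obtain s t where st: "nbrs C a = {s, t}" "s \<noteq> t" by (auto simp: card_2_iff)
  have a_st: "a \<noteq> s" "a \<noteq> t" using dual.irrefl[of a] st by auto
  have sub: "{a, s, t} \<subseteq> hexagons C" using dual.nb_sub[OF a] st a by auto
  have H: "hexagons C = {a, s, t}"
    using sub c3 st(2) a_st finite_hex by (intro card_subset_eq[symmetric]) auto
  have mem: "a \<in> nbrs C s" "a \<in> nbrs C t" using nbrs_sym[OF a] st by auto
  \<comment> \<open>With a third adjacency all three degrees would be at least 2, too much for the
    degree sum 4 of a tree on three vertices.\<close>
  have not_adj: "t \<notin> nbrs C s"
  proof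
    assume t: "t \<in> nbrs C s"
    then have "s \<in> nbrs C t" using nbrs_sym sub by blast
    then have "{a, t} \<subseteq> nbrs C s" "{a, s} \<subseteq> nbrs C t" using mem t by auto
    then have "2 \<le> card (nbrs C s)" "2 \<le> card (nbrs C t)"
      using card_mono[of "nbrs C s" "{a, t}"] card_mono[of "nbrs C t" "{a, s}"] a_st dual.fin_nb sub by auto
    moreover have "card (nbrs C a) + card (nbrs C s) + card (nbrs C t) + 2 = 6"
      using dual.degree_sum c3 a_st st(2) unfolding H by simp
    ultimately show False using c2 by simp
  qed
  have "\<Union> s \<inter> \<Union> t = {}" using not_adj nbrs_iff[of s t] sub st(2) by blast
  then have indep: "independent_hexagons {s, t}"
    unfolding independent_hexagons_def pairwise_def by (auto simp: Int_commute)
  have subS: "{s, t} \<subseteq> hexagons C" using sub by simp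
  have cov: "nbrs C k \<subseteq> {s, t} \<and> (card (nbrs C k) = 3 \<or> angular C k)" if "k \<in> hexagons C" "k \<notin> {s, t}" for k
    using that H st ang by auto
  obtain M where M: "clar_matching C {s, t} M"
    "\<forall>k\<in>hexagons C. k \<notin> {s, t} \<longrightarrow> angular C k \<longrightarrow> {w \<in> \<Union> k. degree C w = 2} \<in> M"
    using clar_matching_of_cover[OF subS indep cov] .
  have D: "{w \<in> \<Union> a. degree C w = 2} \<in> M" using M(2) a ang a_st by auto
  have "card {w \<in> \<Union> a. degree C w = 2} = 2" using shared_verts(1)[OF a] c2 by simp
  moreover have "e \<subseteq> {w \<in> \<Union> a. degree C w = 2}" using ea deg by blast
  moreover have "card e = 2" using edge_card ea hexagon_subset_edges[OF a] by blast
  ultimately have "e = {w \<in> \<Union> a. degree C w = 2}"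
    by (metis (no_types, lifting) card_subset_eq card.infinite zero_neq_numeral)
  then show thesis using that[OF cC a ea M(1)] D st(2) a_st by simp
qed

lemma hexagons_mono: "edges G \<subseteq> edges G' \<Longrightarrow> hexagons G \<subseteq> hexagons G'"
  unfolding hexagons_def by fast

text \<open>Recovers the cut from the bare union of \<open>B'\<close> and \<open>C\<close>. The
  point is to find on the side of \<open>B'\<close> a hexagon that contains \<open>e\<close>, given
  only that the whole union is catacondensed.\<close>

lemma glued_split:
  assumes B: "catacondensed (verts B' \<union> verts C, edges B' \<union> edges C)" (is "catacondensed ?B")
    and sB': "simple_graph B'" and e: "e \<in> edges B'" "\<forall>v\<in>e. degree B' v = 2"
    and cC: "catacondensed C" and a: "a \<in> hexagons C" "e \<in> a" and meet: "verts B' \<inter> verts C = e"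
  obtains u v h' where "e = {u, v}" "split_graph ?B u v (verts C) (verts B') a h'"
    "induced ?B (verts C) = C" "induced ?B (verts B') = B'"
proof -
  interpret catacond ?B using B by unfold_locales
  have sC: "simple_graph C" using cC unfolding catacondensed_def benzenoid_def by simp
  have eB': "f \<subseteq> verts B'" "card f = 2" if "f \<in> edges B'" for f
    using sB' that unfolding simple_graph_def by auto
  have eC: "f \<subseteq> verts C" "card f = 2" if "f \<in> edges C" for f
    using sC that unfolding simple_graph_def by auto
  have "card e = 2" using eB' e(1) by blast
  then obtain u v where uv: "e = {u, v}" "u \<noteq> v" by (auto simp: card_2_iff)
  have only_e: "f = e" if "f \<subseteq> verts B'" "f \<subseteq> verts C" "card f = 2" for f
  proof -
    have "f \<subseteq> e" using that meet by blast
    then show ?thesis using uv that(3) \<open>card e = 2\<close> by (intro card_subset_eq) auto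
  qed
  have aB: "a \<in> hexagons ?B" using a(1) hexagons_mono[of C ?B] by auto
  have aC: "a \<subseteq> edges C" using hexagon_subset_edges[OF a(1)] .
  have aV: "\<Union> a \<subseteq> verts C" using aC eC by blast
  have eC': "e \<in> edges C" using a(2) aC by blast
  have in_uv: "w \<in> {u, v}" if "w \<in> verts B'" "w \<in> verts C" for w using that meet uv by blast
  have side: "f \<subseteq> verts C \<or> f \<subseteq> verts B'" if "f \<in> edges ?B" for f using that eB' eC by auto
  \<comment> \<open>Degree 2 in \<open>B'\<close> provides an edge at \<open>u\<close> leading out
    of \<open>C\<close>; the hexagon through it is the candidate for \<open>h'\<close>.\<close>
  have "\<not> {f \<in> edges B'. u \<in> f} \<subseteq> {e}"
  proof
    assume "{f \<in> edges B'. u \<in> f} \<subseteq> {e}"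
    then have "degree B' u \<le> card {e}" unfolding degree_def by (intro card_mono) auto
    then show False using e(2) uv by simp
  qed
  then obtain f where f: "f \<in> edges B'" "u \<in> f" "f \<noteq> e" by blast
  obtain z where z: "f = {u, z}" "u \<noteq> z" using simple_edgeE[OF sB' f(1,2)] .
  have zB: "z \<in> verts B'" using eB'(1)[OF f(1)] z by blast
  have zC: "z \<notin> verts C" using in_uv[OF zB] z f(3) uv by auto
  have fB: "f \<in> edges ?B" using f(1) by simp
  obtain h' where h': "h' \<in> hexagons ?B" "f \<in> h'" using edge_in_hexagon[OF fB] .
  have fa: "f \<notin> a" using aC eC(1) z zC by blast
  then have ne: "a \<noteq> h'" using h'(2) by blast
  have ua: "u \<in> \<Union> a" using a(2) uv by blast
  have uh': "u \<in> \<Union> h'" using h'(2) f(2) by blast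
  obtain x where x: "{u, x} \<in> a" "{u, x} \<in> h'" "u \<noteq> x" "\<Union> a \<inter> \<Union> h' = {u, x}"
    using common_vertex_edge[OF aB h'(1) ne ua uh'] by metis
  have xC: "x \<in> verts C" using x(1) aV by blast
  have at_u: "{u, y} = {u, x} \<or> y = c" if "h' = hexagon_edges u x b1 b2 b3 c" "distinct [u, x, b1, b2, b3, c]"
      "{u, y} \<in> h'" for y b1 b2 b3 c
    using that unfolding hexagon_edges_def by (auto simp: doubleton_eq_iff)
  obtain b1 b2 b3 c where hd: "distinct [u, x, b1, b2, b3, c]" "h' = hexagon_edges u x b1 b2 b3 c"
    using hexagon_at_edge[OF h'(1) x(2)] .
  have "z \<noteq> x" using zC xC by blast
  then have cz: "c = z" using at_u[OF hd(2,1), of z] h'(2) z by (auto simp: doubleton_eq_iff)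
  have E: "{x, b1} \<in> edges ?B" "{b1, b2} \<in> edges ?B" "{b2, b3} \<in> edges ?B" "{b3, c} \<in> edges ?B"
    using hexagon_subset_edges[OF h'(1)] unfolding hd(2) hexagon_edges_def by auto
  \<comment> \<open>Otherwise \<open>h'\<close> avoids \<open>v\<close>, and the way around
    \<open>h'\<close> from \<open>x\<close> to \<open>z\<close> would leave \<open>C\<close> without
    passing \<open>u\<close> or \<open>v\<close>.\<close>
  have xv: "x = v"
  proof (rule ccontr)
    assume xv: "x \<noteq> v"
    have "v \<notin> \<Union> h'"
    proof
      assume "v \<in> \<Union> h'"
      moreover have "v \<in> \<Union> a" using a(2) uv by blast
      ultimately have "v \<in> {u, x}" using x(4) by blast
      then show False using xv uv by auto
    qed
    then have nv: "v \<notin> {b1, b2, b3, c}" unfolding hd(2) hexagon_edges_verts by auto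
    have step: "q \<in> verts C \<and> q \<notin> {u, v}" if "p \<in> verts C" "p \<notin> {u, v}" "{p, q} \<in> edges ?B" "q \<notin> {u, v}" for p q
    proof -
      have "p \<notin> verts B'" using in_uv that by blast
      then show ?thesis using side[OF that(3)] that(4) by auto
    qed
    have "b1 \<in> verts C \<and> b1 \<notin> {u, v}" by (rule step[OF xC _ E(1)]) (use x(3) xv nv hd(1) in auto)
    then have "b2 \<in> verts C \<and> b2 \<notin> {u, v}" by (intro step[OF _ _ E(2)]) (use nv hd(1) in auto)
    then have "b3 \<in> verts C \<and> b3 \<notin> {u, v}" by (intro step[OF _ _ E(3)]) (use nv hd(1) in auto)
    then have "c \<in> verts C \<and> c \<notin> {u, v}" by (intro step[OF _ _ E(4)]) (use nv hd(1) in auto)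
    then show False using cz zC by simp
  qed
  have h'V: "\<Union> h' \<subseteq> verts B'"
  proof -
    have step: "p \<in> verts B' \<and> p \<notin> verts C" if "q \<notin> verts C" "{p, q} \<in> edges ?B" "p \<notin> {u, v}" for p q
    proof -
      have "p \<in> verts B'" using side[OF that(2)] that(1) by auto
      then show ?thesis using in_uv that(3) by blast
    qed
    have "b3 \<in> verts B' \<and> b3 \<notin> verts C" by (rule step[OF _ E(4)]) (use zC cz hd(1) xv in auto)
    then have b3: "b3 \<in> verts B'" "b3 \<notin> verts C" by auto
    have "b2 \<in> verts B' \<and> b2 \<notin> verts C" by (rule step[OF b3(2) E(3)]) (use hd(1) xv in auto)
    then have b2: "b2 \<in> verts B'" "b2 \<notin> verts C" by auto
    have "b1 \<in> verts B' \<and> b1 \<notin> verts C" by (rule step[OF b2(2) E(2)]) (use hd(1) xv in auto)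
    then show ?thesis unfolding hd(2) hexagon_edges_verts using b2 b3 cz zB eB'(1)[OF e(1)] uv xv by auto
  qed
  have "split_graph ?B u v (verts C) (verts B') a h'"
  proof unfold_locales
    show "verts C \<union> verts B' = verts ?B" by auto
    show "verts C \<inter> verts B' = {u, v}" using meet uv by blast
    show "f \<subseteq> verts C \<or> f \<subseteq> verts B'" if "f \<in> edges ?B" for f using side[OF that] .
    show "a \<in> hexagons ?B" "h' \<in> hexagons ?B" "\<Union> a \<subseteq> verts C" "\<Union> h' \<subseteq> verts B'"
      using aB h' aV h'V by auto
    show "{u, v} \<in> a" "{u, v} \<in> h'" using a(2) uv x(2) xv by auto
  qed
  moreover have "induced ?B (verts C) = C"
  proof -
    have "{f \<in> edges ?B. f \<subseteq> verts C} = edges C"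
    proof
      show "{f \<in> edges ?B. f \<subseteq> verts C} \<subseteq> edges C"
      proof clarify
        fix f assume f: "f \<in> edges ?B" "f \<subseteq> verts C"
        show "f \<in> edges C"
        proof (rule ccontr)
          assume n: "f \<notin> edges C"
          then have "f \<in> edges B'" using f(1) by simp
          then have "f = e" using only_e[OF _ f(2)] eB' by blast
          then show False using n eC' by simp
        qed
      qed
    qed (use eC in auto)
    then show ?thesis unfolding induced_def by (metis prod.collapse)
  qed
  moreover have "induced ?B (verts B') = B'"
  proof -
    have "{f \<in> edges ?B. f \<subseteq> verts B'} = edges B'"
    proof
      show "{f \<in> edges ?B. f \<subseteq> verts B'} \<subseteq> edges B'"
      proof clarify
        fix f assume f: "f \<in> edges ?B" "f \<subseteq> verts B'"
        show "f \<in> edges B'"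
        proof (rule ccontr)
          assume n: "f \<notin> edges B'"
          then have "f \<in> edges C" using f(1) by simp
          then have "f = e" using only_e[OF f(2)] eC by blast
          then show False using n e(1) by simp
        qed
      qed
    qed (use eB' in auto)
    then show ?thesis unfolding induced_def by (metis prod.collapse)
  qed
  ultimately show thesis using that uv(1) by blast
qed

text \<open>The even path vertices form one class of the bipartition of \<open>T_k\<close>; the
  other class will be the Clar set.\<close>

lemma tree_T_edge_parity:
  assumes "{x, y} \<in> edges (tree_T k)"
  shows "x \<in> verts (tree_T k)" "y \<in> verts (tree_T k)"
    "x \<in> {Inl (2 * j) | j. 1 \<le> j \<and> j \<le> k} \<longleftrightarrow> y \<notin> {Inl (2 * j) | j. 1 \<le> j \<and> j \<le> k}"
proof -
  let ?N = "{Inl (2 * j) | j. 1 \<le> j \<and> j \<le> k} :: (nat + nat) set"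
  have N: "Inl i \<in> ?N \<longleftrightarrow> even i" if "1 \<le> i" "i \<le> 2 * k + 1" for i
    using that by (auto elim!: evenE)
  have NR: "Inr i \<notin> ?N" for i by auto
  consider i where "{x, y} = {Inl i, Inl (i + 1)}" "1 \<le> i" "i \<le> 2 * k"
    | j where "{x, y} = {Inl (2 * j), Inr (2 * j)}" "2 \<le> j" "j + 1 \<le> k"
    using assms unfolding tree_T_def by auto
  moreover have both: "x \<in> verts (tree_T k) \<and> y \<in> verts (tree_T k) \<and> (x \<in> ?N \<longleftrightarrow> y \<notin> ?N)"
    if "{x, y} = {a, b}" "a \<in> verts (tree_T k)" "b \<in> verts (tree_T k)" "a \<in> ?N \<longleftrightarrow> b \<notin> ?N" for a b
  proof -
    have "x = a \<and> y = b \<or> x = b \<and> y = a" using that(1) by (simp only: doubleton_eq_iff)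
    then show ?thesis using that(2-4) by (elim disjE conjE) (simp_all only: simp_thms)
  qed
  ultimately have "x \<in> verts (tree_T k) \<and> y \<in> verts (tree_T k) \<and> (x \<in> ?N \<longleftrightarrow> y \<notin> ?N)"
  proof cases
    case 1
    have m: "Inl i \<in> verts (tree_T k)" "Inl (i + 1) \<in> verts (tree_T k)"
      unfolding tree_T_def using 1 by auto
    have p: "(Inl i \<in> ?N) \<longleftrightarrow> Inl (i + 1) \<notin> ?N" using N[of i] N[of "i + 1"] 1 by simp
    show ?thesis by (rule both[OF 1(1) m p])
  next
    case 2
    have m: "Inl (2 * j) \<in> verts (tree_T k)" "Inr (2 * j) \<in> verts (tree_T k)"
      unfolding tree_T_def using 2 by auto
    have p: "Inl (2 * j) \<in> ?N \<longleftrightarrow> Inr (2 * j) \<notin> ?N" using 2 by auto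
    show ?thesis by (rule both[OF 2(1) m p])
  qed
  then show "x \<in> verts (tree_T k)" "y \<in> verts (tree_T k)" "x \<in> ?N \<longleftrightarrow> y \<notin> ?N" by auto
qed

lemma tree_T_card:
  assumes "2 \<le> k"
  shows "card (verts (tree_T k)) = 3 * k - 1" "finite (verts (tree_T k))"
proof -
  have eq: "{Inr (2 * j) | j. 2 \<le> j \<and> j + 1 \<le> k} = (\<lambda>j. Inr (2 * j) :: nat + nat) ` {2..<k}" by auto
  have "card {Inr (2 * j) :: nat + nat | j. 2 \<le> j \<and> j + 1 \<le> k} = k - 2"
    unfolding eq by (subst card_image) (auto simp: inj_on_def)
  moreover have "card (Inl ` {1..2 * k + 1} :: (nat + nat) set) = 2 * k + 1"
    by (subst card_image) (auto simp: inj_on_def)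
  moreover have "Inl ` {1..2 * k + 1} \<inter> {Inr (2 * j) :: nat + nat | j. 2 \<le> j \<and> j + 1 \<le> k} = {}" by auto
  moreover have f: "finite {Inr (2 * j) :: nat + nat | j. 2 \<le> j \<and> j + 1 \<le> k}" unfolding eq by simp
  ultimately show "card (verts (tree_T k)) = 3 * k - 1" unfolding tree_T_def fst_conv
    using assms by (subst card_Un_disjoint) auto
  show "finite (verts (tree_T k))" unfolding tree_T_def using f by simp
qed

text \<open>Outside \<open>S\<close> are the images of the even path vertices: the first and last
  are angular by assumption, the others have three neighbours. The counts are
  \<open>card S = 2 * k - 1\<close> and \<open>3 * k - 1\<close> hexagons, for which the inequality
  is an equality.\<close>

lemma (in catacond) tree_T_clar_matching:
  assumes k: "2 \<le> k" and iso: "graph_iso f (tree_T k) (dualist G)"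
    and ang: "angular G (f (Inl 2))" "angular G (f (Inl (2 * k)))"
  obtains S M where "clar_matching G S M" "2 * card (hexagons G) \<le> 3 * card S + 1"
proof -
  let ?V = "verts (tree_T k)" and ?E = "edges (tree_T k)"
  let ?N = "{Inl (2 * j) | j. 1 \<le> j \<and> j \<le> k} :: (nat + nat) set"
  have bij: "bij_betw f ?V (hexagons G)" and im: "(\<lambda>e. f ` e) ` ?E = edges (dualist G)"
    using iso unfolding graph_iso_def dualist_def by auto
  have inj: "inj_on f ?V" and img: "f ` ?V = hexagons G" using bij unfolding bij_betw_def by auto
  have adj: "f y \<in> nbrs G (f x) \<longleftrightarrow> {x, y} \<in> ?E" if xy: "x \<in> ?V" "y \<in> ?V" for x y
  proof
    assume a: "f y \<in> nbrs G (f x)"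
    have "f x \<in> hexagons G" using img xy by blast
    then have "{f x, f y} \<in> edges (dualist G)" using a unfolding nbrs_def dualist_def by auto
    then have "{f x, f y} \<in> (\<lambda>e. f ` e) ` ?E" unfolding im .
    then obtain e where "{f x, f y} = f ` e" and e1: "e \<in> ?E" by (rule imageE)
    then have e: "e \<in> ?E" "f ` e = f ` {x, y}" by simp_all
    obtain p q where pq: "e = {p, q}" using e(1) unfolding tree_T_def by auto
    have "e \<subseteq> ?V" using tree_T_edge_parity(1,2)[of p q k] e(1) pq by simp
    then have "e = {x, y}" using inj_on_image_eq_iff[OF inj] xy e(2) by (metis empty_subsetI insert_subset)
    then show "{x, y} \<in> ?E" using e by simp
  next
    assume "{x, y} \<in> ?E"
    then have "f ` {x, y} \<in> edges (dualist G)" using im by blast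
    then obtain h h' where h: "{f x, f y} = {h, h'}" "h' \<in> nbrs G h" "h \<in> hexagons G"
      unfolding dualist_def nbrs_def by auto
    then show "f y \<in> nbrs G (f x)" using nbrs_sym[OF h(3,2)] by (metis doubleton_eq_iff)
  qed
  define S where "S = f ` (?V - ?N)"
  have NV: "?N \<subseteq> ?V" unfolding tree_T_def by auto
  have SH: "S \<subseteq> hexagons G" unfolding S_def using img by blast
  have indep: "independent_hexagons S"
    unfolding independent_hexagons_def
  proof (rule pairwiseI, rule ccontr)
    fix h h' assume h: "h \<in> S" "h' \<in> S" "h \<noteq> h'" "\<Union> h \<inter> \<Union> h' \<noteq> {}"
    then have "h' \<in> nbrs G h" using nbrs_iff SH by blast
    moreover obtain x y where xy: "h = f x" "h' = f y" "x \<in> ?V - ?N" "y \<in> ?V - ?N" using h unfolding S_def by blast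
    ultimately have "{x, y} \<in> ?E" using adj[of x y] by simp
    then show False using tree_T_edge_parity(3)[of x y k] xy by blast
  qed
  have cov: "nbrs G h \<subseteq> S \<and> (card (nbrs G h) = 3 \<or> angular G h)" if h: "h \<in> hexagons G" "h \<notin> S" for h
  proof -
    obtain x where x: "x \<in> ?V" "h = f x" using h(1) img by blast
    then have xN: "x \<in> ?N" using h(2) unfolding S_def by blast
    then obtain j where j: "x = Inl (2 * j)" "1 \<le> j" "j \<le> k" by blast
    have "nbrs G h \<subseteq> S"
    proof
      fix h' assume h': "h' \<in> nbrs G h"
      then have "h' \<in> hexagons G" unfolding nbrs_def by simp
      then obtain y where y: "y \<in> ?V" "h' = f y" using img by blast
      then have "{x, y} \<in> ?E" using adj[OF x(1) y(1)] h' x(2) by simp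
      then have "y \<notin> ?N" using tree_T_edge_parity(3)[of x y k] xN by simp
      then show "h' \<in> S" using y unfolding S_def by blast
    qed
    moreover have "card (nbrs G h) = 3 \<or> angular G h"
    proof (cases "j = 1 \<or> j = k")
      case True
      then show ?thesis using ang x(2) j(1) by auto
    next
      case False
      then have jj: "2 \<le> j" "j + 1 \<le> k" using j by auto
      let ?Y = "{Inl (2 * j - 1), Inl (2 * j + 1), Inr (2 * j)} :: (nat + nat) set"
      have "{Inl (2 * j - 1), Inl (2 * j - 1 + 1)} \<in> ?E" "{Inl (2 * j), Inl (2 * j + 1)} \<in> ?E"
        "{Inl (2 * j), Inr (2 * j)} \<in> ?E"
      proof -
        have "1 \<le> 2 * j - 1 \<and> 2 * j - 1 \<le> 2 * k" "1 \<le> 2 * j \<and> 2 * j \<le> 2 * k" using jj by auto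
        then show "{Inl (2 * j - 1), Inl (2 * j - 1 + 1)} \<in> ?E" "{Inl (2 * j), Inl (2 * j + 1)} \<in> ?E"
          unfolding tree_T_def snd_conv by blast+
        show "{Inl (2 * j), Inr (2 * j)} \<in> ?E" unfolding tree_T_def snd_conv using jj by blast
      qed
      then have E: "{x, y} \<in> ?E" if "y \<in> ?Y" for y using that j jj by (auto simp: insert_commute)
      then have YV: "?Y \<subseteq> ?V" using tree_T_edge_parity(2) by blast
      have "f ` ?Y \<subseteq> nbrs G h" using adj[OF x(1)] E YV x(2) by blast
      moreover have "card (f ` ?Y) = 3"
      proof -
        have "card ?Y = 3" using jj by auto
        then show ?thesis using card_image[OF inj_on_subset[OF inj YV]] by simp
      qed
      ultimately have "3 \<le> card (nbrs G h)" using card_mono[OF dual.fin_nb[OF h(1)]] by metis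
      then show ?thesis using dual.degree_le[OF h(1)] by simp
    qed
    ultimately show ?thesis by simp
  qed
  obtain M where M: "clar_matching G S M"
    "\<forall>k\<in>hexagons G. k \<notin> S \<longrightarrow> angular G k \<longrightarrow> {w \<in> \<Union> k. degree G w = 2} \<in> M"
    using clar_matching_of_cover[OF SH indep cov] .
  have "?N = (\<lambda>j. Inl (2 * j)) ` {1..k}" by auto
  then have cN: "card ?N = k" "finite ?N" by (auto simp: card_image inj_on_def)
  have "card S = card (?V - ?N)" unfolding S_def by (rule card_image) (rule inj_on_subset[OF inj], blast)
  also have "\<dots> = 3 * k - 1 - k" using card_Diff_subset[OF cN(2) NV] cN(1) tree_T_card[OF k] by simp
  finally have cS: "card S = 2 * k - 1" by simp
  have "card (hexagons G) = 3 * k - 1" using bij_betw_same_card[OF bij] tree_T_card[OF k] by simp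
  then have "2 * card (hexagons G) \<le> 3 * card S + 1" using cS k by simp
  then show thesis using that M(1) by blast
qed

text \<open>Being catacondensed is a separate premise, as membership in the family need not provide
  it. In case \<open>glue\<close> it passes to \<open>B'\<close> because \<open>B'\<close> is one
  side of a cut of the union.\<close>

lemma family_clar_matching:
  "in_family B \<Longrightarrow> catacondensed B \<Longrightarrow> \<exists>S M. clar_matching B S M \<and> 2 * card (hexagons B) \<le> 3 * card S + 1"
proof (induction rule: in_family.induct)
  case (one B)
  interpret catacond B using one.prems by unfold_locales
  obtain h where h: "hexagons B = {h}" using one by (auto simp: card_1_singleton_iff)
  have "independent_hexagons {h}" unfolding independent_hexagons_def by simp
  then obtain M where "clar_matching B {h} M"
    using clar_matching_of_cover[of "{h}"] h by (metis order_refl)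
  then show ?case using h by (intro exI[of _ "{h}"]) auto
next
  case (two B)
  interpret catacond B using two.prems by unfold_locales
  obtain h h' where h: "hexagons B = {h, h'}" "h \<noteq> h'" using two by (auto simp: card_2_iff)
  have "h' \<in> nbrs B h"
  proof (rule ccontr)
    assume "h' \<notin> nbrs B h"
    then have "nbrs B h = {}" using dual.nb_sub[of h] dual.irrefl[of h] h by auto
    then show False using hexagons_connected[of "{h}"] h by auto
  qed
  then obtain u v where "h \<inter> h' = {{u, v}}" using nbrs_edge[of h h'] h(1) by (metis insertI1)
  then have uv: "{u, v} \<in> h" "{u, v} \<in> h'" by auto
  have hh: "h \<in> hexagons B" "h' \<in> hexagons B" using h by auto
  obtain VA VB where s: "split_graph B u v VA VB h h'" using split_exists[OF hh h(2) uv] .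
  interpret A: split_graph B u v VA VB h h' by (rule s)
  interpret B: split_graph B u v VB VA h' h by (rule A.swap)
  interpret CB: catacond "induced B VB" using B.catacondensed_side by unfold_locales
  have "hexagons (induced B VB) \<subseteq> {h, h'}" using A.all_hexagons(1) h(1) by (metis Un_upper2)
  moreover have "h \<notin> hexagons (induced B VB)" using A.all_hexagons(2,3) by (metis IntI empty_iff)
  ultimately have hB: "hexagons (induced B VB) = {h'}" using A.all_hexagons(4) by blast
  have "independent_hexagons {h'}" unfolding independent_hexagons_def by simp
  then obtain MB where MB: "clar_matching (induced B VB) {h'} MB"
    using CB.clar_matching_of_cover[of "{h'}"] hB by (metis order_refl)
  have "{u, v} \<in> edges (induced B VA) \<inter> edges (induced B VB)" unfolding A.common_edge by simp
  \<comment> \<open>The hexagon \<open>h\<close> stays out of the Clar set, so its side takes any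
    perfect matching through \<open>{u, v}\<close>, paired with the empty set.\<close>
  then obtain MA where MA: "perfect_matching (induced B VA) MA" "{u, v} \<in> MA"
    using matching_containing_edge[OF A.catacondensed_side] by blast
  then have "clar_matching (induced B VA) {} MA" unfolding clar_matching_def independent_hexagons_def by simp
  then have "clar_matching B ({} \<union> {h'}) (MB \<union> (MA - {{u, v}}))"
    by (rule A.clar_matching_union(1)[OF _ MB MA(2)]) simp
  then show ?case using h by (intro exI[of _ "{h'}"]) auto
next
  case (B1 B e)
  obtain a S M where "clar_matching B S M" "card S = 2" using is_B1_clar_matching[OF B1(1)] by metis
  moreover have "card (hexagons B) = 3" using B1(1) unfolding is_B1_def by simp
  ultimately show ?case by (intro exI[of _ S] exI[of _ M]) simp
next
  case (Tk B k f)
  interpret catacond B using Tk.prems by unfold_locales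
  show ?case using tree_T_clar_matching[OF Tk(2-5)] by metis
next
  case (glue B' e C)
  let ?B = "(verts B' \<union> verts C, edges B' \<union> edges C)"
  obtain a S M where C: "catacondensed C" "a \<in> hexagons C" "e \<in> a" "clar_matching C S M" "card S = 2" "e \<in> M" "a \<notin> S"
    using is_B1_clar_matching[OF glue(4)] .
  obtain u v h' where s: "e = {u, v}" "split_graph ?B u v (verts C) (verts B') a h'"
    "induced ?B (verts C) = C" "induced ?B (verts B') = B'"
    using glued_split[OF glue.prems in_family_simple[OF glue(1)] glue(2,3) C(1-3) glue(5)] .
  interpret A: split_graph ?B u v "verts C" "verts B'" a h' by (rule s(2))
  interpret B: split_graph ?B u v "verts B'" "verts C" h' a by (rule A.swap)
  have "catacondensed B'" using B.catacondensed_side unfolding s(4) .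
  then obtain S' M' where S': "clar_matching B' S' M'" "2 * card (hexagons B') \<le> 3 * card S' + 1"
    using glue.IH by blast
  have u: "clar_matching ?B (S \<union> S') (M' \<union> (M - {{u, v}}))" "card (S \<union> S') = card S + card S'"
    using A.clar_matching_union[of S M S' M'] C(4,6,7) S'(1) s by simp_all
  have "card (hexagons C) = 3" using glue(4) unfolding is_B1_def by simp
  then have "card (hexagons ?B) = 3 + card (hexagons B')" using A.card_hexagons s(3,4) by simp
  then have "2 * card (hexagons ?B) \<le> 3 * card (S \<union> S') + 1" using u(2) C(5) S'(2) by simp
  then show ?case using u(1) by blast
qed

section \<open>The extremal graphs belong to the family\<close>

text \<open>Every vertex of the side of \<open>a\<close> other than \<open>u\<close> and \<open>v\<close> is matched inside \<open>s\<close> or \<open>t\<close>, so the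
  matching restricts to the other side.\<close>

lemma (in catacond) reduction:
  assumes cm: "clar_matching G S M" and a: "a \<in> hexagons G" "a \<notin> S" and c3: "card (nbrs G a) = 3"
    and st: "s \<in> nbrs G a" "t \<in> nbrs G a" "s \<noteq> t" "s \<in> S" "t \<in> S" "nbrs G s = {a}" "nbrs G t = {a}"
  obtains u v VA VB c where "split_graph G u v VA VB a c" "is_B1 (induced G VA) {u, v}"
    "clar_matching (induced G VB) (S - {s, t}) (M \<inter> edges (induced G VB))"
    "card (hexagons (induced G VA)) = 3"
proof -
  have M: "perfect_matching G M" and S: "S \<subseteq> hexagons G" and indep: "independent_hexagons S"
    and alt: "\<And>k. k \<in> S \<Longrightarrow> alternating M k" using cm unfolding clar_matching_def by auto
  have fn: "finite (nbrs G a)" by (rule dual.fin_nb[OF a(1)])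
  \<comment> \<open>The cut is made between \<open>a\<close> and its third neighbour
    \<open>c\<close>; then \<open>a\<close>, \<open>s\<close> and \<open>t\<close> make up one
    side.\<close>
  have "card (nbrs G a - {s, t}) = 1" using c3 st(1-3) by (subst card_Diff_subset) auto
  then have "nbrs G a - {s, t} \<noteq> {}" by (metis card.empty zero_neq_one)
  then obtain c where cn: "c \<in> nbrs G a" and cst: "c \<noteq> s" "c \<noteq> t" by blast
  have "{s, t, c} \<subseteq> nbrs G a" "card {s, t, c} = card (nbrs G a)" using st(1-3) cn cst c3 by auto
  then have nb: "nbrs G a = {s, t, c}" by (rule card_subset_eq[OF fn, symmetric])
  have c: "c \<in> hexagons G" "a \<noteq> c" using nbrs_iff[OF a(1), of c] nb by auto
  have ast: "a \<noteq> s" "a \<noteq> t" using a(2) st by auto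
  have sG: "s \<in> hexagons G" "t \<in> hexagons G" using st S by auto
  obtain u v where "a \<inter> c = {{u, v}}" using nbrs_edge[OF a(1), of c] nb by (metis insertCI)
  then have uv: "{u, v} \<in> a" "{u, v} \<in> c" by auto
  obtain VA VB where split: "split_graph G u v VA VB a c" using split_exists[OF a(1) c uv] .
  interpret A: split_graph G u v VA VB a c by (rule split)
  interpret B: split_graph G u v VB VA c a by (rule A.swap)
  let ?A = "induced G VA" and ?B = "induced G VB"
  interpret CA: catacond ?A using A.catacondensed_side by unfold_locales
  have in_A: "k \<in> hexagons ?A" if "k \<in> hexagons G" "k \<in> nbrs G a" "k \<noteq> c" for k
  proof (rule ccontr)
    assume "k \<notin> hexagons ?A"
    then have "k \<in> hexagons ?B" using A.all_hexagons(1) that(1) by blast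
    moreover have "\<Union> a \<inter> \<Union> k \<noteq> {}" using nbrs_iff[OF a(1)] that(2) by simp
    ultimately show False using A.across(2)[OF A.all_hexagons(3)] that(3) by simp
  qed
  have stA: "s \<in> hexagons ?A" "t \<in> hexagons ?A" using in_A sG st cst by auto
  have cA: "c \<notin> hexagons ?A" using A.all_hexagons(2,4) by (metis IntI empty_iff)
  have nbA: "nbrs ?A a = {s, t}"
  proof -
    have e: "nbrs ?A a \<union> {c} = {s, t, c}" using A.nbrs_side[OF A.all_hexagons(3)] nb by simp
    have "c \<notin> nbrs ?A a" using cA unfolding nbrs_def by simp
    then have "nbrs ?A a = (nbrs ?A a \<union> {c}) - {c}" by blast
    also have "\<dots> = {s, t}" unfolding e using cst by auto
    finally show ?thesis .
  qed
  have "nbrs ?A s = {a}" "nbrs ?A t = {a}"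
    using A.nbrs_side[OF stA(1)] A.nbrs_side[OF stA(2)] st(6,7) ast by simp_all
  then have HA: "{a, s, t} = hexagons ?A"
    using CA.hexagons_connected[of "{a, s, t}"] nbA A.all_hexagons(3) stA by auto
  have cardA: "card (hexagons ?A) = 3" unfolding HA[symmetric] using ast st(3) by simp
  let ?D = "{w \<in> \<Union> a. degree ?A w = 2}"
  have "card ?D = 2" using CA.shared_verts(1)[OF A.all_hexagons(3)] nbA st(3) by simp
  moreover have "{u, v} \<subseteq> ?D" using A.degree_side uv(1) by auto
  moreover have "card {u, v} = 2" using A.uv(2) by simp
  ultimately have D: "?D = {u, v}" by (metis (no_types, lifting) card_subset_eq card.infinite zero_neq_numeral)
  have uvA: "{u, v} \<in> edges ?A" using hexagon_subset_edges[OF A.all_hexagons(3)] uv(1) by blast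
  have "?D = {u, v} \<and> u \<noteq> v \<and> {u, v} \<in> edges ?A" using D A.uv(2) uvA by (intro conjI)
  then have "\<exists>u v. ?D = {u, v} \<and> u \<noteq> v \<and> {u, v} \<in> edges ?A" by (intro exI)
  moreover have "card {h' \<in> hexagons ?A. adjacent_hexagons a h'} = 2" using nbA st(3) unfolding nbrs_def by simp
  ultimately have "angular ?A a" unfolding angular_def using A.all_hexagons(3) by (intro conjI)
  then have B1: "is_B1 ?A {u, v}"
    unfolding is_B1_def using A.catacondensed_side cardA uv(1) A.degree_side by blast
  have matched_B: "e \<in> edges ?B" if e: "e \<in> M" "w \<in> e" "w \<in> VB" for e w
  proof (rule ccontr)
    assume n: "e \<notin> edges ?B"
    have eG: "e \<in> edges G" using e(1) M unfolding perfect_matching_def by blast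
    then have eA: "e \<in> edges ?A" using n A.all_edges by blast
    then have "w \<in> VA" using e(2) by auto
    then have w: "w \<in> {u, v}" using e(3) A.meet by blast
    obtain k where k: "k \<in> hexagons G" "e \<in> k" using edge_in_hexagon[OF eG] .
    have "u \<in> \<Union> k \<or> v \<in> \<Union> k" using w k(2) e(2) by blast
    then have "k = a \<or> k = c" by (rule A.hexagon_at_cut[OF k(1)])
    moreover have "k \<noteq> c"
    proof
      assume "k = c"
      then have "e \<subseteq> VB" using k(2) A.sides(2) by blast
      then show False using n eG by simp
    qed
    ultimately have ea: "e \<in> a" using k(2) by simp
    obtain r where r: "e = {w, r}" "w \<noteq> r" using simple_edgeE[OF simple eG e(2)] .
    have "r \<notin> {u, v}"
    proof
      assume "r \<in> {u, v}"
      then have "e \<subseteq> VB" using r w A.meet by blast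
      then show False using n eG by simp
    qed
    moreover have "r \<in> \<Union> a" using ea r by blast
    \<comment> \<open>On this side \<open>u\<close> and \<open>v\<close> are the only vertices of
      \<open>a\<close> off \<open>s\<close> and \<open>t\<close>. So \<open>r\<close> is matched
      inside \<open>s\<close> or \<open>t\<close>, which would put its partner \<open>w\<close>, an
      end of the cut, into a hexagon that misses the cut.\<close>
    ultimately have "r \<in> (\<Union>k'\<in>nbrs ?A a. \<Union> k')"
      using D CA.shared_verts(2)[OF A.all_hexagons(3)] by blast
    then obtain k' where k': "k' \<in> {s, t}" "r \<in> \<Union> k'" unfolding nbA by blast
    then have k'S: "k' \<in> S" "k' \<in> hexagons G" using st(4,5) sG by auto
    have "r \<in> e" using r by simp
    then have "e \<in> k'" using alternating_covers[OF M k'S(2) alt[OF k'S(1)] k'(2) e(1)] by simp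
    then have "u \<in> \<Union> k' \<or> v \<in> \<Union> k'" using w e(2) by blast
    then have "k' = a \<or> k' = c" by (rule A.hexagon_at_cut[OF k'S(2)])
    then show False using k'(1) ast cst by auto
  qed
  let ?M = "M \<inter> edges ?B"
  have "perfect_matching ?B ?M"
    unfolding perfect_matching_def
  proof (intro conjI ballI)
    fix w assume "w \<in> verts ?B"
    then have w: "w \<in> VB" by simp
    then have "w \<in> verts G" using A.cover by blast
    then obtain e where e: "e \<in> M" "w \<in> e" "\<And>f. f \<in> M \<Longrightarrow> w \<in> f \<Longrightarrow> f = e"
      using M unfolding perfect_matching_def by blast
    show "\<exists>!e. e \<in> ?M \<and> w \<in> e"
    proof (rule ex1I[of _ e])
      show "e \<in> ?M \<and> w \<in> e" using e(1,2) matched_B[OF e(1,2) w] by blast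
      show "f = e" if "f \<in> ?M \<and> w \<in> f" for f using e(3)[of f] that by blast
    qed
  qed simp
  moreover have SB: "S - {s, t} \<subseteq> hexagons ?B"
  proof
    fix k assume k: "k \<in> S - {s, t}"
    then have "k \<notin> hexagons ?A" unfolding HA[symmetric] using a(2) by auto
    then show "k \<in> hexagons ?B" using k S A.all_hexagons(1) by blast
  qed
  moreover have "independent_hexagons (S - {s, t})"
    using indep unfolding independent_hexagons_def by (rule pairwise_subset) blast
  moreover have "\<forall>k\<in>S - {s, t}. alternating ?M k"
  proof
    fix k assume k: "k \<in> S - {s, t}"
    then have "k \<subseteq> edges ?B" using SB hexagon_subset_edges by blast
    then have "?M \<inter> k = M \<inter> k" by blast
    then show "alternating ?M k" using alt[of k] k unfolding alternating_def by simp
  qed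
  ultimately have "clar_matching ?B (S - {s, t}) ?M" unfolding clar_matching_def by simp
  then show thesis using that split B1 cardA by blast
qed

text \<open>The cases beyond two hexagons follow the last two hypotheses of
  \<open>rigid_structure\<close>. Each of them fails through a copy of \<open>B1\<close>: the first
  by being the whole graph, the second by being cut off, which leaves a smaller extremal
  graph.\<close>

lemma clar_matching_family:
  assumes "catacondensed G" "clar_matching G S M" "2 * card (hexagons G) \<le> 3 * card S + 1"
  shows "in_family G"
  using assms
proof (induction "card (hexagons G)" arbitrary: G S M rule: less_induct)
  case less
  interpret catacond G using less.prems(1) by unfold_locales
  have cm: "clar_matching G S M" by (rule less.prems(2))
  have S: "S \<subseteq> hexagons G" and iS: "independent_hexagons S" using cm unfolding clar_matching_def by auto
  have indep: "\<And>s. s \<in> S \<Longrightarrow> nbrs G s \<inter> S = {}" by (rule independent_nbrs[OF S iS])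
  have ang: "angular G a" if "a \<in> hexagons G - S" "nbrs G a \<subseteq> S" "card (nbrs G a) = 2" for a
    using angular_if_nbrs_alternating[OF cm] that by blast
  have pos: "card (hexagons G) \<noteq> 0" using hexagons_nonempty finite_hex by simp
  show ?case
  proof (cases "card (hexagons G) \<le> 2")
    case True
    then have "card (hexagons G) = 1 \<or> card (hexagons G) = 2" using pos by linarith
    then show ?thesis using in_family.one in_family.two less.prems(1) by blast
  next
    case False
    then have n3: "3 \<le> card (hexagons G)" by simp
    consider (B1) a where "a \<in> hexagons G - S" "nbrs G a \<subseteq> dual.leaves \<inter> S" "card (nbrs G a) = 2"
      | (red) a s t where "a \<in> hexagons G - S" "card (nbrs G a) = 3" "s \<in> nbrs G a" "t \<in> nbrs G a"
        "s \<in> dual.leaves \<inter> S" "t \<in> dual.leaves \<inter> S" "s \<noteq> t"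
      | (rigid) "\<And>a. a \<in> hexagons G - S \<Longrightarrow> nbrs G a \<subseteq> dual.leaves \<inter> S \<Longrightarrow> card (nbrs G a) \<noteq> 2"
        "\<And>a s t. a \<in> hexagons G - S \<Longrightarrow> card (nbrs G a) = 3 \<Longrightarrow> s \<in> nbrs G a \<Longrightarrow> t \<in> nbrs G a \<Longrightarrow>
          s \<in> dual.leaves \<inter> S \<Longrightarrow> t \<in> dual.leaves \<inter> S \<Longrightarrow> s = t"
      by blast
    then show ?thesis
    proof cases
      case B1
      then have a: "a \<in> hexagons G" by simp
      obtain s t where st: "nbrs G a = {s, t}" "s \<noteq> t" using B1(3) by (auto simp: card_2_iff)
      have leaf: "nbrs G k = {a}" if "k \<in> {s, t}" for k
        using dual.leaf_nb[of k a] nbrs_sym[OF a, of k] B1(2) that st(1) by blast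
      have a_st: "a \<notin> {s, t}" using dual.irrefl[of a] st by simp
      have "{a, s, t} = hexagons G"
      proof (rule hexagons_connected)
        show "{a, s, t} \<subseteq> hexagons G" using a dual.nb_sub[OF a] st(1) by simp
        fix k assume "k \<in> {a, s, t}"
        then consider "k = a" | "k \<in> {s, t}" by blast
        then show "nbrs G k \<subseteq> {a, s, t}" using st(1) leaf[of k] by cases simp_all
      qed simp
      then have c3: "card (hexagons G) = 3" using a_st st(2) by (metis card_3_iff insertCI)
      have anga: "angular G a" using ang[of a] B1 by blast
      then obtain u v where D: "{w \<in> \<Union> a. degree G w = 2} = {u, v}" "u \<noteq> v" "{u, v} \<in> edges G"
        unfolding angular_def by blast
      obtain k where k: "k \<in> hexagons G" "{u, v} \<in> k" using edge_in_hexagon[OF D(3)] .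
      have u: "u \<in> \<Union> a" "degree G u = 2" using D(1) by auto
      then have "k = a" using degree_2_iff[OF a u(1)] k by blast
      moreover have "\<forall>w\<in>{u, v}. degree G w = 2" using D(1) by auto
      ultimately have "is_B1 G {u, v}" unfolding is_B1_def using less.prems(1) c3 anga k(2) by blast
      then show ?thesis by (rule in_family.B1)
    next
      case red
      have aG: "a \<in> hexagons G" "a \<notin> S" using red by auto
      have leaf: "nbrs G k = {a}" if "k \<in> {s, t}" for k
        using dual.leaf_nb[of k a] nbrs_sym[OF aG(1), of k] red that by blast
      have sS: "s \<in> S" "t \<in> S" using red by auto
      obtain u v VA VB c where split: "split_graph G u v VA VB a c" and B1: "is_B1 (induced G VA) {u, v}"
        and cmB: "clar_matching (induced G VB) (S - {s, t}) (M \<inter> edges (induced G VB))"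
        and c3: "card (hexagons (induced G VA)) = 3"
        using reduction[OF cm aG red(2,3,4,7) sS leaf[of s] leaf[of t]] by blast
      interpret A: split_graph G u v VA VB a c by (rule split)
      interpret B: split_graph G u v VB VA c a by (rule A.swap)
      have "finite S" using S finite_hex finite_subset by blast
      then have cS: "card (S - {s, t}) = card S - 2" "2 \<le> card S"
        using sS red(7) card_mono[of S "{s, t}"] by (auto simp: card_Diff_subset)
      \<comment> \<open>Three hexagons and two members of \<open>S\<close> are gone, so both sides
        of the extremal inequality drop by 6.\<close>
      have small: "2 * card (hexagons (induced G VB)) \<le> 3 * card (S - {s, t}) + 1"
        using A.card_hexagons c3 less.prems(3) cS by simp
      have fam: "in_family (induced G VB)"
        by (rule less.hyps[OF B.side_smaller B.catacondensed_side cmB small])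
      have "{u, v} \<in> edges (induced G VB)" using A.common_edge by blast
      then have "in_family (verts (induced G VB) \<union> verts (induced G VA), edges (induced G VB) \<union> edges (induced G VA))"
        by (rule in_family.glue[OF fam _ _ B1]) (use B.degree_side B.meet in auto)
      moreover have "(verts (induced G VB) \<union> verts (induced G VA), edges (induced G VB) \<union> edges (induced G VA)) = G"
        using B.cover B.all_edges by (simp add: prod_eq_iff)
      ultimately show ?thesis by simp
    next
      case rigid
      have rs: "dual.leaves \<subseteq> S" "card {a \<in> hexagons G - S. card (nbrs G a) = 2} = 2"
        "\<And>a. a \<in> hexagons G - S \<Longrightarrow> nbrs G a \<subseteq> S"
        "\<And>a. a \<in> hexagons G - S \<Longrightarrow> card (nbrs G a) = 2 \<or> card (nbrs G a) = 3"
        "\<And>a. a \<in> hexagons G - S \<Longrightarrow> \<exists>l. nbrs G a \<inter> dual.leaves = {l}"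
        "\<And>s. s \<in> S \<Longrightarrow> card (nbrs G s) = 1 \<or> card (nbrs G s) = 2"
        by ((rule dual.rigid_structure[OF S _ less.prems(3) n3]; (assumption | rule indep rigid)+))+
      obtain k f where k: "2 \<le> k" and bij: "bij_betw f (verts (tree_T k)) (hexagons G)"
        and E: "(\<lambda>e. f ` e) ` edges (tree_T k) = {{h, h'} | h h'. h \<in> hexagons G \<and> h' \<in> nbrs G h}"
        and f2: "f (Inl 2) \<in> hexagons G - S" "card (nbrs G (f (Inl 2))) = 2"
          "f (Inl (2 * k)) \<in> hexagons G - S" "card (nbrs G (f (Inl (2 * k)))) = 2"
        using dual.tree_T_iso[OF S indep rs] .
      have "edges (dualist G) = {{h, h'} | h h'. h \<in> hexagons G \<and> h' \<in> nbrs G h}"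
        unfolding dualist_def nbrs_def by (simp add: conj_assoc)
      then have "graph_iso f (tree_T k) (dualist G)"
        unfolding graph_iso_def using bij E by (simp add: dualist_def)
      then show ?thesis
        using in_family.Tk[OF less.prems(1) k] ang[OF f2(1) rs(3)[OF f2(1)] f2(2)]
          ang[OF f2(3) rs(3)[OF f2(3)] f2(4)] by blast
    qed
  qed
qed

theorem theorem4p3:
  fixes B :: "'a graph" and n :: nat
  assumes "catacondensed B" and "card (hexagons B) = n"
  shows "clar_number B \<le> (2 * n + 1) div 3 \<and>
    (clar_number B = (2 * n + 1) div 3 \<longleftrightarrow> in_family B)"
proof -
  interpret catacond B using assms(1) by unfold_locales
  obtain S M where SM: "clar_matching B S M" "card S = clar_number B" using clar_number_props(1) by blast
  have bound: "3 * clar_number B \<le> 2 * n + 1" using clar_bound[OF SM(1)] SM(2) assms(2) by simp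
  \<comment> \<open>A number \<open>c\<close> with \<open>3 * c \<le> 2 * n + 1\<close> is the floor
    exactly when \<open>2 * n + 1 \<le> 3 * c + 2\<close>.\<close>
  then have eq: "clar_number B = (2 * n + 1) div 3 \<longleftrightarrow> 2 * n \<le> 3 * clar_number B + 1" by linarith
  have "2 * n \<le> 3 * clar_number B + 1 \<longleftrightarrow> in_family B"
  proof
    assume "2 * n \<le> 3 * clar_number B + 1"
    then show "in_family B" using clar_matching_family[OF assms(1) SM(1)] SM(2) assms(2) by simp
  next
    assume "in_family B"
    then obtain S' M' where "clar_matching B S' M'" "2 * n \<le> 3 * card S' + 1"
      using family_clar_matching assms by blast
    then show "2 * n \<le> 3 * clar_number B + 1" using clar_number_props(2) by fastforce
  qed
  then show ?thesis using bound eq by linarith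
qed

end
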